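(* Let $\theta$ be an inner function. If $R$ is a rational function that is continuous on $\mathbb T$, then $$\sigma(D_R^\theta)=R(\mathbb T)\cup\sigma_p(D_R^\theta)=\sigma_e(D_R^\theta)\cup\sigma_p(D_R^\theta).$$
   Context: $L^2=L^2(\mathbb T)$, $\mathbb T$ the unit circle; $H^2$ is the Hardy space of the unit disk, viewed as a subspace of $L^2$. For an inner function $\theta$, $K_\theta=H^2\ominus\theta H^2$, $(K_\theta)^\perp=L^2\ominus K_\theta$, and $Q_\theta$ is the orthogonal projection of $L^2$ onto $(K_\theta)^\perp$. For $\varphi\in L^\infty(\mathbb T)$, $D_\varphi^{\theta}\colon (K_\theta)^\perp\to(K_\theta)^\perp$ is the dual truncated Toeplitz operator $D_\varphi^{\theta}f=Q_\theta(\varphi f)$. $\sigma$, $\sigma_p$ denote the spectrum and point spectrum (set of eigenvalues), and $\sigma_e(T)=\{\lambda\in\mathbb C: T-\lambda I\text{ is not Fredholm}\}$. *)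

theory Defs
  imports "HOL-Analysis.Analysis" "HOL-Computational_Algebra.Polynomial"
begin

text \<open>
  The underlying set of this measure space is the circle itself, so that the values of a function
  \<^typ>\<open>complex \<Rightarrow> complex\<close> off the circle matter neither for measurability nor for integrals.
\<close>

definition circle :: "complex measure" where
  "circle = distr (uniform_measure lborel {0..2 * pi}) (restrict_space borel (sphere 0 1)) cis"

definition square_integrable :: "(complex \<Rightarrow> complex) \<Rightarrow> bool" where
  "square_integrable f \<longleftrightarrow>
     f \<in> borel_measurable circle \<and> integrable circle (\<lambda>z. (norm (f z))\<^sup>2)"

lemma square_integrable_zero: "square_integrable (\<lambda>_. 0)"
  by (simp add: square_integrable_def)

lemma square_integrable_mult:
  assumes "square_integrable f" "square_integrable g"
  shows "integrable circle (\<lambda>z. f z * cnj (g z))"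
proof (rule Bochner_Integration.integrable_bound)
  show "integrable circle (\<lambda>z. (norm (f z))\<^sup>2 + (norm (g z))\<^sup>2)"
    using assms by (simp add: square_integrable_def)
  show "(\<lambda>z. f z * cnj (g z)) \<in> borel_measurable circle"
    using assms by (auto simp: square_integrable_def intro!: borel_measurable_times
      measurable_compose[OF _ borel_measurable_continuous_onI[of cnj]] continuous_intros)
  have "norm (f z * cnj (g z)) \<le> norm ((norm (f z))\<^sup>2 + (norm (g z))\<^sup>2)" for z
  proof -
    have "2 * (norm (f z) * norm (g z)) \<le> (norm (f z))\<^sup>2 + (norm (g z))\<^sup>2"
      using sum_squares_bound[of "norm (f z)" "norm (g z)"] by (simp add: mult.assoc)
    moreover have "0 \<le> norm (f z) * norm (g z)" by simp
    ultimately have "norm (f z) * norm (g z) \<le> (norm (f z))\<^sup>2 + (norm (g z))\<^sup>2" by linarith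
    then show ?thesis by (simp add: norm_mult)
  qed
  then show "AE z in circle. norm (f z * cnj (g z)) \<le> norm ((norm (f z))\<^sup>2 + (norm (g z))\<^sup>2)"
    by simp
qed

lemma square_integrable_add:
  assumes f: "square_integrable f" and g: "square_integrable g"
  shows "square_integrable (\<lambda>z. f z + g z)"
  unfolding square_integrable_def
proof
  show m: "(\<lambda>z. f z + g z) \<in> borel_measurable circle"
    using assms by (auto simp: square_integrable_def intro!: borel_measurable_add)
  have "complex_of_real ((norm (f z + g z))\<^sup>2)
      = f z * cnj (f z) + f z * cnj (g z) + g z * cnj (f z) + g z * cnj (g z)" for z
    by (simp add: complex_norm_square algebra_simps del: of_real_power)
  then have "(norm (f z + g z))\<^sup>2
      = Re (f z * cnj (f z) + f z * cnj (g z) + g z * cnj (f z) + g z * cnj (g z))" for z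
    by (metis Re_complex_of_real)
  then show "integrable circle (\<lambda>z. (norm (f z + g z))\<^sup>2)"
    using f g by (simp only:) (intro integrable_Re Bochner_Integration.integrable_add
      square_integrable_mult)
qed

lemma square_integrable_scale:
  assumes "square_integrable f"
  shows "square_integrable (\<lambda>z. c * f z)"
  using assms
  by (auto simp: square_integrable_def norm_mult power_mult_distrib intro!: borel_measurable_times)

quotient_type L2T = "complex \<Rightarrow> complex" / partial:
  "\<lambda>f g. square_integrable f \<and> square_integrable g \<and> (AE z in circle. f z = g z)"
  morphisms rep_L2T abs_L2T
proof (rule part_equivpI)
  show "\<exists>f. square_integrable f \<and> square_integrable f \<and> (AE z in circle. f z = f z)"
    using square_integrable_zero by auto
qed (auto simp: symp_def transp_def elim: eventually_elim2)

instantiation L2T :: ab_group_add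
begin

lift_definition zero_L2T :: L2T is "\<lambda>_. 0"
  by (simp add: square_integrable_zero)

lift_definition plus_L2T :: "L2T \<Rightarrow> L2T \<Rightarrow> L2T" is "\<lambda>f g z. f z + g z"
  by (auto intro: square_integrable_add elim: eventually_elim2)

lift_definition uminus_L2T :: "L2T \<Rightarrow> L2T" is "\<lambda>f z. - f z"
  using square_integrable_scale[of _ "-1"] by (auto elim: eventually_mono)

definition minus_L2T :: "L2T \<Rightarrow> L2T \<Rightarrow> L2T" where
  "minus_L2T f g = f + (- g)"

instance
proof
  fix f g h :: L2T
  show "f + g + h = f + (g + h)"
    by transfer (auto simp: add.assoc intro!: square_integrable_add)
  show "f + g = g + f"
    by transfer (auto simp: add.commute intro!: square_integrable_add)
  show "0 + f = f"
    by transfer auto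
  show "- f + f = 0"
    by transfer (auto simp: square_integrable_zero)
  show "f - g = f + - g"
    by (simp add: minus_L2T_def)
qed

end

lift_definition scaleC :: "complex \<Rightarrow> L2T \<Rightarrow> L2T" (infixr "*\<^sub>C" 75) is "\<lambda>c f z. c * f z"
  by (auto intro: square_integrable_scale elim: eventually_mono)

interpretation L2T: vector_space scaleC
proof
  fix a b :: complex and f g :: L2T
  show "a *\<^sub>C (f + g) = a *\<^sub>C f + a *\<^sub>C g"
    by transfer (auto simp: distrib_left intro!: square_integrable_add square_integrable_scale)
  show "(a + b) *\<^sub>C f = a *\<^sub>C f + b *\<^sub>C f"
  proof transfer
    fix a b :: complex and f :: "complex \<Rightarrow> complex"
    assume "square_integrable f \<and> square_integrable f \<and> (AE z in circle. f z = f z)"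
    then show "square_integrable (\<lambda>z. (a + b) * f z) \<and> square_integrable (\<lambda>z. a * f z + b * f z) \<and>
      (AE z in circle. (a + b) * f z = a * f z + b * f z)"
      by (auto simp: distrib_right intro!: square_integrable_add square_integrable_scale)
  qed
  show "a *\<^sub>C b *\<^sub>C f = (a * b) *\<^sub>C f"
    by transfer (auto simp: mult.assoc intro!: square_integrable_scale)
  show "1 *\<^sub>C f = f"
    by transfer auto
qed

lift_definition cinner :: "L2T \<Rightarrow> L2T \<Rightarrow> complex" is
  "\<lambda>f g. integral\<^sup>L circle (\<lambda>z. f z * cnj (g z))"
proof -
  fix f f' g g' :: "complex \<Rightarrow> complex"
  assume f: "square_integrable f \<and> square_integrable f' \<and> (AE z in circle. f z = f' z)"
    and g: "square_integrable g \<and> square_integrable g' \<and> (AE z in circle. g z = g' z)"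
  have "AE z in circle. f z * cnj (g z) = f' z * cnj (g' z)"
    using f g by (auto elim: eventually_elim2)
  then show "integral\<^sup>L circle (\<lambda>z. f z * cnj (g z)) = integral\<^sup>L circle (\<lambda>z. f' z * cnj (g' z))"
    using f g by (intro integral_cong_AE borel_measurable_integrable square_integrable_mult) auto
qed

lemma cinner_add_left: "cinner (f + g) h = cinner f h + cinner g h"
  by transfer (simp add: distrib_right square_integrable_mult)

lemma cinner_scaleC_left: "cinner (c *\<^sub>C f) g = c * cinner f g"
  by transfer (simp add: mult.assoc)

lemma cinner_cnj: "cinner g f = cnj (cinner f g)"
proof transfer
  fix f g :: "complex \<Rightarrow> complex"
  have "g z * cnj (f z) = cnj (f z * cnj (g z))" for z
    by simp
  then show "integral\<^sup>L circle (\<lambda>z. g z * cnj (f z)) = cnj (integral\<^sup>L circle (\<lambda>z. f z * cnj (g z)))"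
    by (simp only: Bochner_Integration.integral_cnj)
qed

lemma cinner_self_nonneg: "0 \<le> Re (cinner f f)"
proof transfer
  fix f :: "complex \<Rightarrow> complex"
  have "integral\<^sup>L circle (\<lambda>z. f z * cnj (f z)) = of_real (integral\<^sup>L circle (\<lambda>z. (norm (f z))\<^sup>2))"
    by (simp only: complex_norm_square[symmetric] flip: integral_complex_of_real)
  then show "0 \<le> Re (integral\<^sup>L circle (\<lambda>z. f z * cnj (f z)))"
    by simp
qed

lemma cinner_self_eq_0: "Re (cinner f f) = 0 \<longleftrightarrow> f = 0"
proof transfer
  fix f :: "complex \<Rightarrow> complex"
  assume f: "square_integrable f \<and> square_integrable f \<and> (AE z in circle. f z = f z)"
  have "integral\<^sup>L circle (\<lambda>z. f z * cnj (f z)) = of_real (integral\<^sup>L circle (\<lambda>z. (norm (f z))\<^sup>2))"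
    by (simp only: complex_norm_square[symmetric] flip: integral_complex_of_real)
  then have "Re (integral\<^sup>L circle (\<lambda>z. f z * cnj (f z))) = integral\<^sup>L circle (\<lambda>z. (norm (f z))\<^sup>2)"
    by simp
  moreover have "integral\<^sup>L circle (\<lambda>z. (norm (f z))\<^sup>2) = 0 \<longleftrightarrow> (AE z in circle. (norm (f z))\<^sup>2 = 0)"
    using f by (intro integral_nonneg_eq_0_iff_AE) (auto simp: square_integrable_def)
  ultimately show "Re (integral\<^sup>L circle (\<lambda>z. f z * cnj (f z))) = 0 \<longleftrightarrow>
      square_integrable f \<and> square_integrable (\<lambda>_. 0) \<and> (AE z in circle. f z = 0)"
    using f square_integrable_zero by simp
qed

instantiation L2T :: real_inner
begin

definition scaleR_L2T :: "real \<Rightarrow> L2T \<Rightarrow> L2T" where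
  "scaleR_L2T r f = of_real r *\<^sub>C f"

definition inner_L2T :: "L2T \<Rightarrow> L2T \<Rightarrow> real" where
  "inner_L2T f g = Re (cinner f g)"

definition norm_L2T :: "L2T \<Rightarrow> real" where
  "norm_L2T f = sqrt (Re (cinner f f))"

definition sgn_L2T :: "L2T \<Rightarrow> L2T" where
  "sgn_L2T f = inverse (norm f) *\<^sub>R f"

definition dist_L2T :: "L2T \<Rightarrow> L2T \<Rightarrow> real" where
  "dist_L2T f g = norm (f - g)"

definition uniformity_L2T :: "(L2T \<times> L2T) filter" where
  "uniformity_L2T = (INF e\<in>{0<..}. principal {(f, g). dist f g < e})"

definition open_L2T :: "L2T set \<Rightarrow> bool" where
  "open_L2T U \<longleftrightarrow> (\<forall>f\<in>U. eventually (\<lambda>(f', g). f' = f \<longrightarrow> g \<in> U) uniformity)"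

instance
proof
  fix r s :: real and f g h :: L2T and U :: "L2T set"
  show "r *\<^sub>R (f + g) = r *\<^sub>R f + r *\<^sub>R g"
    by (simp add: scaleR_L2T_def L2T.scale_right_distrib)
  show "(r + s) *\<^sub>R f = r *\<^sub>R f + s *\<^sub>R f"
    by (simp add: scaleR_L2T_def L2T.scale_left_distrib)
  show "r *\<^sub>R s *\<^sub>R f = (r * s) *\<^sub>R f"
    by (simp add: scaleR_L2T_def)
  show "1 *\<^sub>R f = f"
    by (simp add: scaleR_L2T_def)
  show "dist f g = norm (f - g)"
    by (fact dist_L2T_def)
  show "sgn f = inverse (norm f) *\<^sub>R f"
    by (fact sgn_L2T_def)
  show "uniformity = (INF e\<in>{0<..}. principal {(f, g). dist (f::L2T) g < e})"
    by (fact uniformity_L2T_def)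
  show "open U \<longleftrightarrow> (\<forall>f\<in>U. \<forall>\<^sub>F (f', g) in uniformity. f' = f \<longrightarrow> g \<in> U)"
    by (fact open_L2T_def)
  show "inner f g = inner g f"
    by (metis cinner_cnj complex_cnj(1) inner_L2T_def complex.sel(1) complex_surj)
  show "inner (f + g) h = inner f h + inner g h"
    by (simp add: inner_L2T_def cinner_add_left)
  show "inner (r *\<^sub>R f) g = r * inner f g"
    by (simp add: inner_L2T_def scaleR_L2T_def cinner_scaleC_left)
  show "0 \<le> inner f f"
    by (simp add: inner_L2T_def cinner_self_nonneg)
  show "inner f f = 0 \<longleftrightarrow> f = 0"
    by (simp add: inner_L2T_def cinner_self_eq_0)
  show "norm f = sqrt (inner f f)"
    by (simp add: inner_L2T_def norm_L2T_def)
qed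

end

text \<open>
  An operator on a closed subspace \<open>M\<close> is given by a function on all of \<^typ>\<open>L2T\<close>, of which only
  the restriction to \<open>M\<close> is ever used.
\<close>

definition orth_compl :: "L2T set \<Rightarrow> L2T set" where
  "orth_compl M = {f. \<forall>g\<in>M. cinner f g = 0}"

definition orth_proj :: "L2T set \<Rightarrow> L2T \<Rightarrow> L2T" where
  "orth_proj M f = (THE g. g \<in> M \<and> f - g \<in> orth_compl M)"

definition bounded_operator_on :: "L2T set \<Rightarrow> (L2T \<Rightarrow> L2T) \<Rightarrow> bool" where
  "bounded_operator_on M T \<longleftrightarrow>
     (\<forall>f\<in>M. T f \<in> M) \<and>
     (\<forall>f\<in>M. \<forall>g\<in>M. T (f + g) = T f + T g) \<and>
     (\<forall>c. \<forall>f\<in>M. T (c *\<^sub>C f) = c *\<^sub>C T f) \<and>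
     (\<exists>C. \<forall>f\<in>M. norm (T f) \<le> C * norm f)"

definition invertible_on :: "L2T set \<Rightarrow> (L2T \<Rightarrow> L2T) \<Rightarrow> bool" where
  "invertible_on M T \<longleftrightarrow>
     (\<exists>S. bounded_operator_on M S \<and> (\<forall>f\<in>M. S (T f) = f \<and> T (S f) = f))"

text \<open>Closed range, finite-dimensional kernel, and finite-dimensional quotient \<open>M / T M\<close>.\<close>

definition fredholm_on :: "L2T set \<Rightarrow> (L2T \<Rightarrow> L2T) \<Rightarrow> bool" where
  "fredholm_on M T \<longleftrightarrow>
     closed (T ` M) \<and>
     (\<exists>B. finite B \<and> {f \<in> M. T f = 0} \<subseteq> L2T.span B) \<and>
     (\<exists>B. finite B \<and> B \<subseteq> M \<and> (\<forall>f\<in>M. \<exists>g\<in>M. f - T g \<in> L2T.span B))"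

definition op_spectrum :: "L2T set \<Rightarrow> (L2T \<Rightarrow> L2T) \<Rightarrow> complex set" where
  "op_spectrum M T = {c. \<not> invertible_on M (\<lambda>f. T f - c *\<^sub>C f)}"

definition point_spectrum :: "L2T set \<Rightarrow> (L2T \<Rightarrow> L2T) \<Rightarrow> complex set" where
  "point_spectrum M T = {c. \<exists>f\<in>M. f \<noteq> 0 \<and> T f = c *\<^sub>C f}"

definition ess_spectrum :: "L2T set \<Rightarrow> (L2T \<Rightarrow> L2T) \<Rightarrow> complex set" where
  "ess_spectrum M T = {c. \<not> fredholm_on M (\<lambda>f. T f - c *\<^sub>C f)}"

text \<open>
  Functions \<open>F\<close> in the Hardy space of the disk are identified with their boundary functions, here
  the limits in \<open>L\<^sup>2(\<T>)\<close> of the dilations \<open>z \<mapsto> F (r z)\<close> as \<open>r\<close> tends to 1 from below.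
\<close>

definition hardy_disk :: "(complex \<Rightarrow> complex) set" where
  "hardy_disk = {F. F holomorphic_on ball 0 1 \<and>
     bdd_above ((\<lambda>r. \<integral>z. (norm (F (of_real r * z)))\<^sup>2 \<partial>circle) ` {0..<1})}"

definition hardy_space :: "L2T set" where
  "hardy_space = {f. \<exists>F\<in>hardy_disk.
     ((\<lambda>r. \<integral>z. (norm (F (of_real r * z) - rep_L2T f z))\<^sup>2 \<partial>circle) \<longlongrightarrow> 0) (at_left 1)}"

definition radial_limit :: "(complex \<Rightarrow> complex) \<Rightarrow> complex \<Rightarrow> complex" where
  "radial_limit F z = Lim (at_left 1) (\<lambda>r::real. F (of_real r * z))"

definition inner_function :: "(complex \<Rightarrow> complex) \<Rightarrow> bool" where
  "inner_function \<theta> \<longleftrightarrow>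
     \<theta> holomorphic_on ball 0 1 \<and> bounded (\<theta> ` ball 0 1) \<and>
     (AE z in circle. \<exists>w. norm w = 1 \<and> ((\<lambda>r::real. \<theta> (of_real r * z)) \<longlongrightarrow> w) (at_left 1))"

text \<open>
  The description determines the product uniquely; it exists whenever \<open>\<phi>\<close> agrees almost everywhere
  on the circle with a bounded measurable function.
\<close>

definition mult_L2T :: "(complex \<Rightarrow> complex) \<Rightarrow> L2T \<Rightarrow> L2T" where
  "mult_L2T \<phi> f = (THE g. AE z in circle. rep_L2T g z = \<phi> z * rep_L2T f z)"

definition model_space :: "(complex \<Rightarrow> complex) \<Rightarrow> L2T set" where
  "model_space \<theta> = hardy_space \<inter> orth_compl (mult_L2T (radial_limit \<theta>) ` hardy_space)"

definition dual_toeplitz :: "(complex \<Rightarrow> complex) \<Rightarrow> (complex \<Rightarrow> complex) \<Rightarrow> L2T \<Rightarrow> L2T" where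
  "dual_toeplitz \<theta> \<phi> f = orth_proj (orth_compl (model_space \<theta>)) (mult_L2T \<phi> f)"

text \<open>
  The values at the zeros of the denominator are left open: there a removable singularity may be
  filled in, and continuity then determines the value.
\<close>

definition rational_function :: "(complex \<Rightarrow> complex) \<Rightarrow> bool" where
  "rational_function R \<longleftrightarrow>
     (\<exists>p q :: complex poly. q \<noteq> 0 \<and> (\<forall>z. poly q z \<noteq> 0 \<longrightarrow> R z = poly p z / poly q z))"

end

theory Submission
  imports Defs "HOL-Complex_Analysis.Complex_Analysis" "HOL-Real_Asymp.Real_Asymp"
    "HOL-Computational_Algebra.Fundamental_Theorem_Algebra"
begin

text \<open>
  Let \<open>U\<close> be multiplication by \<open>z\<close>, \<open>H\<close> the Hardy space, \<open>N = \<theta>H\<close> and \<open>K = H \<ominus> N\<close> the model space, so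
  that \<open>M = K\<^sup>\<bottom> = N \<oplus> H\<^sup>\<bottom>\<close>. The operator in question is the compression of multiplication by \<open>R\<close>
  to \<open>M\<close>. The shift \<open>U\<close> need not map \<open>M\<close> into itself, but it nearly does: it enters \<open>N\<close> with
  codimension one and leaves \<open>H\<^sup>\<bottom>\<close> in one direction, and matching the two defects gives a unitary
  operator \<open>W\<close> on \<open>M\<close> that differs from \<open>U\<close> by rank one. Adding one linear factor at a time
  (\<open>models_poly\<close>, \<open>models_divide_poly\<close>), multiplication by a rational function \<open>\<phi>\<close> without poles on the
  circle agrees on \<open>M\<close> with \<open>\<phi>(W)\<close> up to an operator of finite rank, and so does its compression.

  If \<open>c\<close> is not a value of \<open>R\<close> on the circle, then \<open>\<phi> = R - c\<close> has all its zeros and poles off the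
  circle. Since \<open>W\<close> is unitary, \<open>\<phi>(W)\<close> is invertible, and a finite rank perturbation of it is
  invertible as soon as it is injective (\<open>compression_invertible\<close>). Thus \<open>c\<close> is in the spectrum only
  if it is an eigenvalue. In terms of Toeplitz operators, the indices on \<open>N\<close> and on \<open>H\<^sup>\<bottom>\<close> cancel; the
  operator \<open>W\<close> makes this cancellation visible without any index theory.

  If \<open>c = R(a)\<close> with \<open>a\<close> on the circle, then \<open>z - a\<close> divides \<open>\<phi>\<close>, so the range of \<open>\<phi>(W)\<close> lies in that
  of \<open>W - a\<close>, which has infinite codimension: on \<open>N\<close>, where \<open>W\<close> is a unilateral shift, \<open>(W - a) g = f\<close>
  forces the tails of a series built from the coefficients of \<open>f\<close> to be square summable
  (\<open>range_W_minus_infinite_codim\<close>). Changing the operator by finite rank does not make the codimension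
  finite, so \<open>c\<close> is in the essential spectrum, hence in the spectrum. Both equalities follow, because
  invertible operators are Fredholm.

  The analytic input is small. Completeness of \<open>L\<^sup>2\<close> provides orthogonal projections and fixed points of
  contractions; the Hardy space is the closed span of the powers of \<open>z\<close> (\<open>hardy_space_eq\<close>); and
  multiplication by the boundary values of \<open>\<theta>\<close> is a unitary operator that commutes with \<open>U\<close>, so that
  \<open>N\<close> inherits the properties of \<open>H\<close> (\<open>shift_space_mult_unimodular\<close>).
\<close>

section \<open>The circle as a probability space\<close>

lemma sets_circle [measurable_cong]: "sets circle = sets (restrict_space borel (sphere 0 1))"
  by (simp add: circle_def)

lemma space_circle: "space circle = sphere 0 1"
  by (simp add: circle_def space_restrict_space)

lemma measurable_cis_circle:
  "cis \<in> measurable (uniform_measure lborel {0..2 * pi}) (restrict_space borel (sphere 0 1))"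
proof -
  have "cis \<in> borel_measurable borel"
    by (intro borel_measurable_continuous_onI continuous_intros)
  then have "cis \<in> borel_measurable (uniform_measure lborel {0..2 * pi})"
    by (simp add: measurable_def)
  then show ?thesis
    by (auto intro!: measurable_restrict_space2)
qed

lemma emeasure_space_circle: "emeasure circle (sphere 0 1) = 1"
proof -
  have "emeasure circle (sphere 0 1)
      = emeasure (uniform_measure lborel {0..2 * pi})
          (cis -` sphere 0 1 \<inter> space (uniform_measure lborel {0..2 * pi}))"
    unfolding circle_def
    by (rule emeasure_distr[OF measurable_cis_circle]) (auto simp: sets_restrict_space)
  also have "cis -` sphere 0 1 \<inter> space (uniform_measure lborel {0..2 * pi}) = UNIV"
    by auto
  also have "emeasure (uniform_measure lborel {0..2 * pi}) UNIV = 1"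
  proof -
    have "0 < emeasure lborel {0..2 * pi}" "emeasure lborel {0..2 * pi} < top"
      by (simp_all add: ennreal_zero_less_mult_iff)
    then have "emeasure lborel {0..2 * pi} / emeasure lborel {0..2 * pi} = 1"
      by (intro ennreal_divide_self) auto
    then show ?thesis
      using emeasure_uniform_measure[of "{0..2 * pi}" lborel UNIV]
      by (simp only: sets_lborel borel_closed closed_real_atLeastAtMost Int_UNIV_right space_borel sets.top)
         auto
  qed
  finally show ?thesis .
qed

interpretation circle: finite_measure circle
  by (rule finite_measureI) (simp add: space_circle emeasure_space_circle)

lemma measure_circle_space: "measure circle (sphere 0 1) = 1"
  by (simp add: measure_def emeasure_space_circle)

lemma borel_measurable_circle_continuous:
  fixes f :: "complex \<Rightarrow> 'a::topological_space"
  assumes "continuous_on (sphere 0 1) f"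
  shows "f \<in> borel_measurable circle"
  unfolding measurable_cong_sets[OF sets_circle refl]
  by (rule borel_measurable_continuous_on_restrict[OF assms])

lemma integral_circle:
  fixes f :: "complex \<Rightarrow> complex"
  assumes "f \<in> borel_measurable circle"
  shows "integral\<^sup>L circle f = (LBINT t:{0..2*pi}. f (cis t)) / (2 * pi)"
proof -
  have m: "f \<in> borel_measurable (restrict_space borel (sphere 0 1))"
    using assms unfolding measurable_cong_sets[OF sets_circle refl] .
  have mc: "(\<lambda>t. f (cis t)) \<in> borel_measurable lborel"
    using measurable_compose[OF measurable_cis_circle m] by (simp add: measurable_def)
  have "integral\<^sup>L circle f = (\<integral>t. f (cis t) \<partial>uniform_measure lborel {0..2*pi})"
    unfolding circle_def by (rule integral_distr[OF measurable_cis_circle m])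
  also have "\<dots> = (\<integral>t. f (cis t) \<partial>density lborel (\<lambda>t. ennreal (indicator {0..2*pi} t / (2*pi))))"
  proof -
    have "(1::ennreal) / ennreal (2*pi) = ennreal (1/(2*pi))"
      using divide_ennreal[of 1 "2*pi"] by simp
    then have "uniform_measure lborel {0..2*pi}
        = density lborel (\<lambda>t. ennreal (indicator {0..2*pi} t / (2*pi)))"
      unfolding uniform_measure_def
    proof (intro density_cong)
      assume "(1::ennreal) / ennreal (2*pi) = ennreal (1/(2*pi))"
      then show "AE x in lborel. indicator {0..2 * pi} x / emeasure lborel {0..2 * pi} =
          ennreal (indicat_real {0..2 * pi} x / (2 * pi))"
        by (simp add: indicator_def)
    qed simp_all
    then show ?thesis by simp
  qed
  also have "\<dots> = (\<integral>t. (indicator {0..2*pi} t / (2*pi)) *\<^sub>R f (cis t) \<partial>lborel)"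
    using mc by (intro integral_density) (auto)
  also have "\<dots> = (\<integral>t. (1 / (2*pi)) *\<^sub>R (indicator {0..2*pi} t *\<^sub>R f (cis t)) \<partial>lborel)"
    by (intro Bochner_Integration.integral_cong) (simp_all add: indicator_def)
  also have "\<dots> = (LBINT t:{0..2*pi}. f (cis t)) / (2 * pi)"
    by (simp add: set_lebesgue_integral_def scaleR_conv_of_real)
  finally show ?thesis .
qed

lemma integral_circle_power:
  assumes "n > 0"
  shows "integral\<^sup>L circle (\<lambda>z. z ^ n) = 0"
proof -
  have "(LBINT t:{0..2*pi}. cis t ^ n) = (LBINT t=ereal 0..ereal (2*pi). cis t ^ n)"
    by (simp add: interval_integral_Icc)
  also have "\<dots> = cis (real n * (2*pi)) / (\<i> * n) - cis (real n * 0) / (\<i> * n)"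
  proof (rule interval_integral_FTC_finite)
    show "continuous_on {min 0 (2*pi)..max 0 (2*pi)} (\<lambda>t. cis t ^ n)"
      by (intro continuous_intros)
    fix t :: real
    have "((\<lambda>z::complex. exp (\<i> * (of_nat n * z)) / (\<i> * of_nat n)) has_field_derivative
        exp (\<i> * (of_nat n * of_real t))) (at (of_real t))"
      using assms
      by (auto intro!: derivative_eq_intros) (metis complex_i_mult_minus mult.commute minus_minus)
    note * = has_vector_derivative_real_field[OF this]
    have "cis (real n * x) = exp (\<i> * (of_nat n * of_real x))" for x
      by (simp add: cis_conv_exp)
    then have "((\<lambda>t. cis (real n * t) / (\<i> * n)) has_vector_derivative cis (real n * t))
        (at t within {min 0 (2*pi)..max 0 (2*pi)})"
      by (simp only: *)
    then show "((\<lambda>t. cis (real n * t) / (\<i> * n)) has_vector_derivative cis t ^ n)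
        (at t within {min 0 (2*pi)..max 0 (2*pi)})"
      by (subst Complex.DeMoivre)
  qed
  also have "cis (real n * (2*pi)) = 1"
    using cis_multiple_2pi[of "real n"] by (simp add: mult.commute)
  finally have "(LBINT t:{0..2*pi}. cis t ^ n) = 0"
    by simp
  moreover have "(\<lambda>z::complex. z ^ n) \<in> borel_measurable circle"
    by (intro borel_measurable_circle_continuous continuous_intros)
  ultimately show ?thesis
    using integral_circle[of "\<lambda>z. z ^ n"] by simp
qed

lemma power_mult_cnj_power_circle:
  fixes z :: complex
  assumes "z \<in> sphere 0 1"
  shows "z ^ n * cnj (z ^ n) = 1"
proof -
  have "norm (z ^ n) = 1" using assms by (simp add: norm_power)
  then show ?thesis using complex_norm_square[of "z ^ n"] by simp
qed

lemma integral_circle_power_cnj: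
  "integral\<^sup>L circle (\<lambda>z. z ^ m * cnj (z ^ n)) = (if m = n then 1 else 0)"
proof -
  have gt: "integral\<^sup>L circle (\<lambda>z. z ^ m * cnj (z ^ n)) = 0" if "m > n" for m n :: nat
  proof -
    have "z ^ m * cnj (z ^ n) = z ^ (m - n)" if "z \<in> space circle" for z
    proof -
      have "z ^ m = z ^ (m - n) * z ^ n"
        using \<open>m > n\<close> by (metis le_add_diff_inverse2 less_imp_le power_add)
      then show ?thesis
        using power_mult_cnj_power_circle[of z n] that
        by (metis mult.assoc mult.right_neutral space_circle)
    qed
    then have "integral\<^sup>L circle (\<lambda>z. z ^ m * cnj (z ^ n)) = integral\<^sup>L circle (\<lambda>z. z ^ (m - n))"
      by (intro Bochner_Integration.integral_cong) auto
    then show ?thesis using integral_circle_power[of "m - n"] that by simp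
  qed
  consider "m > n" | "n > m" | "m = n" by linarith
  then show ?thesis
  proof cases
    case 1
    then show ?thesis using gt[OF 1] by (simp del: complex_cnj_power)
  next
    case 2
    have "integral\<^sup>L circle (\<lambda>z. z ^ m * cnj (z ^ n))
        = integral\<^sup>L circle (\<lambda>z. cnj (z ^ n * cnj (z ^ m)))"
      by (simp add: mult.commute)
    also have "\<dots> = cnj (integral\<^sup>L circle (\<lambda>z. z ^ n * cnj (z ^ m)))"
      by (rule Bochner_Integration.integral_cnj)
    finally show ?thesis using gt[OF 2] 2 by (simp del: complex_cnj_power)
  next
    case 3
    have "integral\<^sup>L circle (\<lambda>z. z ^ n * cnj (z ^ n)) = integral\<^sup>L circle (\<lambda>z. 1)"
      by (intro Bochner_Integration.integral_cong refl)
         (simp add: power_mult_cnj_power_circle space_circle del: complex_cnj_power)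
    then show ?thesis
      using 3 by (simp add: space_circle measure_circle_space del: complex_cnj_power)
  qed
qed

section \<open>Elements of \<open>L\<^sup>2\<close> and their representatives\<close>

lemma square_integrable_rep: "square_integrable (rep_L2T f)"
  using Quotient3_rep_reflp[OF Quotient3_L2T, of f] by simp

lemma abs_rep_L2T [simp]: "abs_L2T (rep_L2T f) = f"
  by (rule Quotient3_abs_rep[OF Quotient3_L2T])

lemma rep_abs_L2T:
  assumes "square_integrable f"
  shows "AE z in circle. rep_L2T (abs_L2T f) z = f z"
  using rep_abs_rsp_left[OF Quotient3_L2T, of f f] assms by auto

lemma abs_L2T_eqI:
  assumes "square_integrable f" "square_integrable g" "AE z in circle. f z = g z"
  shows "abs_L2T f = abs_L2T g"
  using Quotient3_rel[OF Quotient3_L2T, of f g] assms by auto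

lemma L2T_eqI: "AE z in circle. rep_L2T f z = rep_L2T g z \<Longrightarrow> f = g"
  using abs_L2T_eqI[OF square_integrable_rep[of f] square_integrable_rep[of g]] by simp

lemma measurable_rep_L2T [measurable]: "rep_L2T f \<in> borel_measurable circle"
  using square_integrable_rep[of f] by (simp add: square_integrable_def)

lemma plus_abs_L2T:
  assumes "square_integrable f" "square_integrable g"
  shows "abs_L2T f + abs_L2T g = abs_L2T (\<lambda>z. f z + g z)"
  using assms by (intro plus_L2T.abs_eq) auto

lemma scaleC_abs_L2T:
  assumes "square_integrable f"
  shows "c *\<^sub>C abs_L2T f = abs_L2T (\<lambda>z. c * f z)"
  using assms by (intro scaleC.abs_eq) auto

lemma rep_L2T_plus: "AE z in circle. rep_L2T (f + g) z = rep_L2T f z + rep_L2T g z"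
  using plus_abs_L2T[OF square_integrable_rep[of f] square_integrable_rep[of g]]
    rep_abs_L2T[OF square_integrable_add[OF square_integrable_rep[of f] square_integrable_rep[of g]]]
  by simp

lemma rep_L2T_scaleC: "AE z in circle. rep_L2T (c *\<^sub>C f) z = c * rep_L2T f z"
  using scaleC_abs_L2T[OF square_integrable_rep[of f], of c]
    rep_abs_L2T[OF square_integrable_scale[OF square_integrable_rep[of f], of c]]
  by simp

lemma scaleC_minus_one: "(-1) *\<^sub>C f = - f"
  by (metis L2T.scale_minus_left L2T.scale_one)

lemma rep_L2T_diff: "AE z in circle. rep_L2T (f - g) z = rep_L2T f z - rep_L2T g z"
proof -
  have "f - g = f + (-1) *\<^sub>C g" by (simp add: scaleC_minus_one)
  then show ?thesis
    using rep_L2T_plus[of f "(-1) *\<^sub>C g"] rep_L2T_scaleC[of "-1" g] by auto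
qed

lemma cinner_rep: "cinner f g = integral\<^sup>L circle (\<lambda>z. rep_L2T f z * cnj (rep_L2T g z))"
  using cinner.abs_eq[of "rep_L2T f" "rep_L2T g"] by (simp add: square_integrable_rep)

lemma cinner_self: "cinner f f = of_real ((norm f)\<^sup>2)"
proof -
  have "Im (cinner f f) = Im (cnj (cinner f f))" by (metis cinner_cnj)
  then have "Im (cinner f f) = 0" by simp
  moreover have "(norm f)\<^sup>2 = Re (cinner f f)"
    by (simp add: norm_L2T_def cinner_self_nonneg)
  ultimately show ?thesis by (simp add: complex_eq_iff)
qed

lemma norm_squared_rep: "(norm f)\<^sup>2 = integral\<^sup>L circle (\<lambda>z. (norm (rep_L2T f z))\<^sup>2)"
proof -
  have "complex_of_real ((norm f)\<^sup>2) = cinner f f" by (simp add: cinner_self)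
  also have "\<dots> = integral\<^sup>L circle (\<lambda>z. complex_of_real ((norm (rep_L2T f z))\<^sup>2))"
    unfolding cinner_rep by (simp only: complex_norm_square)
  also have "\<dots> = complex_of_real (integral\<^sup>L circle (\<lambda>z. (norm (rep_L2T f z))\<^sup>2))"
    by (rule integral_complex_of_real)
  finally show ?thesis by (simp only: of_real_eq_iff)
qed

lemma norm_squared_abs_diff:
  assumes "square_integrable g"
  shows "(norm (abs_L2T g - f))\<^sup>2 = integral\<^sup>L circle (\<lambda>z. (norm (g z - rep_L2T f z))\<^sup>2)"
proof -
  have m [measurable]: "g \<in> borel_measurable circle"
    using assms by (simp add: square_integrable_def)
  have "AE z in circle. (norm (rep_L2T (abs_L2T g - f) z))\<^sup>2 = (norm (g z - rep_L2T f z))\<^sup>2"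
    using rep_L2T_diff[of "abs_L2T g" f] rep_abs_L2T[OF assms] by auto
  then show ?thesis unfolding norm_squared_rep
    by (intro integral_cong_AE) measurable
qed

lemma norm_squared_abs:
  assumes "square_integrable g"
  shows "(norm (abs_L2T g))\<^sup>2 = integral\<^sup>L circle (\<lambda>z. (norm (g z))\<^sup>2)"
proof -
  have m [measurable]: "g \<in> borel_measurable circle"
    using assms by (simp add: square_integrable_def)
  have "AE z in circle. (norm (rep_L2T (abs_L2T g) z))\<^sup>2 = (norm (g z))\<^sup>2"
    using rep_abs_L2T[OF assms] by auto
  then show ?thesis unfolding norm_squared_rep
    by (intro integral_cong_AE) measurable
qed

lemma cinner_zero_left [simp]: "cinner 0 g = 0"
  using cinner_scaleC_left[of 0 0 g] by simp

lemma cinner_zero_right [simp]: "cinner f 0 = 0"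
  by (metis cinner_cnj cinner_zero_left complex_cnj_zero)

lemma cinner_minus_left [simp]: "cinner (- f) g = - cinner f g"
  using cinner_scaleC_left[of "-1" f g] by (simp add: scaleC_minus_one)

lemma cinner_diff_left: "cinner (f - g) h = cinner f h - cinner g h"
  using cinner_add_left[of f "- g" h] by simp

lemma cinner_add_right: "cinner f (g + h) = cinner f g + cinner f h"
  by (metis cinner_add_left cinner_cnj complex_cnj_add)

lemma cinner_scaleC_right: "cinner f (c *\<^sub>C g) = cnj c * cinner f g"
  by (metis cinner_scaleC_left cinner_cnj complex_cnj_mult)

lemma cinner_diff_right: "cinner f (g - h) = cinner f g - cinner f h"
  by (metis cinner_diff_left cinner_cnj complex_cnj_diff)

lemma cinner_sum_left: "cinner (sum f A) g = (\<Sum>i\<in>A. cinner (f i) g)"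
  by (induction A rule: infinite_finite_induct) (simp_all add: cinner_add_left)

lemma cinner_sum_right: "cinner g (sum f A) = (\<Sum>i\<in>A. cinner g (f i))"
  by (induction A rule: infinite_finite_induct) (simp_all add: cinner_add_right)

lemmas cinner_simps = cinner_add_left cinner_add_right cinner_diff_left cinner_diff_right
  cinner_scaleC_left cinner_scaleC_right

lemma cinner_self_eq_0_iff [simp]: "cinner f f = 0 \<longleftrightarrow> f = 0"
  by (simp add: cinner_self)

lemma cinner_commute_eq_0: "cinner f g = 0 \<Longrightarrow> cinner g f = 0"
  by (metis cinner_cnj complex_cnj_zero)

lemma norm_scaleC [simp]: "norm (c *\<^sub>C f) = norm c * norm f"
proof -
  have "complex_of_real ((norm (c *\<^sub>C f))\<^sup>2) = (c * cnj c) * cinner f f"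
    by (simp only: cinner_self[symmetric] cinner_simps mult_ac)
  also have "\<dots> = complex_of_real ((norm c * norm f)\<^sup>2)"
    by (simp only: complex_norm_square[symmetric] cinner_self power_mult_distrib of_real_mult)
  finally have "(norm (c *\<^sub>C f))\<^sup>2 = (norm c * norm f)\<^sup>2" by (simp only: of_real_eq_iff)
  then show ?thesis by (simp add: power2_eq_iff_nonneg)
qed

lemma Cauchy_Schwarz_cinner: "norm (cinner f g) \<le> norm f * norm g"
proof -
  obtain c where c: "norm c = 1" "c * cinner f g = of_real (norm (cinner f g))"
  proof (cases "cinner f g = 0")
    case False
    then show ?thesis
      by (intro that[of "cnj (cinner f g) / of_real (norm (cinner f g))"])
         (simp_all add: norm_divide complex_norm_square[symmetric] power2_eq_square field_simps)
  qed (auto intro: that[of 1])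
  have "norm (cinner f g) = Re (cinner (c *\<^sub>C f) g)" using c by (simp add: cinner_simps)
  also have "\<dots> \<le> norm (c *\<^sub>C f) * norm g"
    using norm_cauchy_schwarz[of "c *\<^sub>C f" g] by (simp only: inner_L2T_def)
  finally show ?thesis using c by simp
qed

lemma norm_add_squared_orthogonal:
  assumes "cinner f g = 0"
  shows "(norm (f + g))\<^sup>2 = (norm f)\<^sup>2 + (norm g)\<^sup>2"
proof -
  have "complex_of_real ((norm (f + g))\<^sup>2) = complex_of_real ((norm f)\<^sup>2 + (norm g)\<^sup>2)"
    using assms cinner_commute_eq_0[OF assms]
    by (simp only: of_real_add cinner_self[symmetric] cinner_simps) simp
  then show ?thesis by (simp only: of_real_eq_iff)
qed

lemma tendsto_cinner:
  assumes "X \<longlonglongrightarrow> f"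
  shows "(\<lambda>n. cinner (X n) g) \<longlonglongrightarrow> cinner f g"
proof (rule LIM_zero_cancel)
  have "(\<lambda>n. norm (X n - f) * norm g) \<longlonglongrightarrow> 0"
    using tendsto_mult_right[OF tendsto_norm_zero[OF LIM_zero[OF assms]], of "norm g"] by simp
  then show "(\<lambda>n. cinner (X n) g - cinner f g) \<longlonglongrightarrow> 0"
    by (rule Lim_null_comparison[rotated])
       (simp add: cinner_diff_left[symmetric] Cauchy_Schwarz_cinner)
qed

lemma closed_orth_compl: "closed (orth_compl S)"
  unfolding closed_sequential_limits
proof safe
  fix X f assume X: "\<forall>n. X n \<in> orth_compl S" "X \<longlonglongrightarrow> f"
  have "cinner f g = 0" if "g \<in> S" for g
  proof -
    have "(\<lambda>n. cinner (X n) g) = (\<lambda>n. 0)" using X(1) that by (auto simp: orth_compl_def)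
    then show ?thesis using tendsto_cinner[OF X(2), of g] by (simp add: LIMSEQ_const_iff)
  qed
  then show "f \<in> orth_compl S" by (simp add: orth_compl_def)
qed

lemma subspace_orth_compl: "L2T.subspace (orth_compl S)"
  by (auto simp: L2T.subspace_def orth_compl_def cinner_simps)

section \<open>Multiplication operators\<close>

definition bounded_symbol :: "(complex \<Rightarrow> complex) \<Rightarrow> bool" where
  "bounded_symbol \<phi> \<longleftrightarrow>
     \<phi> \<in> borel_measurable circle \<and> (\<exists>C. \<forall>z\<in>sphere 0 1. norm (\<phi> z) \<le> C)"

lemma bounded_symbolI:
  assumes "\<phi> \<in> borel_measurable circle" "\<And>z. z \<in> sphere 0 1 \<Longrightarrow> norm (\<phi> z) \<le> C"
  shows "bounded_symbol \<phi>"
  using assms unfolding bounded_symbol_def by blast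

lemma bounded_symbolE:
  assumes "bounded_symbol \<phi>"
  obtains C where "\<phi> \<in> borel_measurable circle"
    "\<And>z. z \<in> sphere 0 1 \<Longrightarrow> norm (\<phi> z) \<le> C"
  using assms unfolding bounded_symbol_def by blast

lemma bounded_symbol_continuous:
  assumes "continuous_on (sphere 0 1) \<phi>"
  shows "bounded_symbol \<phi>"
proof -
  have "bounded (\<phi> ` sphere 0 1)"
    by (intro compact_imp_bounded compact_continuous_image assms compact_sphere)
  then show ?thesis
    unfolding bounded_symbol_def bounded_iff
    using borel_measurable_circle_continuous[OF assms] by auto
qed

lemma bounded_symbol_mult:
  assumes \<phi>: "bounded_symbol \<phi>" and \<psi>: "bounded_symbol \<psi>"
  shows "bounded_symbol (\<lambda>z. \<phi> z * \<psi> z)"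
proof -
  obtain C where C: "\<phi> \<in> borel_measurable circle" "\<And>z. z \<in> sphere 0 1 \<Longrightarrow> norm (\<phi> z) \<le> C"
    using \<phi> by (rule bounded_symbolE) blast
  obtain D where D: "\<psi> \<in> borel_measurable circle" "\<And>z. z \<in> sphere 0 1 \<Longrightarrow> norm (\<psi> z) \<le> D"
    using \<psi> by (rule bounded_symbolE) blast
  show ?thesis
  proof (rule bounded_symbolI)
    show "(\<lambda>z. \<phi> z * \<psi> z) \<in> borel_measurable circle" using C D by measurable
    fix z :: complex assume z: "z \<in> sphere 0 1"
    have "0 \<le> C" using norm_ge_zero[of "\<phi> z"] C(2)[OF z] by linarith
    then show "norm (\<phi> z * \<psi> z) \<le> C * D"
      unfolding norm_mult using C(2)[OF z] D(2)[OF z] by (intro mult_mono) auto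
  qed
qed

lemma bounded_symbol_cnj:
  assumes "bounded_symbol \<phi>"
  shows "bounded_symbol (\<lambda>z. cnj (\<phi> z))"
proof -
  obtain C where C: "\<phi> \<in> borel_measurable circle" "\<And>z. z \<in> sphere 0 1 \<Longrightarrow> norm (\<phi> z) \<le> C"
    using assms by (rule bounded_symbolE) blast
  have "cnj \<in> borel_measurable borel"
    by (intro borel_measurable_continuous_onI continuous_intros)
  then show ?thesis
    using C by (intro bounded_symbolI[where C=C] measurable_compose[OF C(1)]) auto
qed

lemma square_integrable_bounded_mult:
  assumes "bounded_symbol \<phi>" "square_integrable f"
  shows "square_integrable (\<lambda>z. \<phi> z * f z)"
  unfolding square_integrable_def
proof
  have m [measurable]: "\<phi> \<in> borel_measurable circle" "f \<in> borel_measurable circle"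
    using assms by (simp_all add: square_integrable_def bounded_symbol_def)
  show "(\<lambda>z. \<phi> z * f z) \<in> borel_measurable circle" by measurable
  obtain C where C: "\<And>z. z \<in> sphere 0 1 \<Longrightarrow> norm (\<phi> z) \<le> C"
    using assms unfolding bounded_symbol_def by blast
  show "integrable circle (\<lambda>z. (norm (\<phi> z * f z))\<^sup>2)"
  proof (rule Bochner_Integration.integrable_bound)
    show "integrable circle (\<lambda>z. C\<^sup>2 * (norm (f z))\<^sup>2)"
      using assms by (simp add: square_integrable_def)
    show "AE z in circle. norm ((norm (\<phi> z * f z))\<^sup>2) \<le> norm (C\<^sup>2 * (norm (f z))\<^sup>2)"
      using C by (intro AE_I2)
        (auto simp: space_circle norm_mult power_mult_distrib intro!: mult_right_mono power_mono)
  qed measurable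
qed

text \<open>
  The symbol \<open>\<psi>\<close> is tied to a measurable one only almost everywhere: a radial limit has unspecified
  values where the limit does not exist.
\<close>

lemma mult_L2T_eq:
  assumes "bounded_symbol \<phi>" "AE z in circle. \<psi> z = \<phi> z"
  shows "mult_L2T \<psi> f = abs_L2T (\<lambda>z. \<phi> z * rep_L2T f z)"
  unfolding mult_L2T_def
proof (rule the_equality)
  have "AE z in circle. rep_L2T (abs_L2T (\<lambda>z. \<phi> z * rep_L2T f z)) z = \<phi> z * rep_L2T f z"
    by (intro rep_abs_L2T square_integrable_bounded_mult assms square_integrable_rep)
  then show ae: "AE z in circle. rep_L2T (abs_L2T (\<lambda>z. \<phi> z * rep_L2T f z)) z = \<psi> z * rep_L2T f z"
    using assms(2) by auto
  fix g assume "AE z in circle. rep_L2T g z = \<psi> z * rep_L2T f z"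
  then show "g = abs_L2T (\<lambda>z. \<phi> z * rep_L2T f z)"
    using ae by (intro L2T_eqI) auto
qed

lemma mult_L2T_cong_AE:
  assumes "bounded_symbol \<phi>" "AE z in circle. \<psi> z = \<phi> z"
  shows "mult_L2T \<psi> f = mult_L2T \<phi> f"
  using mult_L2T_eq[OF assms] mult_L2T_eq[OF assms(1), of \<phi>] by simp

lemma mult_L2T_cong:
  assumes "bounded_symbol \<phi>" "\<And>z. z \<in> sphere 0 1 \<Longrightarrow> \<psi> z = \<phi> z"
  shows "mult_L2T \<psi> f = mult_L2T \<phi> f"
  using assms by (intro mult_L2T_cong_AE AE_I2) (auto simp: space_circle)

lemma rep_mult_L2T:
  assumes "bounded_symbol \<phi>"
  shows "AE z in circle. rep_L2T (mult_L2T \<phi> f) z = \<phi> z * rep_L2T f z"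
  using rep_abs_L2T[OF square_integrable_bounded_mult[OF assms square_integrable_rep[of f]]]
    mult_L2T_eq[OF assms, of \<phi>] by simp

lemma mult_abs_L2T:
  assumes "bounded_symbol \<phi>" "square_integrable f"
  shows "mult_L2T \<phi> (abs_L2T f) = abs_L2T (\<lambda>z. \<phi> z * f z)"
  using rep_mult_L2T[OF assms(1), of "abs_L2T f"] rep_abs_L2T[OF assms(2)]
    rep_abs_L2T[OF square_integrable_bounded_mult[OF assms]]
  by (intro L2T_eqI) auto

lemma mult_L2T_add:
  assumes "bounded_symbol \<phi>"
  shows "mult_L2T \<phi> (f + g) = mult_L2T \<phi> f + mult_L2T \<phi> g"
  using rep_mult_L2T[OF assms, of "f + g"] rep_mult_L2T[OF assms, of f] rep_mult_L2T[OF assms, of g]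
    rep_L2T_plus[of f g] rep_L2T_plus[of "mult_L2T \<phi> f" "mult_L2T \<phi> g"]
  by (intro L2T_eqI) (auto simp: distrib_left)

lemma mult_L2T_scaleC:
  assumes "bounded_symbol \<phi>"
  shows "mult_L2T \<phi> (c *\<^sub>C f) = c *\<^sub>C mult_L2T \<phi> f"
  using rep_mult_L2T[OF assms, of "c *\<^sub>C f"] rep_mult_L2T[OF assms, of f]
    rep_L2T_scaleC[of c f] rep_L2T_scaleC[of c "mult_L2T \<phi> f"]
  by (intro L2T_eqI) auto

lemma mult_L2T_diff:
  assumes "bounded_symbol \<phi>"
  shows "mult_L2T \<phi> (f - g) = mult_L2T \<phi> f - mult_L2T \<phi> g"
  using mult_L2T_add[OF assms, of "f - g" g] by (simp add: algebra_simps)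

lemma mult_L2T_mult:
  assumes "bounded_symbol \<phi>" "bounded_symbol \<psi>"
  shows "mult_L2T \<phi> (mult_L2T \<psi> f) = mult_L2T (\<lambda>z. \<phi> z * \<psi> z) f"
  using rep_mult_L2T[OF assms(1), of "mult_L2T \<psi> f"] rep_mult_L2T[OF assms(2), of f]
    rep_mult_L2T[OF bounded_symbol_mult[OF assms], of f]
  by (intro L2T_eqI) auto

lemma mult_L2T_one: "mult_L2T (\<lambda>_. 1) f = f"
  using rep_mult_L2T[OF bounded_symbol_continuous[of "\<lambda>_. 1"], of f]
  by (intro L2T_eqI) simp

lemma mult_L2T_minus_const:
  assumes "bounded_symbol \<phi>" 
  shows "mult_L2T (\<lambda>z. \<phi> z - c) f = mult_L2T \<phi> f - c *\<^sub>C f"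
proof -
  obtain C where C: "\<phi> \<in> borel_measurable circle" "\<And>z. z \<in> sphere 0 1 \<Longrightarrow> norm (\<phi> z) \<le> C"
    using assms by (rule bounded_symbolE) blast
  have "norm (\<phi> z - c) \<le> C + norm c" if "z \<in> sphere 0 1" for z
    using C(2)[OF that] norm_triangle_ineq4[of "\<phi> z" c] by linarith
  then have "bounded_symbol (\<lambda>z. \<phi> z - c)"
    using C(1) by (intro bounded_symbolI) auto
  from rep_mult_L2T[OF this, of f] show ?thesis
    using rep_mult_L2T[OF assms, of f] rep_L2T_diff[of "mult_L2T \<phi> f" "c *\<^sub>C f"]
      rep_L2T_scaleC[of c f]
    by (intro L2T_eqI) (auto simp: left_diff_distrib)
qed

lemma cinner_mult_L2T_left:
  assumes "bounded_symbol \<phi>"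
  shows "cinner (mult_L2T \<phi> f) g = cinner f (mult_L2T (\<lambda>z. cnj (\<phi> z)) g)"
  unfolding cinner_rep
proof (rule integral_cong_AE)
  show "AE z in circle. rep_L2T (mult_L2T \<phi> f) z * cnj (rep_L2T g z) =
      rep_L2T f z * cnj (rep_L2T (mult_L2T (\<lambda>z. cnj (\<phi> z)) g) z)"
    using rep_mult_L2T[OF assms, of f] rep_mult_L2T[OF bounded_symbol_cnj[OF assms], of g]
    by auto
qed (intro borel_measurable_integrable square_integrable_mult square_integrable_rep)+

lemma norm_mult_L2T_le:
  assumes "bounded_symbol \<phi>" "\<And>z. z \<in> sphere 0 1 \<Longrightarrow> norm (\<phi> z) \<le> C"
  shows "norm (mult_L2T \<phi> f) \<le> C * norm f"
proof -
  have "norm (\<phi> 1) \<le> C" using assms(2)[of 1] by simp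
  then have C: "0 \<le> C" using norm_ge_zero[of "\<phi> 1"] by linarith
  have "(norm (mult_L2T \<phi> f))\<^sup>2 \<le> integral\<^sup>L circle (\<lambda>z. C\<^sup>2 * (norm (rep_L2T f z))\<^sup>2)"
    unfolding norm_squared_rep
  proof (rule integral_mono_AE)
    show "AE z in circle. (norm (rep_L2T (mult_L2T \<phi> f) z))\<^sup>2 \<le> C\<^sup>2 * (norm (rep_L2T f z))\<^sup>2"
      using rep_mult_L2T[OF assms(1), of f] AE_space
    proof eventually_elim
      case (elim z)
      then show ?case using assms(2)[of z]
        by (auto simp: space_circle norm_mult power_mult_distrib intro!: mult_right_mono power_mono)
    qed
  qed (use square_integrable_rep in \<open>auto simp: square_integrable_def\<close>)
  also have "\<dots> = (C * norm f)\<^sup>2" by (simp add: norm_squared_rep power_mult_distrib)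
  finally show ?thesis using C by (simp add: power2_le_iff_abs_le)
qed

lemma mult_L2T_bounded:
  assumes "bounded_symbol \<phi>"
  shows "\<exists>C. \<forall>f. norm (mult_L2T \<phi> f) \<le> C * norm f"
  using assms norm_mult_L2T_le[OF assms] unfolding bounded_symbol_def by blast

lemma tendsto_mult_L2T:
  assumes "bounded_symbol \<phi>" "X \<longlonglongrightarrow> f"
  shows "(\<lambda>n. mult_L2T \<phi> (X n)) \<longlonglongrightarrow> mult_L2T \<phi> f"
proof (rule LIM_zero_cancel)
  obtain C where C: "\<And>f. norm (mult_L2T \<phi> f) \<le> C * norm f"
    using mult_L2T_bounded[OF assms(1)] by blast
  have "(\<lambda>n. C * norm (X n - f)) \<longlonglongrightarrow> 0"
    using tendsto_mult_left[OF tendsto_norm_zero[OF LIM_zero[OF assms(2)]], of C] by simp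
  then show "(\<lambda>n. mult_L2T \<phi> (X n) - mult_L2T \<phi> f) \<longlonglongrightarrow> 0"
    by (rule Lim_null_comparison[rotated]) (simp add: mult_L2T_diff[OF assms(1), symmetric] C)
qed

section \<open>Completeness of \<open>L\<^sup>2\<close>\<close>

text \<open>
  This is the Cauchy--Schwarz inequality against the constant 1, on a space of total mass 1.
\<close>

lemma integral_norm_le_norm_L2T: "integral\<^sup>L circle (\<lambda>z. norm (rep_L2T f z)) \<le> norm f"
  and integrable_norm_rep: "integrable circle (\<lambda>z. norm (rep_L2T f z))"
proof -
  let ?g = "\<lambda>z. complex_of_real (norm (rep_L2T f z))"
  have g: "square_integrable ?g"
    using square_integrable_rep[of f] by (simp add: square_integrable_def)
  have one: "square_integrable (\<lambda>_. 1)" by (simp add: square_integrable_def)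
  have i: "integrable circle ?g" using square_integrable_mult[OF g one] by simp
  show "integrable circle (\<lambda>z. norm (rep_L2T f z))"
    using integrable_norm[OF i] by simp
  have "cinner (abs_L2T ?g) (abs_L2T (\<lambda>_. 1)) = integral\<^sup>L circle ?g"
    using cinner.abs_eq[of ?g "\<lambda>_. 1"] g one by simp
  also have "\<dots> = of_real (integral\<^sup>L circle (\<lambda>z. norm (rep_L2T f z)))"
    by (rule integral_complex_of_real)
  finally have "norm (complex_of_real (integral\<^sup>L circle (\<lambda>z. norm (rep_L2T f z))))
      \<le> norm (abs_L2T ?g) * norm (abs_L2T (\<lambda>_. 1))"
    using Cauchy_Schwarz_cinner[of "abs_L2T ?g" "abs_L2T (\<lambda>_. 1)"] by simp
  moreover have "(norm (abs_L2T ?g))\<^sup>2 = (norm f)\<^sup>2"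
    unfolding norm_squared_abs[OF g] norm_squared_rep[of f] by simp
  moreover have "(norm (abs_L2T (\<lambda>_. 1)))\<^sup>2 = 1\<^sup>2"
    unfolding norm_squared_abs[OF one] by (simp add: space_circle measure_circle_space)
  then have "norm (abs_L2T (\<lambda>_. 1)) = 1"
    by (simp only: power2_eq_iff_nonneg norm_ge_zero zero_le_one)
  ultimately show "integral\<^sup>L circle (\<lambda>z. norm (rep_L2T f z)) \<le> norm f"
    by (simp add: power2_eq_iff_nonneg)
qed

text \<open>
  The integrals of the terms are bounded by a summable sequence, so the sum is integrable.
\<close>

lemma AE_summable_norm_rep:
  assumes "summable (\<lambda>k. norm (X k))"
  shows "AE z in circle. summable (\<lambda>k. norm (rep_L2T (X k) z))"
proof -
  have "(\<integral>\<^sup>+z. (\<Sum>k. ennreal (norm (rep_L2T (X k) z))) \<partial>circle)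
      = (\<Sum>k. \<integral>\<^sup>+z. ennreal (norm (rep_L2T (X k) z)) \<partial>circle)"
    by (rule nn_integral_suminf) measurable
  also have "\<dots> = (\<Sum>k. ennreal (integral\<^sup>L circle (\<lambda>z. norm (rep_L2T (X k) z))))"
    by (simp add: nn_integral_eq_integral[OF integrable_norm_rep])
  also have "\<dots> \<le> (\<Sum>k. ennreal (norm (X k)))"
    by (intro suminf_le) (auto intro!: ennreal_leI integral_norm_le_norm_L2T)
  also have "\<dots> < top"
    by (subst suminf_ennreal2[OF _ assms]) auto
  finally have "AE z in circle. (\<Sum>k. ennreal (norm (rep_L2T (X k) z))) \<noteq> \<infinity>"
    by (intro nn_integral_PInf_AE) (auto simp: top.not_eq_extremum)
  then show ?thesis
    by eventually_elim (rule summable_suminf_not_top, auto)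
qed

lemma summable_diff_subseq:
  fixes X :: "nat \<Rightarrow> 'a::real_normed_vector"
  assumes "Cauchy X"
  obtains r where "strict_mono r" "summable (\<lambda>k. norm (X (r (Suc k)) - X (r k)))"
proof -
  have "\<forall>k. \<exists>M. \<forall>m\<ge>M. \<forall>n\<ge>M. norm (X m - X n) < (1/2) ^ k"
    using CauchyD[OF assms] by simp
  then obtain M where M: "\<And>k m n. m \<ge> M k \<Longrightarrow> n \<ge> M k \<Longrightarrow> norm (X m - X n) < (1/2) ^ k"
    by metis
  define r where "r k = k + (\<Sum>i\<le>k. M i)" for k
  have r: "r k \<ge> M k" for k
    unfolding r_def by (rule trans_le_add2) (auto intro: member_le_sum)
  have mono: "strict_mono r"
    by (rule strict_mono_Suc_iff[THEN iffD2]) (simp add: r_def)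
  have "norm (X (r (Suc k)) - X (r k)) \<le> (1/2) ^ k" for k
  proof -
    have "r k \<le> r (Suc k)" using mono by (simp add: strict_mono_less_eq)
    then show ?thesis using M[of k "r (Suc k)" "r k"] r[of k] by simp
  qed
  then have "summable (\<lambda>k. norm (X (r (Suc k)) - X (r k)))"
    by (intro summable_comparison_test'[OF summable_geometric[of "1/2 :: real"]]) auto
  with mono show ?thesis by (rule that)
qed

text \<open>
  The argument of Riesz and Fischer: a subsequence with summable increments converges almost
  everywhere, and Fatou's lemma shows that its pointwise limit is also the limit in norm.
\<close>

lemma L2T_Cauchy_convergent:
  fixes X :: "nat \<Rightarrow> L2T"
  assumes "Cauchy X"
  shows "convergent X"
proof -
  obtain r where r: "strict_mono r" and sm: "summable (\<lambda>k. norm (X (r (Suc k)) - X (r k)))"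
    using summable_diff_subseq[OF assms] by blast
  define Y where "Y k = X (r k)" for k
  have CY: "Cauchy Y"
    using Cauchy_subseq_Cauchy[OF assms r] by (simp add: Y_def[abs_def] o_def)
  define g where "g z = lim (\<lambda>k. rep_L2T (Y k) z)" for z
  have g [measurable]: "g \<in> borel_measurable circle"
    unfolding g_def by (intro borel_measurable_lim_metric) measurable
  have "AE z in circle. \<forall>k. rep_L2T (Y (Suc k) - Y k) z = rep_L2T (Y (Suc k)) z - rep_L2T (Y k) z"
    by (subst AE_all_countable) (intro allI rep_L2T_diff)
  moreover have "AE z in circle. summable (\<lambda>k. norm (rep_L2T (Y (Suc k) - Y k) z))"
    using sm unfolding Y_def by (rule AE_summable_norm_rep)
  ultimately have lim: "AE z in circle. (\<lambda>k. rep_L2T (Y k) z) \<longlonglongrightarrow> g z"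
  proof eventually_elim
    case (elim z)
    then have "summable (\<lambda>k. rep_L2T (Y (Suc k)) z - rep_L2T (Y k) z)"
      by (auto intro: summable_norm_cancel)
    then have "convergent (\<lambda>n. \<Sum>k<n. rep_L2T (Y (Suc k)) z - rep_L2T (Y k) z)"
      by (simp add: summable_iff_convergent)
    then have "convergent (\<lambda>n. rep_L2T (Y n) z - rep_L2T (Y 0) z)"
      by (simp add: sum_lessThan_telescope[of "\<lambda>k. rep_L2T (Y k) z"])
    then have "convergent (\<lambda>n. rep_L2T (Y n) z - rep_L2T (Y 0) z + rep_L2T (Y 0) z)"
      by (intro convergent_add convergent_const)
    then show ?case unfolding g_def by (simp add: convergent_LIMSEQ_iff)
  qed
  \<comment> \<open>By Fatou, the distance of \<open>Y k\<close> to the pointwise limit is at most its distance to the tail.\<close>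
  have fatou: "square_integrable (\<lambda>z. g z - rep_L2T (Y k) z) \<and>
      integral\<^sup>L circle (\<lambda>z. (norm (g z - rep_L2T (Y k) z))\<^sup>2) \<le> e\<^sup>2"
    if e: "\<And>m. m \<ge> k \<Longrightarrow> norm (Y m - Y k) \<le> e" for k e
  proof -
    let ?h = "\<lambda>z. (norm (g z - rep_L2T (Y k) z))\<^sup>2"
    have e0: "0 \<le> e" using e[of k] by simp
    have "(\<integral>\<^sup>+z. ennreal (?h z) \<partial>circle)
        = (\<integral>\<^sup>+z. liminf (\<lambda>m. ennreal ((norm (rep_L2T (Y m) z - rep_L2T (Y k) z))\<^sup>2)) \<partial>circle)"
    proof (rule nn_integral_cong_AE)
      show "AE z in circle. ennreal (?h z)
          = liminf (\<lambda>m. ennreal ((norm (rep_L2T (Y m) z - rep_L2T (Y k) z))\<^sup>2))"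
        using lim
      proof eventually_elim
        case (elim z)
        then have "(\<lambda>m. ennreal ((norm (rep_L2T (Y m) z - rep_L2T (Y k) z))\<^sup>2)) \<longlonglongrightarrow> ennreal (?h z)"
          by (intro tendsto_intros)
        from lim_imp_Liminf[OF _ this] show ?case by (simp only: sequentially_bot not_False_eq_True)
      qed
    qed
    also have "\<dots> \<le> liminf (\<lambda>m. \<integral>\<^sup>+z. ennreal ((norm (rep_L2T (Y m) z - rep_L2T (Y k) z))\<^sup>2) \<partial>circle)"
      by (rule nn_integral_liminf) measurable
    also have "\<dots> = liminf (\<lambda>m. ennreal ((norm (Y m - Y k))\<^sup>2))"
    proof -
      have "(\<integral>\<^sup>+z. ennreal ((norm (rep_L2T (Y m) z - rep_L2T (Y k) z))\<^sup>2) \<partial>circle)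
          = ennreal ((norm (Y m - Y k))\<^sup>2)" for m
      proof -
        have "(\<integral>\<^sup>+z. ennreal ((norm (rep_L2T (Y m) z - rep_L2T (Y k) z))\<^sup>2) \<partial>circle)
            = (\<integral>\<^sup>+z. ennreal ((norm (rep_L2T (Y m - Y k) z))\<^sup>2) \<partial>circle)"
          using rep_L2T_diff[of "Y m" "Y k"] by (intro nn_integral_cong_AE) auto
        also have "\<dots> = ennreal ((norm (Y m - Y k))\<^sup>2)"
          unfolding norm_squared_rep using square_integrable_rep
          by (intro nn_integral_eq_integral) (auto simp: square_integrable_def)
        finally show ?thesis .
      qed
      then show ?thesis by simp
    qed
    also have "\<dots> \<le> ennreal (e\<^sup>2)"
    proof -
      have "eventually (\<lambda>m. ennreal ((norm (Y m - Y k))\<^sup>2) \<le> ennreal (e\<^sup>2)) sequentially"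
        using e by (intro eventually_sequentiallyI[of k] ennreal_leI power_mono) auto
      then have "liminf (\<lambda>m. ennreal ((norm (Y m - Y k))\<^sup>2)) \<le> liminf (\<lambda>m. ennreal (e\<^sup>2))"
        by (rule Liminf_mono)
      then show ?thesis by (simp add: Liminf_const)
    qed
    finally have le: "(\<integral>\<^sup>+z. ennreal (?h z) \<partial>circle) \<le> ennreal (e\<^sup>2)" .
    then have "integrable circle ?h"
      by (intro integrableI_bounded) (auto intro: le_less_trans[OF _ ennreal_less_top])
    moreover from this have "integral\<^sup>L circle ?h \<le> e\<^sup>2"
      using le by (simp add: nn_integral_eq_integral)
    ultimately show ?thesis by (simp add: square_integrable_def)
  qed
  have tail: "\<exists>K. \<forall>k\<ge>K. \<forall>m\<ge>k. norm (Y m - Y k) \<le> e" if "e > 0" for e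
    using CauchyD[OF CY that] by (meson less_imp_le order_trans)
  obtain K where "\<And>m. m \<ge> K \<Longrightarrow> norm (Y m - Y K) \<le> 1" using tail[of 1] by auto
  from fatou[OF this] have "square_integrable (\<lambda>z. (g z - rep_L2T (Y K) z) + rep_L2T (Y K) z)"
    by (intro square_integrable_add square_integrable_rep) auto
  then have sg: "square_integrable g" by simp
  have "Y \<longlonglongrightarrow> abs_L2T g"
  proof (rule metric_LIMSEQ_I)
    fix e :: real assume "e > 0"
    then obtain K where K: "\<And>k m. k \<ge> K \<Longrightarrow> m \<ge> k \<Longrightarrow> norm (Y m - Y k) \<le> e / 2"
      using tail[of "e / 2"] by auto
    have "dist (Y k) (abs_L2T g) < e" if "k \<ge> K" for k
    proof -
      have "(norm (abs_L2T g - Y k))\<^sup>2 \<le> (e / 2)\<^sup>2"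
        using fatou[OF K[OF that]] norm_squared_abs_diff[OF sg, of "Y k"] by simp
      then have "norm (abs_L2T g - Y k) \<le> e / 2"
        using \<open>e > 0\<close> by (simp add: power2_le_iff_abs_le)
      then show ?thesis using \<open>e > 0\<close> by (simp add: dist_norm norm_minus_commute)
    qed
    then show "\<exists>K. \<forall>k\<ge>K. dist (Y k) (abs_L2T g) < e" by blast
  qed
  then have "X \<longlonglongrightarrow> abs_L2T g"
    using Cauchy_converges_subseq[OF assms r] by (simp add: Y_def[abs_def] o_def)
  then show ?thesis by (rule convergentI)
qed

instance L2T :: banach
  by standard (rule L2T_Cauchy_convergent)

section \<open>Orthogonal projections\<close>

lemma parallelogram:
  fixes x y :: "'a::real_inner"
  shows "(norm (x + y))\<^sup>2 + (norm (x - y))\<^sup>2 = 2 * (norm x)\<^sup>2 + 2 * (norm y)\<^sup>2"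
  by (simp add: power2_norm_eq_inner inner_simps inner_commute)

text \<open>
  By the parallelogram law two almost nearest points are close to each other, since their midpoint
  is not nearer to \<open>f\<close> than the distance allows. Minimizing sequences are therefore Cauchy.
\<close>

lemma nearest_point_exists:
  assumes S: "closed S" "L2T.subspace S"
  shows "\<exists>g\<in>S. \<forall>s\<in>S. norm (f - g) \<le> norm (f - s)"
proof -
  have S0: "0 \<in> S" using S(2) by (rule L2T.subspace_0)
  define d where "d = infdist f S"
  have d0: "0 \<le> d" by (simp add: d_def infdist_nonneg)
  have dle: "d \<le> norm (f - s)" if "s \<in> S" for s
    using infdist_le[OF that, of f] by (simp add: d_def dist_norm)
  have "\<exists>s\<in>S. norm (f - s) < d + 1 / (real n + 1)" for n
  proof -
    have "infdist f S < d + 1 / (real n + 1)" by (simp add: d_def)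
    moreover have "infdist f S = (INF s\<in>S. dist f s)" using S0 by (auto simp: infdist_def)
    ultimately show ?thesis
      using cInf_lessD[of "dist f ` S" "d + 1 / (real n + 1)"] S0 by (auto simp: dist_norm)
  qed
  then obtain s where s: "\<And>n. s n \<in> S" "\<And>n. norm (f - s n) < d + 1 / (real n + 1)" by metis
  have near: "(norm (s m - s n))\<^sup>2 \<le> (8 * d + 4) / (real N + 1)" if "m \<ge> N" "n \<ge> N" for m n N
  proof -
    have b: "(norm (f - s k))\<^sup>2 \<le> (d + 1 / (real N + 1))\<^sup>2" if "k \<ge> N" for k
    proof -
      have "1 / (real k + 1) \<le> 1 / (real N + 1)" using that by (intro divide_left_mono) auto
      then show ?thesis using s(2)[of k] by (intro power_mono) auto
    qed
    have mid: "(1/2) *\<^sub>C (s m + s n) \<in> S"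
      using s(1) S(2) by (simp add: L2T.subspace_add L2T.subspace_scale)
    have "(f - s m) + (f - s n) = 2 *\<^sub>C (f - (1/2) *\<^sub>C (s m + s n))"
      by (simp add: L2T.scale_right_diff_distrib L2T.scale_left_distrib[of 1 1, simplified])
    then have "(norm ((f - s m) + (f - s n)))\<^sup>2 = 4 * (norm (f - (1/2) *\<^sub>C (s m + s n)))\<^sup>2"
      by (simp add: power_mult_distrib)
    also have "\<dots> \<ge> 4 * d\<^sup>2" using dle[OF mid] d0 by (intro mult_left_mono power_mono) auto
    finally have "(norm ((f - s m) - (f - s n)))\<^sup>2 \<le> 4 * (d + 1 / (real N + 1))\<^sup>2 - 4 * d\<^sup>2"
      using parallelogram[of "f - s m" "f - s n"] b[OF that(1)] b[OF that(2)] by linarith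
    also have "4 * (d + t)\<^sup>2 - 4 * d\<^sup>2 = (8 * d + 4 * t) * t" for t
      by (simp add: power2_eq_square algebra_simps)
    also have "(8 * d + 4 * (1 / (real N + 1))) * (1 / (real N + 1)) \<le> (8 * d + 4) * (1 / (real N + 1))"
      by (intro mult_right_mono) (auto simp: field_simps)
    finally show ?thesis by (simp add: norm_minus_commute)
  qed
  have "Cauchy s"
  proof (rule CauchyI)
    fix e :: real assume "e > 0"
    obtain N where N: "(8 * d + 4) / e\<^sup>2 < real N" using reals_Archimedean2 by blast
    then have "8 * d + 4 < e\<^sup>2 * real N" using \<open>e > 0\<close> by (simp add: field_simps)
    also have "\<dots> \<le> e\<^sup>2 * (real N + 1)" by (intro mult_left_mono) auto
    finally have "8 * d + 4 < e\<^sup>2 * (real N + 1)" .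
    then have "(8 * d + 4) / (real N + 1) < e\<^sup>2" by (simp add: field_simps)
    then have "norm (s m - s n) < e" if "m \<ge> N" "n \<ge> N" for m n
      using near[OF that] \<open>e > 0\<close> by (intro power2_less_imp_less[of _ e]) auto
    then show "\<exists>N. \<forall>m\<ge>N. \<forall>n\<ge>N. norm (s m - s n) < e" by blast
  qed
  then obtain g where g: "s \<longlonglongrightarrow> g" using convergent_eq_Cauchy by blast
  have "g \<in> S" using S(1) s(1) g by (auto simp: closed_sequential_limits)
  moreover have "norm (f - g) \<le> d"
  proof (rule LIMSEQ_le)
    show "(\<lambda>n. norm (f - s n)) \<longlonglongrightarrow> norm (f - g)" by (intro tendsto_intros g)
    have "(\<lambda>n. d + 1 / (real n + 1)) \<longlonglongrightarrow> d + 0"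
      using LIMSEQ_inverse_real_of_nat by (intro tendsto_intros) (simp add: field_simps)
    then show "(\<lambda>n. d + 1 / (real n + 1)) \<longlonglongrightarrow> d" by simp
  qed (use s(2) in \<open>auto intro: less_imp_le\<close>)
  ultimately show ?thesis using dle order_trans by blast
qed

text \<open>
  If \<open>g\<close> is nearest to \<open>f\<close>, then adding to it the component of \<open>f - g\<close> along \<open>s \<in> S\<close> cannot decrease
  the distance, so this component is zero.
\<close>

lemma orth_proj_exists:
  assumes S: "closed S" "L2T.subspace S"
  shows "\<exists>g. g \<in> S \<and> f - g \<in> orth_compl S"
proof -
  obtain g where g: "g \<in> S" "\<And>s. s \<in> S \<Longrightarrow> norm (f - g) \<le> norm (f - s)"
    using nearest_point_exists[OF S] by blast
  have "cinner (f - g) s = 0" if s: "s \<in> S" for s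
  proof (cases "s = 0")
    case False
    define c where "c = cinner (f - g) s / of_real ((norm s)\<^sup>2)"
    have orth: "cinner (f - g - c *\<^sub>C s) (c *\<^sub>C s) = 0"
      using False by (simp add: cinner_simps cinner_self c_def)
    have "g + c *\<^sub>C s \<in> S" using S g s by (simp add: L2T.subspace_add L2T.subspace_scale)
    from g(2)[OF this] have "(norm (f - g))\<^sup>2 \<le> (norm (f - g - c *\<^sub>C s))\<^sup>2"
      by (intro power_mono) (auto simp: algebra_simps)
    moreover have "(norm (f - g))\<^sup>2 = (norm (f - g - c *\<^sub>C s))\<^sup>2 + (norm (c *\<^sub>C s))\<^sup>2"
      using norm_add_squared_orthogonal[OF orth] by simp
    ultimately have "norm (c *\<^sub>C s) = 0" by simp
    then have "c = 0" using False by simp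
    then show ?thesis using False by (simp add: c_def)
  qed simp
  then show ?thesis using g(1) by (auto simp: orth_compl_def)
qed

lemma orth_proj_unique:
  assumes "L2T.subspace S" "g \<in> S" "f - g \<in> orth_compl S" "h \<in> S" "f - h \<in> orth_compl S"
  shows "g = h"
proof -
  have "g - h \<in> S" using assms by (simp add: L2T.subspace_diff)
  moreover have "g - h \<in> orth_compl S"
    using L2T.subspace_diff[OF subspace_orth_compl assms(5,3)] by simp
  ultimately have "cinner (g - h) (g - h) = 0" by (simp add: orth_compl_def)
  then show ?thesis by simp
qed

lemma orth_proj_eqI:
  assumes "L2T.subspace S" "g \<in> S" "f - g \<in> orth_compl S"
  shows "orth_proj S f = g"
  unfolding orth_proj_def using assms orth_proj_unique by (intro the_equality) blast+

locale closed_subspace =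
  fixes S :: "L2T set"
  assumes closed: "closed S" and subspace: "L2T.subspace S"
begin

lemma orth_proj_mem: "orth_proj S f \<in> S"
  and orth_proj_diff: "f - orth_proj S f \<in> orth_compl S"
  using orth_proj_exists[OF closed subspace, of f] orth_proj_eqI[OF subspace, of _ f] by metis+

lemma orth_proj_id: "f \<in> S \<Longrightarrow> orth_proj S f = f"
  by (rule orth_proj_eqI[OF subspace]) (auto simp: orth_compl_def)

lemma orth_proj_add: "orth_proj S (f + g) = orth_proj S f + orth_proj S g"
proof (rule orth_proj_eqI[OF subspace])
  have "(f - orth_proj S f) + (g - orth_proj S g) \<in> orth_compl S"
    by (intro L2T.subspace_add[OF subspace_orth_compl] orth_proj_diff)
  then show "f + g - (orth_proj S f + orth_proj S g) \<in> orth_compl S" by (simp add: algebra_simps)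
qed (intro L2T.subspace_add[OF subspace] orth_proj_mem)

lemma orth_proj_scaleC: "orth_proj S (c *\<^sub>C f) = c *\<^sub>C orth_proj S f"
proof (rule orth_proj_eqI[OF subspace])
  have "c *\<^sub>C (f - orth_proj S f) \<in> orth_compl S"
    by (intro L2T.subspace_scale[OF subspace_orth_compl] orth_proj_diff)
  then show "c *\<^sub>C f - c *\<^sub>C orth_proj S f \<in> orth_compl S"
    by (simp add: L2T.scale_right_diff_distrib)
qed (intro L2T.subspace_scale[OF subspace] orth_proj_mem)

lemma norm_orth_proj_le: "norm (orth_proj S f) \<le> norm f"
proof -
  have "cinner (f - orth_proj S f) (orth_proj S f) = 0"
    using orth_proj_diff orth_proj_mem by (auto simp: orth_compl_def)
  from norm_add_squared_orthogonal[OF this]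
  have "(norm (orth_proj S f))\<^sup>2 \<le> (norm f)\<^sup>2" by simp
  then show ?thesis by (rule power2_le_imp_le) simp
qed

end

section \<open>Bounded operators and finite rank perturbations\<close>

lemma bounded_operator_onD:
  assumes "bounded_operator_on S T"
  shows "f \<in> S \<Longrightarrow> T f \<in> S"
    and "f \<in> S \<Longrightarrow> g \<in> S \<Longrightarrow> T (f + g) = T f + T g"
    and "f \<in> S \<Longrightarrow> T (c *\<^sub>C f) = c *\<^sub>C T f"
  using assms unfolding bounded_operator_on_def by blast+

lemma bounded_operator_on_bound:
  assumes "bounded_operator_on S T"
  obtains C where "0 \<le> C" "\<And>f. f \<in> S \<Longrightarrow> norm (T f) \<le> C * norm f"
proof -
  obtain C where C: "\<And>f. f \<in> S \<Longrightarrow> norm (T f) \<le> C * norm f"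
    using assms unfolding bounded_operator_on_def by blast
  have "norm (T f) \<le> \<bar>C\<bar> * norm f" if "f \<in> S" for f
  proof -
    have "C * norm f \<le> \<bar>C\<bar> * norm f" by (intro mult_right_mono) auto
    then show ?thesis using C[OF that] by linarith
  qed
  then show ?thesis by (intro that[of "\<bar>C\<bar>"]) auto
qed

context closed_subspace
begin

lemmas mem_add = L2T.subspace_add[OF subspace]
  and mem_diff = L2T.subspace_diff[OF subspace]
  and mem_scale = L2T.subspace_scale[OF subspace]
  and mem_zero = L2T.subspace_0[OF subspace]

lemma bounded_operator_onI:
  assumes "\<And>f. f \<in> S \<Longrightarrow> T f \<in> S"
    and "\<And>f g. f \<in> S \<Longrightarrow> g \<in> S \<Longrightarrow> T (f + g) = T f + T g"
    and "\<And>c f. f \<in> S \<Longrightarrow> T (c *\<^sub>C f) = c *\<^sub>C T f"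
    and "\<And>f. f \<in> S \<Longrightarrow> norm (T f) \<le> C * norm f"
  shows "bounded_operator_on S T"
  using assms unfolding bounded_operator_on_def by blast

lemma bounded_operator_on_id: "bounded_operator_on S (\<lambda>f. f)"
  by (rule bounded_operator_onI[where C=1]) auto

lemma bounded_operator_on_zero: "bounded_operator_on S (\<lambda>f. 0)"
  by (rule bounded_operator_onI[where C=0]) (auto simp: mem_zero)

lemma bounded_operator_on_scale:
  assumes T: "bounded_operator_on S T"
  shows "bounded_operator_on S (\<lambda>f. c *\<^sub>C T f)"
proof -
  obtain C where C: "0 \<le> C" "\<And>f. f \<in> S \<Longrightarrow> norm (T f) \<le> C * norm f"
    using bounded_operator_on_bound[OF T] by blast
  have "norm (c *\<^sub>C T f) \<le> (norm c * C) * norm f" if "f \<in> S" for f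
    using mult_left_mono[OF C(2)[OF that], of "norm c"] by (simp add: mult.assoc)
  then show ?thesis
    by (rule bounded_operator_onI[rotated 3])
       (auto simp: bounded_operator_onD[OF T] L2T.scale_right_distrib mem_scale mult.commute)
qed

lemma bounded_operator_on_add:
  assumes T: "bounded_operator_on S T" and T': "bounded_operator_on S T'"
  shows "bounded_operator_on S (\<lambda>f. T f + T' f)"
proof -
  obtain C where C: "0 \<le> C" "\<And>f. f \<in> S \<Longrightarrow> norm (T f) \<le> C * norm f"
    using bounded_operator_on_bound[OF T] by blast
  obtain C' where C': "0 \<le> C'" "\<And>f. f \<in> S \<Longrightarrow> norm (T' f) \<le> C' * norm f"
    using bounded_operator_on_bound[OF T'] by blast
  have "norm (T f + T' f) \<le> (C + C') * norm f" if "f \<in> S" for f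
    using norm_triangle_ineq[of "T f" "T' f"] C(2)[OF that] C'(2)[OF that]
    by (simp add: distrib_right)
  then show ?thesis
    by (rule bounded_operator_onI[rotated 3])
       (auto simp: bounded_operator_onD[OF T] bounded_operator_onD[OF T'] L2T.scale_right_distrib
          mem_add algebra_simps)
qed

lemma bounded_operator_on_diff:
  assumes "bounded_operator_on S T" "bounded_operator_on S T'"
  shows "bounded_operator_on S (\<lambda>f. T f - T' f)"
  using bounded_operator_on_add[OF assms(1) bounded_operator_on_scale[OF assms(2), of "-1"]]
  by (simp add: scaleC_minus_one)

lemma bounded_operator_on_compose:
  assumes T: "bounded_operator_on S T" and T': "bounded_operator_on S T'"
  shows "bounded_operator_on S (\<lambda>f. T (T' f))"
proof -
  obtain C where C: "0 \<le> C" "\<And>f. f \<in> S \<Longrightarrow> norm (T f) \<le> C * norm f"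
    using bounded_operator_on_bound[OF T] by blast
  obtain C' where C': "0 \<le> C'" "\<And>f. f \<in> S \<Longrightarrow> norm (T' f) \<le> C' * norm f"
    using bounded_operator_on_bound[OF T'] by blast
  have "norm (T (T' f)) \<le> (C * C') * norm f" if "f \<in> S" for f
    using C(2)[OF bounded_operator_onD(1)[OF T' that]] mult_left_mono[OF C'(2)[OF that] C(1)]
    by (simp add: mult.assoc)
  then show ?thesis
    by (rule bounded_operator_onI[rotated 3])
       (auto simp: bounded_operator_onD[OF T] bounded_operator_onD[OF T'])
qed

lemma bounded_operator_on_zero_eq:
  assumes "bounded_operator_on S T"
  shows "T 0 = 0"
proof -
  have "T (0 *\<^sub>C 0) = 0 *\<^sub>C T 0"
    using assms mem_zero unfolding bounded_operator_on_def by blast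
  then show ?thesis by simp
qed

lemma bounded_operator_on_diff_eq:
  assumes "bounded_operator_on S T" "f \<in> S" "g \<in> S"
  shows "T (f - g) = T f - T g"
proof -
  have "T (f + (-1) *\<^sub>C g) = T f + (-1) *\<^sub>C T g"
    using assms mem_scale[OF assms(3), of "-1"] unfolding bounded_operator_on_def by metis
  then show ?thesis by (simp only: scaleC_minus_one) simp
qed

lemma invertible_on_compose:
  assumes "invertible_on S T" "invertible_on S T'" "bounded_operator_on S T'"
  shows "invertible_on S (\<lambda>f. T (T' f))"
proof -
  obtain R where R: "bounded_operator_on S R" "\<And>f. f \<in> S \<Longrightarrow> R (T f) = f \<and> T (R f) = f"
    using assms(1) unfolding invertible_on_def by blast
  obtain R' where R': "bounded_operator_on S R'" "\<And>f. f \<in> S \<Longrightarrow> R' (T' f) = f \<and> T' (R' f) = f"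
    using assms(2) unfolding invertible_on_def by blast
  have "R f \<in> S" "T' f \<in> S" if "f \<in> S" for f
    using that R(1) assms(3) by (auto simp: bounded_operator_on_def)
  then show ?thesis
    unfolding invertible_on_def using bounded_operator_on_compose[OF R'(1) R(1)] R(2) R'(2)
    by (intro exI[of _ "\<lambda>f. R' (R f)"]) auto
qed

lemma invertible_on_bounded_below:
  assumes T: "bounded_operator_on S T"
    and c: "c > 0" "\<And>f. f \<in> S \<Longrightarrow> c * norm f \<le> norm (T f)"
    and surj: "\<And>g. g \<in> S \<Longrightarrow> \<exists>f\<in>S. T f = g"
  shows "invertible_on S T"
proof -
  have inj: "f = g" if "f \<in> S" "g \<in> S" "T f = T g" for f g
  proof -
    have "c * norm (f - g) \<le> norm (T (f - g))" using that by (intro c mem_diff)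
    also have "T (f - g) = 0" using bounded_operator_on_diff_eq[OF T that(1,2)] that(3) by simp
    finally have "c * norm (f - g) \<le> 0" by simp
    then show ?thesis using c(1) by (simp add: mult_le_0_iff)
  qed
  define R where "R g = (SOME f. f \<in> S \<and> T f = g)" for g
  have R: "R g \<in> S \<and> T (R g) = g" if "g \<in> S" for g
    unfolding R_def using someI_ex[of "\<lambda>f. f \<in> S \<and> T f = g"] surj[OF that] by blast
  note Tadd = bounded_operator_onD(2)[OF T] and Tscale = bounded_operator_onD(3)[OF T]
    and Tmem = bounded_operator_onD(1)[OF T]
  have "bounded_operator_on S R"
  proof (rule bounded_operator_onI[where C="1 / c"])
    fix f g b assume fg: "f \<in> S" "g \<in> S"
    show "R (f + g) = R f + R g"
      using R[OF fg(1)] R[OF fg(2)] R[OF mem_add[OF fg]] by (auto intro!: inj[of "R (f + g)"] simp: Tadd mem_add)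
  next
    fix f b assume f: "f \<in> S"
    show "R (b *\<^sub>C f) = b *\<^sub>C R f"
      using R[OF f] R[OF mem_scale[OF f]] by (auto intro!: inj[of "R (b *\<^sub>C f)"] simp: Tscale mem_scale)
    show "norm (R f) \<le> 1 / c * norm f"
      using R[OF f] c(2)[of "R f"] c(1) by (simp add: field_simps)
  qed (use R in blast)
  moreover have "R (T f) = f" if "f \<in> S" for f
    using that R[of "T f"] Tmem[OF that] by (auto intro!: inj[of "R (T f)"])
  ultimately show ?thesis using R unfolding invertible_on_def by blast
qed

end

text \<open>
  A basis of the span is mapped to an independent set of the same size, which by the exchange lemma
  cannot be enlarged within the span.
\<close>

lemma linear_inj_on_span_surj:
  assumes A: "Vector_Spaces.linear scaleC scaleC A" and B: "finite B"
    and maps: "A ` L2T.span B \<subseteq> L2T.span B"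
    and inj: "\<And>v. v \<in> L2T.span B \<Longrightarrow> A v = 0 \<Longrightarrow> v = 0"
  shows "L2T.span B \<subseteq> A ` L2T.span B"
proof -
  interpret A: Vector_Spaces.linear scaleC scaleC A by (rule A)
  obtain C where C: "C \<subseteq> L2T.span B" "L2T.independent C" "L2T.span B \<subseteq> L2T.span C"
    using L2T.maximal_independent_subset[of "L2T.span B"] by blast
  have sp: "L2T.span C = L2T.span B"
    using C L2T.span_minimal[OF C(1) L2T.subspace_span] by auto
  have finC: "finite C" using L2T.independent_span_bound[OF B C(2,1)] by simp
  have inj_on: "inj_on A (L2T.span C)"
    unfolding A.inj_on_iff_eq_0[OF L2T.subspace_span] using inj sp by auto
  have indep: "L2T.independent (A ` C)"
    using A.independent_inj_on_image[OF C(2) inj_on] .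
  have card: "card (A ` C) = card C"
    by (intro card_image inj_on_subset[OF inj_on] L2T.span_superset)
  have sub: "A ` C \<subseteq> L2T.span C"
    using maps sp L2T.span_superset[of C] by blast
  have "w \<in> L2T.span (A ` C)" if w: "w \<in> L2T.span B" for w
  proof (rule ccontr)
    assume nw: "w \<notin> L2T.span (A ` C)"
    then have "L2T.independent (insert w (A ` C))"
      using indep by (rule L2T.independent_insertI)
    moreover have "insert w (A ` C) \<subseteq> L2T.span C" using w sub sp by auto
    ultimately have "card (insert w (A ` C)) \<le> card C"
      using L2T.independent_span_bound[OF finC] by blast
    moreover have "w \<notin> A ` C" using nw L2T.span_base by blast
    ultimately show False using finC card by simp
  qed
  then show ?thesis using A.span_image[of C] sp by auto
qed

text \<open>
  Phrased for a family instead of a set, so that coinciding values count as a dependence.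
\<close>

lemma span_family_dependent:
  fixes h :: "nat \<Rightarrow> L2T"
  assumes B: "finite B" and h: "\<And>k. h k \<in> L2T.span B"
  shows "\<exists>K u. finite K \<and> (\<exists>k\<in>K. u k \<noteq> 0) \<and> (\<Sum>k\<in>K. u k *\<^sub>C h k) = 0"
proof (cases "inj h")
  case False
  then obtain i j where ij: "i \<noteq> j" "h i = h j" by (auto simp: inj_def)
  let ?u = "\<lambda>k. if k = i then 1 else -1 :: complex"
  have "(\<Sum>k\<in>{i, j}. ?u k *\<^sub>C h k) = 0" using ij by (simp add: scaleC_minus_one)
  then show ?thesis by (intro exI[of _ "{i, j}"] exI[of _ ?u]) auto
next
  case True
  let ?K = "{..card B}"
  have inj: "inj_on h ?K" using True by (rule inj_on_subset) auto
  have "L2T.dependent (h ` ?K)"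
  proof (rule ccontr)
    assume "\<not> L2T.dependent (h ` ?K)"
    then have "card (h ` ?K) \<le> card B" using L2T.independent_span_bound[OF B] h by blast
    then show False using card_image[OF inj] by simp
  qed
  then obtain u where u: "\<exists>v\<in>h ` ?K. u v \<noteq> 0" "(\<Sum>v\<in>h ` ?K. u v *\<^sub>C v) = 0"
    using L2T.dependent_finite[of "h ` ?K"] by auto
  then show ?thesis
    using sum.reindex[OF inj, of "\<lambda>v. u v *\<^sub>C v"]
    by (intro exI[of _ ?K] exI[of _ "\<lambda>k. u (h k)"]) auto
qed

definition functional_on :: "L2T set \<Rightarrow> (L2T \<Rightarrow> complex) \<Rightarrow> bool" where
  "functional_on S l \<longleftrightarrow>
     (\<forall>f\<in>S. \<forall>g\<in>S. l (f + g) = l f + l g) \<and> (\<forall>c. \<forall>f\<in>S. l (c *\<^sub>C f) = c * l f) \<and>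
     (\<exists>C. \<forall>f\<in>S. norm (l f) \<le> C * norm f)"

text \<open>
  Finite rank is recorded by an explicit list of functionals and vectors, so that bounded operators
  can be built from the functionals; the vectors need not lie in the domain.
\<close>

definition finite_rank_on :: "L2T set \<Rightarrow> (L2T \<Rightarrow> L2T) \<Rightarrow> bool" where
  "finite_rank_on S F \<longleftrightarrow>
     (\<exists>L. (\<forall>(l, v)\<in>set L. functional_on S l) \<and> (\<forall>f\<in>S. F f = (\<Sum>(l, v)\<leftarrow>L. l f *\<^sub>C v)))"

lemma functional_on_cinner: "functional_on S (\<lambda>f. cinner f g)"
  unfolding functional_on_def using Cauchy_Schwarz_cinner[of _ g]
  by (auto simp: cinner_simps mult.commute intro!: exI[of _ "norm g"])

lemma functional_on_compose:
  assumes l: "functional_on S l" and T: "bounded_operator_on S T"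
  shows "functional_on S (\<lambda>f. l (T f))"
proof -
  obtain C where C: "\<And>f. f \<in> S \<Longrightarrow> norm (l f) \<le> C * norm f"
    using l unfolding functional_on_def by blast
  obtain C' where C': "0 \<le> C'" "\<And>f. f \<in> S \<Longrightarrow> norm (T f) \<le> C' * norm f"
    using bounded_operator_on_bound[OF T] by blast
  have "norm (l (T f)) \<le> (\<bar>C\<bar> * C') * norm f" if f: "f \<in> S" for f
  proof -
    have "norm (l (T f)) \<le> C * norm (T f)" by (intro C bounded_operator_onD(1)[OF T] f)
    also have "\<dots> \<le> \<bar>C\<bar> * norm (T f)" by (intro mult_right_mono) auto
    also have "\<dots> \<le> \<bar>C\<bar> * (C' * norm f)" using C'(2)[OF f] by (intro mult_left_mono) auto
    finally show ?thesis by (simp add: mult.assoc)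
  qed
  moreover have "l (T (f + g)) = l (T f) + l (T g)" "l (T (c *\<^sub>C f)) = c * l (T f)"
    if "f \<in> S" "g \<in> S" for f g c
    using l that bounded_operator_onD[OF T] unfolding functional_on_def by simp_all
  ultimately show ?thesis unfolding functional_on_def by blast
qed

lemma finite_rank_on_rank_one:
  "functional_on S l \<Longrightarrow> finite_rank_on S (\<lambda>f. l f *\<^sub>C v)"
  unfolding finite_rank_on_def by (intro exI[of _ "[(l, v)]"]) auto

lemma finite_rank_on_zero: "finite_rank_on S (\<lambda>f. 0)"
  unfolding finite_rank_on_def by (intro exI[of _ "[]"]) auto

lemma finite_rank_on_cong:
  "(\<And>f. f \<in> S \<Longrightarrow> F f = G f) \<Longrightarrow> finite_rank_on S G \<Longrightarrow> finite_rank_on S F"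
  unfolding finite_rank_on_def by simp

lemma finite_rank_on_add:
  assumes "finite_rank_on S F" "finite_rank_on S G"
  shows "finite_rank_on S (\<lambda>f. F f + G f)"
proof -
  obtain L where L: "\<forall>(l, v)\<in>set L. functional_on S l" "\<forall>f\<in>S. F f = (\<Sum>(l, v)\<leftarrow>L. l f *\<^sub>C v)"
    using assms(1) unfolding finite_rank_on_def by blast
  obtain L' where L': "\<forall>(l, v)\<in>set L'. functional_on S l"
    "\<forall>f\<in>S. G f = (\<Sum>(l, v)\<leftarrow>L'. l f *\<^sub>C v)"
    using assms(2) unfolding finite_rank_on_def by blast
  show ?thesis
    unfolding finite_rank_on_def using L L' by (intro exI[of _ "L @ L'"]) auto
qed

lemma finite_rank_on_compose_left:
  assumes F: "finite_rank_on S F"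
    and T: "\<And>f g. T (f + g) = T f + T g" "\<And>c f. T (c *\<^sub>C f) = c *\<^sub>C T f"
  shows "finite_rank_on S (\<lambda>f. T (F f))"
proof -
  obtain L where L: "\<forall>(l, v)\<in>set L. functional_on S l" "\<forall>f\<in>S. F f = (\<Sum>(l, v)\<leftarrow>L. l f *\<^sub>C v)"
    using F unfolding finite_rank_on_def by blast
  have T0: "T 0 = 0" using T(2)[of 0 0] by simp
  have "T (\<Sum>(l, v)\<leftarrow>L. l f *\<^sub>C v) = (\<Sum>(l, v)\<leftarrow>map (\<lambda>(l, v). (l, T v)) L. l f *\<^sub>C v)" for f
    by (induction L) (auto simp: T T0)
  then show ?thesis
    unfolding finite_rank_on_def using L by (intro exI[of _ "map (\<lambda>(l, v). (l, T v)) L"]) auto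
qed

lemma finite_rank_on_compose_right:
  assumes F: "finite_rank_on S F" and T: "bounded_operator_on S T"
  shows "finite_rank_on S (\<lambda>f. F (T f))"
proof -
  obtain L where L: "\<forall>(l, v)\<in>set L. functional_on S l" "\<forall>f\<in>S. F f = (\<Sum>(l, v)\<leftarrow>L. l f *\<^sub>C v)"
    using F unfolding finite_rank_on_def by blast
  have "(\<Sum>(l, v)\<leftarrow>L. l (T f) *\<^sub>C v) = (\<Sum>(l, v)\<leftarrow>map (\<lambda>(l, v). (\<lambda>f. l (T f), v)) L. l f *\<^sub>C v)" for f
    by (induction L) auto
  moreover have "T f \<in> S" if "f \<in> S" for f
    using T that by (simp add: bounded_operator_on_def)
  ultimately show ?thesis
    unfolding finite_rank_on_def using L functional_on_compose[OF _ T]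
    by (intro exI[of _ "map (\<lambda>(l, v). (\<lambda>f. l (T f), v)) L"]) fastforce
qed

lemma sum_list_scaleC_in_span: "(\<Sum>(l, v)\<leftarrow>L. l f *\<^sub>C v) \<in> L2T.span (snd ` set L)"
proof (induction L)
  case Nil
  then show ?case by (simp add: L2T.span_zero)
next
  case (Cons p L)
  have "snd p \<in> L2T.span (snd ` set (p # L))" by (intro L2T.span_base) simp
  moreover have "(\<Sum>(l, v)\<leftarrow>L. l f *\<^sub>C v) \<in> L2T.span (snd ` set (p # L))"
    using Cons L2T.span_mono[of "snd ` set L" "snd ` set (p # L)"] by auto
  ultimately show ?case
    by (cases p) (simp add: L2T.span_add L2T.span_scale)
qed

lemma finite_rank_on_range:
  assumes "finite_rank_on S F"
  shows "\<exists>B. finite B \<and> (\<forall>f\<in>S. F f \<in> L2T.span B)"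
proof -
  obtain L where L: "\<forall>f\<in>S. F f = (\<Sum>(l, v)\<leftarrow>L. l f *\<^sub>C v)"
    using assms unfolding finite_rank_on_def by blast
  show ?thesis
    using L sum_list_scaleC_in_span[of _ L] by (intro exI[of _ "snd ` set L"]) simp
qed

lemma (in closed_subspace) bounded_operator_on_sum_functionals:
  assumes "\<forall>(l, v)\<in>set L. functional_on S l \<and> X v \<in> S"
  shows "bounded_operator_on S (\<lambda>f. \<Sum>(l, v)\<leftarrow>L. l f *\<^sub>C X v)"
  using assms
proof (induction L)
  case Nil
  then show ?case by (simp add: bounded_operator_on_zero)
next
  case (Cons p L)
  obtain l v where p: "p = (l, v)" by (cases p)
  have l: "functional_on S l" and v: "X v \<in> S" using Cons.prems p by auto
  obtain C where C: "\<And>f. f \<in> S \<Longrightarrow> norm (l f) \<le> C * norm f"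
    using l unfolding functional_on_def by blast
  have "bounded_operator_on S (\<lambda>f. l f *\<^sub>C X v)"
  proof (rule bounded_operator_onI[where C="C * norm (X v)"])
    fix f assume "f \<in> S"
    then have "norm (l f) * norm (X v) \<le> (C * norm f) * norm (X v)"
      by (intro mult_right_mono C) auto
    then show "norm (l f *\<^sub>C X v) \<le> C * norm (X v) * norm f" by (simp add: mult_ac)
  qed (use l v in \<open>auto simp: functional_on_def L2T.scale_left_distrib mem_scale\<close>)
  moreover have "bounded_operator_on S (\<lambda>f. \<Sum>(l, v)\<leftarrow>L. l f *\<^sub>C X v)"
    using Cons by auto
  ultimately show ?case using p by (auto dest: bounded_operator_on_add)
qed

text \<open>
  Let \<open>R\<close> be the inverse of \<open>Y\<close>, and let \<open>T - Y\<close> be the sum of the operators \<open>f \<mapsto> l f *\<^sub>C v\<close>, where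
  the \<open>v\<close> may be projected onto \<open>S\<close>. On the span of the vectors \<open>v\<close> the operator \<open>T R\<close> is the identity plus an endomorphism of that span, and it is
  injective there; hence each \<open>v\<close> is \<open>T x\<close> for some \<open>x\<close>. Subtracting \<open>l (R f) *\<^sub>C x\<close> from \<open>R f\<close> for all
  pairs gives a right inverse of \<open>T\<close>. It is bounded because the functionals are, and two-sided because
  \<open>T\<close> is injective.
\<close>

lemma (in closed_subspace) invertible_on_finite_rank_perturbation:
  assumes Y: "bounded_operator_on S Y" "invertible_on S Y" and T: "bounded_operator_on S T"
    and F: "finite_rank_on S (\<lambda>f. T f - Y f)"
    and inj: "\<And>f. f \<in> S \<Longrightarrow> T f = 0 \<Longrightarrow> f = 0"
  shows "invertible_on S T"
proof -
  let ?Q = "orth_proj S"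
  obtain R where R: "bounded_operator_on S R" "\<And>f. f \<in> S \<Longrightarrow> R (Y f) = f \<and> Y (R f) = f"
    using Y(2) unfolding invertible_on_def by blast
  have mem: "T f \<in> S" "Y f \<in> S" "R f \<in> S" if "f \<in> S" for f
    using T Y R that by (auto simp: bounded_operator_on_def)
  obtain L0 where L0: "\<forall>(l, v)\<in>set L0. functional_on S l"
    "\<forall>f\<in>S. T f - Y f = (\<Sum>(l, v)\<leftarrow>L0. l f *\<^sub>C v)"
    using F unfolding finite_rank_on_def by blast
  define L where "L = map (\<lambda>(l, v). (l, ?Q v)) L0"
  have Lf: "\<forall>(l, v)\<in>set L. functional_on S l" and Lv: "\<forall>(l, v)\<in>set L. v \<in> S"
    using L0(1) by (auto simp: L_def orth_proj_mem)
  have TY: "T f = Y f + (\<Sum>(l, v)\<leftarrow>L. l f *\<^sub>C v)" if f: "f \<in> S" for f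
  proof -
    have "?Q (\<Sum>(l, v)\<leftarrow>L0. l f *\<^sub>C v) = (\<Sum>(l, v)\<leftarrow>L. l f *\<^sub>C v)"
      unfolding L_def
      by (induction L0) (auto simp: orth_proj_add orth_proj_scaleC orth_proj_id mem_zero)
    moreover have "?Q (T f - Y f) = T f - Y f"
      using f by (intro orth_proj_id mem_diff mem)
    ultimately have "T f - Y f = (\<Sum>(l, v)\<leftarrow>L. l f *\<^sub>C v)" using L0(2) f by simp
    then show ?thesis by (simp add: algebra_simps)
  qed
  define B where "B = snd ` set L"
  have B: "finite B" "B \<subseteq> S" using Lv by (auto simp: B_def)
  have spanS: "L2T.span B \<subseteq> S" by (rule L2T.span_minimal[OF B(2) subspace])
  have Lspan: "(\<Sum>(l, v)\<leftarrow>L. l f *\<^sub>C v) \<in> L2T.span B" for f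
    unfolding B_def by (rule sum_list_scaleC_in_span)
  \<comment> \<open>The projection makes \<open>T R\<close> linear on the whole space without changing it on \<open>S\<close>.\<close>
  define A where "A f = T (R (?Q f))" for f
  have A: "Vector_Spaces.linear scaleC scaleC A"
  proof (unfold_locales)
    fix f g c
    have "R (?Q f + ?Q g) = R (?Q f) + R (?Q g)" "R (c *\<^sub>C ?Q f) = c *\<^sub>C R (?Q f)"
      using R(1) orth_proj_mem unfolding bounded_operator_on_def by blast+
    moreover have "T (R (?Q f) + R (?Q g)) = T (R (?Q f)) + T (R (?Q g))"
      "T (c *\<^sub>C R (?Q f)) = c *\<^sub>C T (R (?Q f))"
      using T mem(3)[OF orth_proj_mem] unfolding bounded_operator_on_def by blast+
    ultimately show "A (f + g) = A f + A g" "A (c *\<^sub>C f) = c *\<^sub>C A f"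
      by (simp_all add: A_def orth_proj_add orth_proj_scaleC)
  qed
  have Aeq: "A f = f + (\<Sum>(l, v)\<leftarrow>L. l (R f) *\<^sub>C v)" if "f \<in> S" for f
    using that R(2)[OF that] TY[OF mem(3)[OF that]] by (simp add: A_def orth_proj_id)
  have "L2T.span B \<subseteq> A ` L2T.span B"
  proof (rule linear_inj_on_span_surj[OF A B(1)])
    show "A ` L2T.span B \<subseteq> L2T.span B"
    proof safe
      fix v assume v: "v \<in> L2T.span B"
      then have "A v = v + (\<Sum>(l, w)\<leftarrow>L. l (R v) *\<^sub>C w)" using Aeq spanS by blast
      then show "A v \<in> L2T.span B" using v Lspan[of "R v"] by (simp add: L2T.span_add)
    qed
    fix v assume v: "v \<in> L2T.span B" "A v = 0"
    then have vS: "v \<in> S" using spanS by auto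
    then have "R v = 0" using v(2) inj[OF mem(3)[OF vS]] by (simp add: A_def orth_proj_id)
    then show "v = 0" using R(2)[OF vS] bounded_operator_on_zero_eq[OF Y(1)] by simp
  qed
  note onto = this
  have "\<exists>x. x \<in> S \<and> T x = v" if v: "v \<in> B" for v
  proof -
    have "v \<in> A ` L2T.span B" using subsetD[OF onto L2T.span_base[OF v]] .
    then obtain w where w: "w \<in> L2T.span B" "v = A w" by (rule imageE)
    then have "w \<in> S" using spanS by blast
    then show ?thesis using w(2) mem(3)[of w] orth_proj_id[of w] by (auto simp: A_def)
  qed
  then obtain X where X: "\<And>v. v \<in> B \<Longrightarrow> X v \<in> S \<and> T (X v) = v"
    using bchoice[of B "\<lambda>v x. x \<in> S \<and> T x = v"] by blast
  have XL: "\<forall>(l, v)\<in>set L. functional_on S l \<and> X v \<in> S"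
  proof safe
    fix l v assume lv: "(l, v) \<in> set L"
    then have "v \<in> B" by (auto simp: B_def intro: rev_image_eqI)
    then show "X v \<in> S" using X by blast
    show "functional_on S l" using Lf lv by blast
  qed
  define G where "G f = (\<Sum>(l, v)\<leftarrow>L. l f *\<^sub>C X v)" for f
  have G: "bounded_operator_on S G"
    unfolding G_def by (rule bounded_operator_on_sum_functionals[OF XL])
  have TG: "T (G f) = (\<Sum>(l, v)\<leftarrow>L. l f *\<^sub>C v)" for f
  proof -
    have "(\<Sum>(l, v)\<leftarrow>L'. l f *\<^sub>C X v) \<in> S \<and>
        T (\<Sum>(l, v)\<leftarrow>L'. l f *\<^sub>C X v) = (\<Sum>(l, v)\<leftarrow>L'. l f *\<^sub>C v)" if "set L' \<subseteq> set L" for L'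
      using that
    proof (induction L')
      case Nil
      then show ?case using bounded_operator_on_zero_eq[OF T] by (simp add: mem_zero)
    next
      case (Cons p L')
      obtain l v where p: "p = (l, v)" by (cases p)
      then have "v \<in> B" using Cons.prems by (auto simp: B_def intro: rev_image_eqI)
      then have v: "X v \<in> S" "T (X v) = v" using X by auto
      have "T (l f *\<^sub>C X v + (\<Sum>(l, v)\<leftarrow>L'. l f *\<^sub>C X v))
          = l f *\<^sub>C v + T (\<Sum>(l, v)\<leftarrow>L'. l f *\<^sub>C X v)"
        using T v Cons mem_scale[OF v(1), of "l f"] unfolding bounded_operator_on_def by auto
      then show ?case using Cons p v by (auto intro: mem_add mem_scale)
    qed
    then show ?thesis by (simp add: G_def)
  qed
  define Z where "Z f = R f - G (R f)" for f
  have Z: "bounded_operator_on S Z"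
    unfolding Z_def
    by (rule bounded_operator_on_diff[OF R(1) bounded_operator_on_compose[OF G R(1)]])
  have TZ: "T (Z f) = f" if f: "f \<in> S" for f
  proof -
    have "G (R f) \<in> S" using G mem(3)[OF f] by (auto simp: bounded_operator_on_def)
    then have "T (Z f) = T (R f) - T (G (R f))"
      unfolding Z_def using f mem by (intro bounded_operator_on_diff_eq[OF T]) auto
    then show ?thesis using TY[OF mem(3)[OF f]] TG R(2)[OF f] by simp
  qed
  have ZT: "Z (T f) = f" if f: "f \<in> S" for f
  proof -
    have ZS: "Z (T f) \<in> S" using Z mem(1)[OF f] by (auto simp: bounded_operator_on_def)
    have "T (Z (T f) - f) = 0"
      using bounded_operator_on_diff_eq[OF T ZS f] TZ[OF mem(1)[OF f]] by simp
    then have "Z (T f) - f = 0" by (rule inj[OF mem_diff[OF ZS f]])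
    then show ?thesis by simp
  qed
  show ?thesis
    unfolding invertible_on_def using Z TZ ZT by (intro exI[of _ Z]) simp
qed

section \<open>Orthonormal sequences\<close>

locale orthonormal_seq =
  fixes E :: "nat \<Rightarrow> L2T"
  assumes orthonormal: "cinner (E m) (E n) = (if m = n then 1 else 0)"
begin

definition fourier_sum :: "L2T \<Rightarrow> nat \<Rightarrow> L2T" where
  "fourier_sum g m = (\<Sum>n<m. cinner g (E n) *\<^sub>C E n)"

lemma norm_E: "norm (E n) = 1"
proof -
  have "complex_of_real ((norm (E n))\<^sup>2) = of_real 1"
    using cinner_self[of "E n"] orthonormal[of n n] by simp
  then have "(norm (E n))\<^sup>2 = 1\<^sup>2" by (simp only: of_real_eq_iff) simp
  then show ?thesis by (simp only: power2_eq_iff_nonneg norm_ge_zero zero_le_one)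
qed

lemma cinner_sum_E: "finite A \<Longrightarrow> cinner (\<Sum>n\<in>A. c n *\<^sub>C E n) (E k) = (if k \<in> A then c k else 0)"
  by (simp add: cinner_sum_left cinner_scaleC_left orthonormal sum.delta' if_distrib cong: if_cong)

lemma norm_sum_E: "finite A \<Longrightarrow> (norm (\<Sum>n\<in>A. c n *\<^sub>C E n))\<^sup>2 = (\<Sum>n\<in>A. (norm (c n))\<^sup>2)"
proof -
  assume A: "finite A"
  have "complex_of_real ((norm (\<Sum>n\<in>A. c n *\<^sub>C E n))\<^sup>2) = (\<Sum>k\<in>A. cnj (c k) * c k)"
    unfolding cinner_self[symmetric]
    by (subst cinner_sum_right) (auto simp: cinner_scaleC_right cinner_sum_E[OF A] intro!: sum.cong)
  also have "\<dots> = complex_of_real (\<Sum>n\<in>A. (norm (c n))\<^sup>2)"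
    by (simp only: of_real_sum complex_norm_square mult.commute)
  finally show ?thesis by (simp only: of_real_eq_iff)
qed

lemma fourier_sum_orthogonal:
  "cinner (g - fourier_sum g m) (\<Sum>n<m. c n *\<^sub>C E n) = 0"
  by (simp add: cinner_sum_right cinner_scaleC_right cinner_diff_left fourier_sum_def cinner_sum_E)

lemma Bessel: "(\<Sum>n<m. (norm (cinner g (E n)))\<^sup>2) \<le> (norm g)\<^sup>2"
proof -
  have "cinner (g - fourier_sum g m) (fourier_sum g m) = 0"
    using fourier_sum_orthogonal[of g m "\<lambda>n. cinner g (E n)"] by (simp add: fourier_sum_def)
  from norm_add_squared_orthogonal[OF this]
  have "(norm (fourier_sum g m))\<^sup>2 \<le> (norm g)\<^sup>2" by simp
  then show ?thesis by (simp add: fourier_sum_def norm_sum_E)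
qed

lemma best_approximation: "norm (g - fourier_sum g m) \<le> norm (g - (\<Sum>n<m. c n *\<^sub>C E n))"
proof -
  let ?p = "\<Sum>n<m. (cinner g (E n) - c n) *\<^sub>C E n"
  have p: "?p = fourier_sum g m - (\<Sum>n<m. c n *\<^sub>C E n)"
    by (simp add: fourier_sum_def L2T.scale_left_diff_distrib sum_subtractf)
  have "cinner (g - fourier_sum g m) ?p = 0" by (rule fourier_sum_orthogonal)
  from norm_add_squared_orthogonal[OF this]
  have "(norm (g - fourier_sum g m))\<^sup>2 \<le> (norm (g - (\<Sum>n<m. c n *\<^sub>C E n)))\<^sup>2"
    by (simp add: p)
  then show ?thesis by (rule power2_le_imp_le) simp
qed

lemma Bessel_summable: "summable (\<lambda>n. (norm (cinner g (E n)))\<^sup>2)"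
  by (rule summableI_nonneg_bounded[OF _ Bessel]) auto

lemma cinner_E_tendsto_0: "(\<lambda>n. cinner g (E n)) \<longlonglongrightarrow> 0"
proof -
  have "(\<lambda>n. sqrt ((norm (cinner g (E n)))\<^sup>2)) \<longlonglongrightarrow> sqrt 0"
    by (rule tendsto_real_sqrt[OF summable_LIMSEQ_zero[OF Bessel_summable]])
  then show ?thesis by (simp add: tendsto_norm_zero_iff)
qed

lemma cinner_suminf_E:
  assumes "summable (\<lambda>n. norm (c n))"
  shows "cinner (\<Sum>n. c n *\<^sub>C E n) (E k) = c k"
proof -
  have "summable (\<lambda>n. c n *\<^sub>C E n)"
    by (rule summable_norm_cancel) (use assms in \<open>simp add: norm_E\<close>)
  then have "(\<lambda>m. \<Sum>n<m. c n *\<^sub>C E n) \<longlonglongrightarrow> (\<Sum>n. c n *\<^sub>C E n)" by (rule summable_LIMSEQ)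
  then have "(\<lambda>m. cinner (\<Sum>n<m. c n *\<^sub>C E n) (E k)) \<longlonglongrightarrow> cinner (\<Sum>n. c n *\<^sub>C E n) (E k)"
    by (rule tendsto_cinner)
  moreover have "(\<lambda>m. cinner (\<Sum>n<m. c n *\<^sub>C E n) (E k)) \<longlonglongrightarrow> c k"
    by (rule tendsto_eventually, rule eventually_sequentiallyI[of "Suc k"]) (simp add: cinner_sum_E)
  ultimately show ?thesis by (rule LIMSEQ_unique)
qed

end

section \<open>Subspaces that shift by one dimension\<close>

abbreviation U :: "L2T \<Rightarrow> L2T" where "U \<equiv> mult_L2T (\<lambda>z. z)"
abbreviation U' :: "L2T \<Rightarrow> L2T" where "U' \<equiv> mult_L2T cnj"

lemma bounded_symbol_id: "bounded_symbol (\<lambda>z. z)"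
  by (intro bounded_symbol_continuous continuous_intros)

lemma bounded_symbol_cnj_id: "bounded_symbol cnj"
  by (intro bounded_symbol_continuous continuous_intros)

lemmas shift_add = mult_L2T_add[OF bounded_symbol_id] mult_L2T_add[OF bounded_symbol_cnj_id]
lemmas shift_diff = mult_L2T_diff[OF bounded_symbol_id] mult_L2T_diff[OF bounded_symbol_cnj_id]
lemmas shift_scaleC = mult_L2T_scaleC[OF bounded_symbol_id] mult_L2T_scaleC[OF bounded_symbol_cnj_id]
lemmas shift_linear = shift_add shift_diff shift_scaleC

lemma shift_backshift [simp]: "U (U' f) = f" and backshift_shift [simp]: "U' (U f) = f"
proof -
  have "z * cnj z = 1" if "z \<in> sphere 0 1" for z
    using power_mult_cnj_power_circle[OF that, of 1] by simp
  then have "mult_L2T (\<lambda>z. z * cnj z) f = mult_L2T (\<lambda>_. 1) f"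
    by (intro mult_L2T_cong bounded_symbol_continuous continuous_intros)
  then show "U (U' f) = f" "U' (U f) = f"
    by (simp_all add: mult_L2T_mult bounded_symbol_id bounded_symbol_cnj_id mult_L2T_one mult.commute)
qed

lemma cinner_shift_left: "cinner (U f) g = cinner f (U' g)"
  by (rule cinner_mult_L2T_left[OF bounded_symbol_id])

lemma cinner_backshift_left: "cinner (U' f) g = cinner f (U g)"
  using cinner_mult_L2T_left[OF bounded_symbol_cnj_id] by simp

lemma cinner_shift_shift [simp]: "cinner (U f) (U g) = cinner f g"
  by (simp add: cinner_shift_left)

text \<open>
  The unit vector \<open>d\<close> spans the orthogonal complement of \<open>U S\<close> in \<open>S\<close>.
\<close>

locale shift_space = closed_subspace S for S +
  fixes d :: L2T
  assumes shift_mem: "f \<in> S \<Longrightarrow> U f \<in> S"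
    and d_mem: "d \<in> S"
    and cinner_d_d: "cinner d d = 1"
    and cinner_shift_d: "f \<in> S \<Longrightarrow> cinner (U f) d = 0"
    and backshift_mem: "f \<in> S \<Longrightarrow> cinner f d = 0 \<Longrightarrow> U' f \<in> S"
begin

lemma backshift_remainder: "f \<in> S \<Longrightarrow> U' (f - cinner f d *\<^sub>C d) \<in> S"
  by (rule backshift_mem) (auto intro!: mem_diff mem_scale d_mem simp: cinner_simps cinner_d_d)

lemma backshift_d_orth: "U' d \<in> orth_compl S"
  using cinner_shift_d
  by (auto simp: orth_compl_def cinner_backshift_left intro: cinner_commute_eq_0)

lemma backshift_orth: "g \<in> orth_compl S \<Longrightarrow> U' g \<in> orth_compl S"
  using shift_mem by (auto simp: orth_compl_def cinner_backshift_left)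

text \<open>
  Every \<open>s \<in> S\<close> is a multiple of \<open>d\<close> plus some \<open>U t\<close> with \<open>t \<in> S\<close>, and \<open>U g\<close> is orthogonal to the latter.
\<close>

lemma shift_orth:
  assumes g: "g \<in> orth_compl S"
  shows "U g - cinner (U g) d *\<^sub>C d \<in> orth_compl S"
proof -
  have "cinner (U g - cinner (U g) d *\<^sub>C d) s = 0" if s: "s \<in> S" for s
  proof -
    let ?t = "U' (s - cinner s d *\<^sub>C d)"
    have t: "?t \<in> S" using s by (rule backshift_remainder)
    have "s = cinner s d *\<^sub>C d + U ?t" by (simp add: shift_linear)
    then have "cinner (U g - cinner (U g) d *\<^sub>C d) s
        = cinner (U g - cinner (U g) d *\<^sub>C d) (cinner s d *\<^sub>C d + U ?t)" by simp
    also have "\<dots> = cinner g ?t - cinner (U g) d * cinner d (U ?t)"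
      unfolding cinner_add_right cinner_scaleC_right
      by (simp only: cinner_diff_left cinner_scaleC_left cinner_d_d cinner_shift_shift) simp
    also have "\<dots> = 0"
      using g t cinner_commute_eq_0[OF cinner_shift_d[OF t]] by (simp add: orth_compl_def)
    finally show ?thesis .
  qed
  then show ?thesis by (simp add: orth_compl_def)
qed

lemma shift_power_mem: "f \<in> S \<Longrightarrow> (U ^^ n) f \<in> S"
  by (induction n) (auto intro: shift_mem)

lemma shift_power_orthonormal:
  "cinner ((U ^^ m) d) ((U ^^ n) d) = (if m = n then 1 else 0)"
proof (induction m arbitrary: n)
  case 0
  show ?case
  proof (cases n)
    case (Suc k)
    have "cinner (U ((U ^^ k) d)) d = 0" by (intro cinner_shift_d shift_power_mem d_mem)
    then show ?thesis using Suc by (simp add: cinner_commute_eq_0)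
  qed (simp add: cinner_d_d)
next
  case (Suc m)
  show ?case
  proof (cases n)
    case 0
    then show ?thesis by (simp add: cinner_shift_d shift_power_mem d_mem)
  next
    case (Suc k)
    then show ?thesis using Suc.IH[of k] by simp
  qed
qed

end

sublocale shift_space \<subseteq> orthonormal_seq "\<lambda>n. (U ^^ n) d"
  by unfold_locales (rule shift_power_orthonormal)

lemma add_diff_rearrange: "n + g + (a - b) = (n + a) + (g - b)" for n g a b :: L2T
  by (simp add: algebra_simps)

lemma diff_add_rearrange: "n + g + (a - b) = (n - b) + (g + a)" for n g a b :: L2T
  by (simp add: algebra_simps)

text \<open>
  In the application \<open>H\<close> is the Hardy space and \<open>N = \<theta>H\<close>, so that \<open>K\<close> is the model space.
\<close>

locale shift_pair = H: shift_space H d + N: shift_space N e for H N :: "L2T set" and d e +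
  assumes N_subset_H: "N \<subseteq> H"
begin

definition K :: "L2T set" where "K = H \<inter> orth_compl N"
definition M :: "L2T set" where "M = orth_compl K"

lemma N_subset_M: "N \<subseteq> M"
  by (auto simp: M_def K_def orth_compl_def intro: cinner_commute_eq_0)

lemma orth_H_subset_M: "orth_compl H \<subseteq> M"
  by (auto simp: M_def K_def orth_compl_def)

sublocale M: closed_subspace M
  by unfold_locales (simp_all add: M_def closed_orth_compl subspace_orth_compl)

text \<open>
  What remains of \<open>f\<close> after removing its components in \<open>N\<close> and in \<open>H\<^sup>\<bottom>\<close> lies in \<open>K\<close>, and is orthogonal
  to \<open>K\<close> because the other three vectors are.
\<close>

lemma M_decomposition:
  assumes f: "f \<in> M"
  obtains n g where "n \<in> N" "g \<in> orth_compl H" "f = n + g"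
proof -
  define n where "n = orth_proj N f"
  define h where "h = orth_proj H (f - n)"
  define g where "g = f - n - h"
  have n: "n \<in> N" "f - n \<in> orth_compl N"
    by (simp_all add: n_def N.orth_proj_mem N.orth_proj_diff)
  have h: "h \<in> H" and g: "g \<in> orth_compl H"
    by (simp_all add: h_def g_def H.orth_proj_mem H.orth_proj_diff)
  have "cinner h m = 0" if m: "m \<in> N" for m
  proof -
    have "cinner h m = cinner (f - n) m - cinner g m" by (simp add: g_def cinner_diff_left)
    then show ?thesis using n(2) g m N_subset_H by (auto simp: orth_compl_def)
  qed
  then have hK: "h \<in> K" using h by (auto simp: K_def orth_compl_def)
  have "cinner h h = cinner f h - cinner n h - cinner g h" by (simp add: g_def cinner_diff_left)
  also have "\<dots> = 0"
    using f hK n g h by (auto simp: M_def K_def orth_compl_def cinner_commute_eq_0)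
  finally have "f = n + g" by (simp add: g_def)
  with n g show ?thesis using that by blast
qed

text \<open>
  The shift maps \<open>N\<close> onto \<open>N \<ominus> \<complex>e\<close>, and the vectors of \<open>H\<^sup>\<bottom>\<close> orthogonal to \<open>U' d\<close> onto \<open>H\<^sup>\<bottom>\<close>. The
  remaining direction \<open>U' d\<close> of \<open>M\<close> is sent to \<open>d\<close>, which need not belong to \<open>M\<close>. Sending it to the
  missing vector \<open>e\<close> instead gives a unitary operator \<open>W\<close> on \<open>M\<close>, with the inverse \<open>W'\<close>.
\<close>

definition W :: "L2T \<Rightarrow> L2T" where "W f = U f + cinner (U f) d *\<^sub>C (e - d)"
definition W' :: "L2T \<Rightarrow> L2T" where "W' f = U' f + cinner f e *\<^sub>C (U' d - U' e)"

lemma W_add: "W (f + g) = W f + W g"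
  by (simp add: W_def shift_linear cinner_simps L2T.scale_left_distrib)

lemma W_scaleC: "W (c *\<^sub>C f) = c *\<^sub>C W f"
  by (simp add: W_def shift_linear cinner_simps L2T.scale_right_distrib)

lemma W_mem: "f \<in> M \<Longrightarrow> W f \<in> M"
proof -
  assume "f \<in> M"
  then obtain n g where ng: "n \<in> N" "g \<in> orth_compl H" "f = n + g" by (rule M_decomposition)
  have "cinner (U n) d = 0" using ng N_subset_H by (intro H.cinner_shift_d) auto
  then have "W f = (U n + cinner (U g) d *\<^sub>C e) + (U g - cinner (U g) d *\<^sub>C d)"
    by (simp only: W_def ng(3) shift_linear cinner_add_left L2T.scale_right_diff_distrib add_0
        add_diff_rearrange)
  moreover have "U n + cinner (U g) d *\<^sub>C e \<in> M"
    by (rule subsetD[OF N_subset_M])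
       (rule N.mem_add[OF N.shift_mem[OF ng(1)] N.mem_scale[OF N.d_mem]])
  moreover have "U g - cinner (U g) d *\<^sub>C d \<in> M"
    by (rule subsetD[OF orth_H_subset_M H.shift_orth[OF ng(2)]])
  ultimately show ?thesis by (simp add: M.mem_add)
qed

lemma W'_mem: "f \<in> M \<Longrightarrow> W' f \<in> M"
proof -
  assume "f \<in> M"
  then obtain n g where ng: "n \<in> N" "g \<in> orth_compl H" "f = n + g" by (rule M_decomposition)
  have "cinner g e = 0" using ng(2) N.d_mem N_subset_H by (auto simp: orth_compl_def)
  then have "W' f = U' (n - cinner n e *\<^sub>C e) + (U' g + cinner n e *\<^sub>C U' d)"
    by (simp only: W'_def ng(3) shift_linear cinner_add_left L2T.scale_right_diff_distrib
        add_0_right diff_add_rearrange)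
  moreover have "U' (n - cinner n e *\<^sub>C e) \<in> M"
    by (rule subsetD[OF N_subset_M N.backshift_remainder[OF ng(1)]])
  moreover have "U' g \<in> M" "U' d \<in> M"
    by (rule subsetD[OF orth_H_subset_M H.backshift_orth[OF ng(2)]],
        rule subsetD[OF orth_H_subset_M H.backshift_d_orth])
  ultimately show ?thesis by (simp add: M.mem_add M.mem_scale)
qed

text \<open>
  The projection of \<open>d\<close> onto \<open>M\<close> is a multiple of \<open>e\<close>: indeed \<open>d\<close> is orthogonal both to \<open>H\<^sup>\<bottom>\<close> and to
  \<open>U N\<close>, which together with \<open>e\<close> span \<open>M\<close>.
\<close>

lemma cinner_d_eq: "f \<in> M \<Longrightarrow> cinner f d = cinner f e * cinner e d"
proof -
  assume "f \<in> M"
  then obtain n g where ng: "n \<in> N" "g \<in> orth_compl H" "f = n + g" by (rule M_decomposition)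
  have g0: "cinner g d = 0" "cinner g e = 0"
    using ng(2) H.d_mem N.d_mem N_subset_H by (auto simp: orth_compl_def)
  let ?n = "U' (n - cinner n e *\<^sub>C e)"
  have "?n \<in> H" using N.backshift_remainder[OF ng(1)] N_subset_H by blast
  then have "cinner (U ?n) d = 0" by (rule H.cinner_shift_d)
  then have "cinner n d = cinner n e * cinner e d" by (simp add: cinner_simps)
  then show ?thesis using g0 by (simp add: ng(3) cinner_simps)
qed

text \<open>
  Here \<open>U f\<close> differs from an element of \<open>U N + H\<^sup>\<bottom>\<close>, which is orthogonal to \<open>e\<close>, by a multiple of \<open>d\<close>.
\<close>

lemma cinner_shift_e: "f \<in> M \<Longrightarrow> cinner (U f) e = cinner (U f) d * cinner d e"
proof -
  assume "f \<in> M"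
  then obtain n g where ng: "n \<in> N" "g \<in> orth_compl H" "f = n + g" by (rule M_decomposition)
  have n0: "cinner (U n) d = 0" "cinner (U n) e = 0"
    using ng(1) N_subset_H by (auto intro: H.cinner_shift_d N.cinner_shift_d)
  have "cinner (U g - cinner (U g) d *\<^sub>C d) e = 0"
    using H.shift_orth[OF ng(2)] N.d_mem N_subset_H by (auto simp: orth_compl_def)
  then have "cinner (U g) e = cinner (U g) d * cinner d e" by (simp add: cinner_simps)
  then show ?thesis using n0 by (simp add: ng(3) cinner_simps shift_linear)
qed

lemma W_W': "f \<in> M \<Longrightarrow> W (W' f) = f"
proof -
  assume f: "f \<in> M"
  have U: "U (W' f) = f + cinner f e *\<^sub>C (d - e)"
    by (simp add: W'_def shift_linear L2T.scale_right_diff_distrib)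
  have "cinner (U (W' f)) d = cinner f e"
    unfolding U using cinner_d_eq[OF f] H.cinner_d_d by (simp add: cinner_simps algebra_simps)
  then show ?thesis
    unfolding W_def by (simp add: U L2T.scale_right_diff_distrib)
qed

lemma norm_W: "f \<in> M \<Longrightarrow> norm (W f) = norm f"
proof -
  assume f: "f \<in> M"
  let ?c = "cinner (U f) d"
  have ce: "cinner (U f) e = ?c * cinner d e" by (rule cinner_shift_e[OF f])
  have dc: "cinner d (U f) = cnj ?c" by (rule cinner_cnj)
  have ec: "cinner e (U f) = cnj ?c * cinner e d"
    using ce by (metis cinner_cnj complex_cnj_mult)
  have "cinner (W f) (W f) = cinner f f"
    unfolding W_def
    by (simp add: cinner_simps ce dc ec H.cinner_d_d N.cinner_d_d algebra_simps)
  then have "complex_of_real ((norm (W f))\<^sup>2) = complex_of_real ((norm f)\<^sup>2)"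
    by (simp only: cinner_self)
  then show ?thesis by (simp only: of_real_eq_iff power2_eq_iff_nonneg norm_ge_zero)
qed

lemma bounded_operator_W: "bounded_operator_on M W"
  by (rule M.bounded_operator_onI[where C=1]) (auto simp: W_mem W_add W_scaleC norm_W)

lemma norm_W': "f \<in> M \<Longrightarrow> norm (W' f) = norm f"
  using norm_W[OF W'_mem] W_W' by metis

lemma bounded_operator_W_minus: "bounded_operator_on M (\<lambda>f. W f - a *\<^sub>C f)"
  by (rule M.bounded_operator_on_diff[OF bounded_operator_W
      M.bounded_operator_on_scale[OF M.bounded_operator_on_id]])

text \<open>
  As \<open>W\<close> is isometric, \<open>W - a\<close> is bounded below by \<open>\<bar>1 - \<bar>a\<bar>\<bar>\<close>. For surjectivity, \<open>W f - a f = g\<close> is a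
  fixed point equation for a contraction with factor \<open>\<bar>a\<bar>\<close> or \<open>1 / \<bar>a\<bar>\<close>, whichever is less than 1.
\<close>

lemma invertible_W_minus:
  assumes a: "norm a \<noteq> 1"
  shows "invertible_on M (\<lambda>f. W f - a *\<^sub>C f)"
proof (rule M.invertible_on_bounded_below[OF bounded_operator_W_minus])
  show "0 < \<bar>1 - norm a\<bar>" using a by simp
  show "\<bar>1 - norm a\<bar> * norm f \<le> norm (W f - a *\<^sub>C f)" if "f \<in> M" for f
  proof -
    have "\<bar>1 - norm a\<bar> * norm f = \<bar>norm (W f) - norm (a *\<^sub>C f)\<bar>"
      using norm_W[OF that] by (simp add: left_diff_distrib abs_mult_pos)
    then show ?thesis using norm_triangle_ineq3[of "W f" "a *\<^sub>C f"] by simp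
  qed
  have complete: "complete M" using M.closed by (simp add: complete_eq_closed)
  have ne: "M \<noteq> {}" using M.mem_zero by blast
  fix g assume g: "g \<in> M"
  show "\<exists>f\<in>M. W f - a *\<^sub>C f = g"
  proof (cases "norm a < 1")
    case True
    let ?p = "\<lambda>f. W' (g + a *\<^sub>C f)"
    have "\<exists>!f\<in>M. ?p f = f"
    proof (rule Banach_fix[OF complete ne _ True, where f = "?p"])
      show "?p ` M \<subseteq> M" using g by (auto intro!: W'_mem M.mem_add M.mem_scale)
      fix x y assume xy: "x \<in> M" "y \<in> M"
        have "?p x - ?p y = W' (a *\<^sub>C (x - y))"
          by (simp add: W'_def shift_linear cinner_simps L2T.scale_left_distrib
              L2T.scale_right_diff_distrib L2T.scale_left_diff_distrib right_diff_distrib)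
      then show "dist (?p x) (?p y) \<le> norm a * dist x y"
          using norm_W'[of "a *\<^sub>C (x - y)"] xy by (simp add: dist_norm M.mem_diff M.mem_scale)
    qed auto
    then obtain f where f: "f \<in> M" "?p f = f" by blast
    have "W f = W (?p f)" using f by simp
    also have "\<dots> = g + a *\<^sub>C f" using f g by (intro W_W' M.mem_add M.mem_scale) auto
    finally show ?thesis using f by (intro bexI[of _ f]) auto
  next
    case False
    then have a1: "norm a > 1" using a by simp
    let ?p = "\<lambda>f. (1 / a) *\<^sub>C (W f - g)"
    have "\<exists>!f\<in>M. ?p f = f"
    proof (rule Banach_fix[OF complete ne, where f = "?p" and c = "1 / norm a"])
      have "0 < norm a" using a1 by linarith
      then show "1 / norm a < 1" using a1 by (simp only: divide_less_eq_1_pos)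
      show "?p ` M \<subseteq> M" using g by (auto intro!: W_mem M.mem_diff M.mem_scale)
      fix x y assume xy: "x \<in> M" "y \<in> M"
        have "?p x - ?p y = (1 / a) *\<^sub>C W (x - y)"
          by (simp add: W_def shift_linear cinner_simps L2T.scale_left_diff_distrib
              L2T.scale_right_diff_distrib L2T.scale_right_distrib)
      then show "dist (?p x) (?p y) \<le> 1 / norm a * dist x y"
          using norm_W[of "x - y"] xy by (simp add: dist_norm M.mem_diff norm_divide)
    qed auto
    then obtain f where f: "f \<in> M" "?p f = f" by blast
    have "a *\<^sub>C ?p f = W f - g" using a1 by auto
    then have "a *\<^sub>C f = W f - g" using f(2) by simp
    then show ?thesis using f(1) by (intro bexI[of _ f]) (auto simp: algebra_simps)
  qed
qed

end

section \<open>Values on the circle belong to the essential spectrum\<close>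

lemma power_combination_not_square_summable:
  fixes u :: "nat \<Rightarrow> complex"
  assumes K: "finite K" "k \<in> K" "u k \<noteq> 0"
  shows "\<not> summable (\<lambda>n. (norm (\<Sum>k\<in>K. u k * of_real (real (Suc n) powr (- 1 / (real k + 2)))))\<^sup>2)"
proof
  let ?s = "\<lambda>n. \<Sum>k\<in>K. u k * of_real (real (Suc n) powr (- 1 / (real k + 2)))"
  assume summ: "summable (\<lambda>n. (norm (?s n))\<^sup>2)"
  \<comment> \<open>The largest index carries the slowest decay, so it governs the sum.\<close>
  define m where "m = Max {k \<in> K. u k \<noteq> 0}"
  have fin: "finite {k \<in> K. u k \<noteq> 0}" using K by simp
  have mK: "m \<in> K" "u m \<noteq> 0"
    using Max_in[OF fin] K unfolding m_def by auto
  have mmax: "k \<le> m" if "k \<in> K" "u k \<noteq> 0" for k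
    using Max_ge[OF fin, of k] that unfolding m_def by auto
  define b where "b = 1 / (real m + 2)"
  have lim: "(\<lambda>n. u k * of_real (real (Suc n) powr (b - 1 / (real k + 2))))
      \<longlonglongrightarrow> (if k = m then u m else 0)" if k: "k \<in> K" for k
  proof (cases "u k = 0 \<or> k = m")
    case True
    then show ?thesis using mK(2) by (auto simp: b_def)
  next
    case False
    then have "k < m" using mmax[OF k] by linarith
    then have "b < 1 / (real k + 2)" unfolding b_def by (intro divide_strict_left_mono) auto
    then have neg: "b - 1 / (real k + 2) < 0" by simp
    have "filterlim (\<lambda>n. real (Suc n)) at_top sequentially"
      using filterlim_real_sequentially filterlim_sequentially_Suc by blast
    from tendsto_neg_powr[OF neg this]
    have "(\<lambda>n. u k * of_real (real (Suc n) powr (b - 1 / (real k + 2)))) \<longlonglongrightarrow> u k * of_real 0"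
      by (intro tendsto_mult tendsto_const tendsto_of_real)
    then show ?thesis using False by simp
  qed
  have eq: "(\<Sum>k\<in>K. u k * of_real (real (Suc n) powr (b - 1 / (real k + 2))))
      = ?s n * of_real (real (Suc n) powr b)" for n
  proof -
    have "real (Suc n) powr (b - 1 / (real k + 2))
        = real (Suc n) powr (- 1 / (real k + 2)) * real (Suc n) powr b" for k
      by (subst powr_add[symmetric]) (simp add: algebra_simps)
    then show ?thesis by (simp add: sum_distrib_right mult.assoc)
  qed
  have "(\<lambda>n. \<Sum>k\<in>K. u k * of_real (real (Suc n) powr (b - 1 / (real k + 2))))
      \<longlonglongrightarrow> (\<Sum>k\<in>K. if k = m then u m else 0)"
    by (intro tendsto_sum lim)
  then have "(\<lambda>n. ?s n * of_real (real (Suc n) powr b)) \<longlonglongrightarrow> u m"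
    using K(1) mK by (simp only: eq) (simp add: sum.delta')
  then have "(\<lambda>n. norm (?s n * of_real (real (Suc n) powr b))) \<longlonglongrightarrow> norm (u m)"
    by (rule tendsto_norm)
  then have ev: "eventually (\<lambda>n. norm (u m) / 2 < norm (?s n * of_real (real (Suc n) powr b))) sequentially"
    by (rule order_tendstoD) (use mK(2) in simp)
  define q where "q = (norm (u m) / 2)\<^sup>2"
  have q: "q > 0" using mK(2) by (simp add: q_def)
  have "eventually (\<lambda>n. norm (q * inverse (real (Suc n))) \<le> (norm (?s n))\<^sup>2) sequentially"
    using ev
  proof eventually_elim
    case (elim n)
    have p: "real (Suc n) powr b > 0" by simp
    have "q \<le> (norm (?s n * of_real (real (Suc n) powr b)))\<^sup>2"
      unfolding q_def using elim by (intro power_mono) auto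
    also have "\<dots> = (norm (?s n))\<^sup>2 * (real (Suc n) powr b)\<^sup>2"
      unfolding norm_mult power_mult_distrib by simp
    also have "(real (Suc n) powr b)\<^sup>2 = real (Suc n) powr (2 * b)"
      by (simp add: power2_eq_square powr_add[symmetric])
    also have "(norm (?s n))\<^sup>2 * real (Suc n) powr (2 * b) \<le> (norm (?s n))\<^sup>2 * real (Suc n) powr 1"
      by (intro mult_left_mono powr_mono) (auto simp: b_def field_simps)
    finally have "q \<le> (norm (?s n))\<^sup>2 * real (Suc n)" by simp
    then have "q * inverse (real (Suc n)) \<le> (norm (?s n))\<^sup>2"
      by (simp only: divide_inverse[symmetric]) (simp add: divide_le_eq)
    moreover have "0 \<le> q * inverse (real (Suc n))" using q by simp
    ultimately show ?case by simp
  qed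
  then have "summable (\<lambda>n. q * inverse (real (Suc n)))"
    by (rule summable_comparison_test_ev[OF _ summ])
  then have "summable (\<lambda>n. inverse (real (Suc n)))" using q by (simp add: summable_cmult_iff)
  then have "summable (\<lambda>n. inverse (real n))" using summable_Suc_iff[of "\<lambda>n. inverse (real n)"] by simp
  then show False using not_summable_harmonic[where ?'a = real] by simp
qed

context shift_pair
begin

abbreviation E where "E n \<equiv> (U ^^ n) e"

lemma cinner_W_E: "cinner (W g) (E (Suc n)) = cinner g (E n)"
proof -
  have n: "E n \<in> N" by (intro N.shift_power_mem N.d_mem)
  have "cinner e (U (E n)) = 0" by (rule cinner_commute_eq_0[OF N.cinner_shift_d[OF n]])
  moreover have "cinner d (U (E n)) = 0"
    using n N_subset_H by (intro cinner_commute_eq_0[OF H.cinner_shift_d]) auto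
  ultimately show ?thesis by (simp add: W_def cinner_simps)
qed

text \<open>
  If \<open>f = W g - a g\<close> then \<open>a\<^sup>n \<langle>g, E n\<rangle>\<close> is the tail of the series with the terms
  \<open>a\<^sup>n \<langle>f, E (n + 1)\<rangle>\<close>, and must therefore be square summable. Choosing the tails of \<open>f\<close> to be slowly
  decaying powers gives infinitely many vectors that are independent modulo the range.
\<close>

lemma range_W_minus_infinite_codim:
  assumes a: "norm a = 1" and B: "finite B"
    and range: "\<And>f. f \<in> M \<Longrightarrow> \<exists>g\<in>M. f - (W g - a *\<^sub>C g) \<in> L2T.span B"
  shows False
proof -
  \<comment> \<open>The series with the terms \<open>a ^ n * c k (Suc n)\<close> has the tails \<open>s k n\<close>.\<close>
  define s where "s k n = real (Suc n) powr (- 1 / (real k + 2))" for k n :: nat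
  define c where "c k n = (case n of 0 \<Rightarrow> 0 | Suc n \<Rightarrow> cnj a ^ n * of_real (s k n - s k (Suc n)))" for k n
  define f where "f k = (\<Sum>n. c k n *\<^sub>C E n)" for k
  have s0: "s k \<longlonglongrightarrow> 0" for k
  proof -
    have "filterlim (\<lambda>n. real (Suc n)) at_top sequentially"
      using filterlim_real_sequentially filterlim_sequentially_Suc by blast
    from tendsto_neg_powr[OF _ this, of "- 1 / (real k + 2)"]
    show ?thesis by (simp add: s_def[abs_def] field_simps)
  qed
  have smono: "s k (Suc n) \<le> s k n" for k n
    unfolding s_def by (intro powr_mono2') (auto simp: field_simps)
  have csum: "summable (\<lambda>n. norm (c k n))" for k
  proof -
    have "summable (\<lambda>n. s k n - s k (Suc n))" by (rule telescope_summable'[OF s0])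
    moreover have "norm (c k (Suc n)) = s k n - s k (Suc n)" for n
      using a smono[of k n] by (simp add: c_def norm_mult norm_power flip: of_real_diff)
    ultimately have "summable (\<lambda>n. norm (c k (Suc n)))" by simp
    then show ?thesis by (simp only: summable_Suc_iff[of "\<lambda>n. norm (c k n)"])
  qed
  have fE: "cinner (f k) (E n) = c k n" for k n
    unfolding f_def by (rule N.cinner_suminf_E[OF csum])
  have fM: "f k \<in> M" for k
  proof -
    have "summable (\<lambda>n. c k n *\<^sub>C E n)"
      by (rule summable_norm_cancel) (use csum[of k] in \<open>simp add: N.norm_E\<close>)
    then have "(\<lambda>m. \<Sum>n<m. c k n *\<^sub>C E n) \<longlonglongrightarrow> f k" unfolding f_def by (rule summable_LIMSEQ)
    moreover have "(\<Sum>n<m. c k n *\<^sub>C E n) \<in> N" for m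
      by (intro L2T.subspace_sum[OF N.subspace] N.mem_scale N.shift_power_mem N.d_mem)
    ultimately have "f k \<in> N"
      using closed_sequentially[OF N.closed, of "\<lambda>m. \<Sum>n<m. c k n *\<^sub>C E n" "f k"] by blast
    then show ?thesis using N_subset_M by blast
  qed
  have ex: "\<exists>g. g \<in> M \<and> f k - (W g - a *\<^sub>C g) \<in> L2T.span B" for k
    using range[OF fM[of k]] by (auto simp only: Bex_def)
  define g where "g k = (SOME g. g \<in> M \<and> f k - (W g - a *\<^sub>C g) \<in> L2T.span B)" for k
  have gk: "g k \<in> M \<and> f k - (W (g k) - a *\<^sub>C g k) \<in> L2T.span B" for k
    using someI_ex[OF ex[of k]] by (simp only: g_def)
  note g = conjunct1[OF gk] conjunct2[OF gk]
  define h where "h k = f k - (W (g k) - a *\<^sub>C g k)" for k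
  have "\<exists>K u. finite K \<and> (\<exists>k\<in>K. u k \<noteq> 0) \<and> (\<Sum>k\<in>K. u k *\<^sub>C h k) = 0"
    by (rule span_family_dependent[OF B]) (simp only: h_def g)
  then obtain K u where K: "finite K" "\<exists>k\<in>K. u k \<noteq> 0" and dep: "(\<Sum>k\<in>K. u k *\<^sub>C h k) = 0"
    by (elim exE conjE)
  from K(2) obtain k0 where k0: "k0 \<in> K" "u k0 \<noteq> 0" by (elim bexE)
  define G where "G = (\<Sum>k\<in>K. u k *\<^sub>C g k)"
  define x where "x n = a ^ n * cinner G (E n)" for n
  define t where "t n = (\<Sum>k\<in>K. u k * of_real (s k n))" for n
  have GE: "cinner G (E n) = (\<Sum>k\<in>K. u k * cinner (g k) (E n))" for n
    by (simp add: G_def cinner_sum_left cinner_scaleC_left)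
  have step: "x n - x (Suc n) = t n - t (Suc n)" for n
  proof -
    have "0 = cinner (\<Sum>k\<in>K. u k *\<^sub>C h k) (E (Suc n))"
      by (simp only: dep cinner_zero_left)
    also have "\<dots> = (\<Sum>k\<in>K. u k * (c k (Suc n) - (cinner (g k) (E n) - a * cinner (g k) (E (Suc n)))))"
      by (simp only: h_def cinner_sum_left cinner_scaleC_left cinner_diff_left cinner_W_E fE)
    also have "\<dots> = (\<Sum>k\<in>K. u k * c k (Suc n)) - (cinner G (E n) - a * cinner G (E (Suc n)))"
      unfolding GE by (simp add: right_diff_distrib sum_subtractf sum_distrib_left mult.left_commute)
    finally have "cinner G (E n) - a * cinner G (E (Suc n)) = (\<Sum>k\<in>K. u k * c k (Suc n))"
      by simp
    then have "x n - x (Suc n) = a ^ n * (\<Sum>k\<in>K. u k * c k (Suc n))"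
      by (simp add: x_def algebra_simps del: funpow.simps)
    also have "\<dots> = (\<Sum>k\<in>K. (a ^ n * cnj (a ^ n)) * (u k * of_real (s k n - s k (Suc n))))"
      by (simp add: c_def sum_distrib_left mult_ac)
    also have "\<dots> = t n - t (Suc n)"
      using power_mult_cnj_power_circle[of a n] a
      by (simp add: t_def right_diff_distrib sum_subtractf)
    finally show ?thesis .
  qed
  have const: "x n - t n = x 0 - t 0" for n
  proof (induction n)
    case (Suc n)
    have "x (Suc n) - t (Suc n) = x n - t n" using step[of n] by (simp add: algebra_simps)
    then show ?case using Suc by simp
  qed simp
  have "(\<lambda>n. x n) \<longlonglongrightarrow> 0"
  proof (rule tendsto_norm_zero_cancel)
    have "(\<lambda>n. norm (cinner G (E n))) \<longlonglongrightarrow> 0"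
      by (rule tendsto_norm_zero[OF N.cinner_E_tendsto_0])
    then show "(\<lambda>n. norm (x n)) \<longlonglongrightarrow> 0" using a by (simp add: x_def norm_mult norm_power)
  qed
  moreover have "t \<longlonglongrightarrow> (\<Sum>k\<in>K. u k * of_real 0)"
    unfolding t_def[abs_def] by (intro tendsto_sum tendsto_mult tendsto_const tendsto_of_real s0)
  ultimately have "(\<lambda>n. x n - t n) \<longlonglongrightarrow> 0 - 0" by (intro tendsto_diff) simp_all
  moreover have "(\<lambda>n. x n - t n) = (\<lambda>n. x 0 - t 0)" by (rule ext) (rule const)
  ultimately have "(\<lambda>n::nat. x 0 - t 0) \<longlonglongrightarrow> 0 - 0" by (simp only:)
  then have "x 0 - t 0 = 0" by (simp add: LIMSEQ_const_iff)
  then have "t n = x n" for n using const[of n] by simp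
  then have "norm (t n) = norm (cinner G (E n))" for n
    using a by (simp add: x_def norm_mult norm_power)
  then have "summable (\<lambda>n. (norm (t n))\<^sup>2)" using N.Bessel_summable[of G] by simp
  then show False
    using power_combination_not_square_summable[of K k0 u] K(1) k0 by (simp add: t_def s_def)
qed

lemma diff_add_diff: "(f - g) + (g - h) = f - h" for f g h :: L2T
  by simp

section \<open>Rational functions of the shift modulo finite rank\<close>

text \<open>
  The difference may take values outside \<open>M\<close>: only the model \<open>Y\<close>, not the multiplication, has to map
  \<open>M\<close> into itself.
\<close>

definition models :: "(L2T \<Rightarrow> L2T) \<Rightarrow> (complex \<Rightarrow> complex) \<Rightarrow> bool" where
  "models Y \<phi> \<longleftrightarrow> continuous_on (sphere 0 1) \<phi> \<and> bounded_operator_on M Y \<and>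
     finite_rank_on M (\<lambda>f. mult_L2T \<phi> f - Y f)"

lemma models_const: "models (\<lambda>f. c *\<^sub>C f) (\<lambda>_. c)"
proof -
  have "mult_L2T (\<lambda>_. c) f = c *\<^sub>C f" for f
    using rep_mult_L2T[OF bounded_symbol_continuous[of "\<lambda>_. c"], of f] rep_L2T_scaleC[of c f]
    by (intro L2T_eqI) auto
  then show ?thesis
    unfolding models_def
    by (simp add: finite_rank_on_zero M.bounded_operator_on_scale[OF M.bounded_operator_on_id])
qed

lemma finite_rank_shift_minus_W: "finite_rank_on M (\<lambda>f. U f - W f)"
proof (rule finite_rank_on_cong)
  show "finite_rank_on M (\<lambda>f. cinner f (U' d) *\<^sub>C (d - e))"
    by (intro finite_rank_on_rank_one functional_on_cinner)
  show "U f - W f = cinner f (U' d) *\<^sub>C (d - e)" for f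
    by (simp add: W_def cinner_shift_left L2T.scale_right_diff_distrib)
qed

text \<open>
  With \<open>X\<close> for multiplication by \<open>\<phi>\<close>, this rests on the identity
  \<open>(U - a) X - (W - a) Y = (U - a) (X - Y) + (U - W) Y\<close>, where \<open>U - W\<close> has rank one.
\<close>

lemma models_mult_linear:
  assumes Y: "models Y \<phi>"
  shows "models (\<lambda>f. W (Y f) - a *\<^sub>C Y f) (\<lambda>z. (z - a) * \<phi> z)"
proof -
  have c: "continuous_on (sphere 0 1) \<phi>" and bY: "bounded_operator_on M Y"
    and F: "finite_rank_on M (\<lambda>f. mult_L2T \<phi> f - Y f)"
    using Y unfolding models_def by blast+
  have c1: "bounded_symbol (\<lambda>z. z - a)"
    by (intro bounded_symbol_continuous continuous_intros)
  have "finite_rank_on M (\<lambda>f. mult_L2T (\<lambda>z. z - a) (mult_L2T \<phi> f - Y f) + (U (Y f) - W (Y f)))"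
    by (rule finite_rank_on_add[OF
        finite_rank_on_compose_left[OF F mult_L2T_add[OF c1] mult_L2T_scaleC[OF c1]]
        finite_rank_on_compose_right[OF finite_rank_shift_minus_W bY]])
  moreover have "mult_L2T (\<lambda>z. (z - a) * \<phi> z) f - (W (Y f) - a *\<^sub>C Y f)
      = mult_L2T (\<lambda>z. z - a) (mult_L2T \<phi> f - Y f) + (U (Y f) - W (Y f))" for f
  proof -
    have "mult_L2T (\<lambda>z. (z - a) * \<phi> z) f = mult_L2T (\<lambda>z. z - a) (mult_L2T \<phi> f)"
      by (rule mult_L2T_mult[OF c1 bounded_symbol_continuous[OF c], symmetric])
    moreover have "mult_L2T (\<lambda>z. z - a) (Y f) = U (Y f) - a *\<^sub>C Y f"
      by (rule mult_L2T_minus_const[OF bounded_symbol_id])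
    ultimately show ?thesis by (simp add: mult_L2T_diff[OF c1])
  qed
  ultimately have "finite_rank_on M (\<lambda>f. mult_L2T (\<lambda>z. (z - a) * \<phi> z) f - (W (Y f) - a *\<^sub>C Y f))"
    by (simp only:)
  then show ?thesis
    unfolding models_def
    using M.bounded_operator_on_compose[OF bounded_operator_W_minus[of a] bY] c
    by (auto intro!: continuous_intros)
qed

text \<open>
  With \<open>X\<close> for multiplication by \<open>\<phi>\<close> and \<open>V\<close> for the inverse of \<open>U - b\<close>, this rests on the identity
  \<open>V X - R Y = V (X - Y) - V (U - W) R Y\<close>, a consequence of \<open>Y = (W - b) R Y\<close>.
\<close>

lemma models_divide_linear:
  assumes Y: "models Y \<phi>" and b: "norm b \<noteq> 1"
    and R: "bounded_operator_on M R" "\<And>f. f \<in> M \<Longrightarrow> W (R f) - b *\<^sub>C R f = f"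
  shows "models (\<lambda>f. R (Y f)) (\<lambda>z. \<phi> z / (z - b))"
proof -
  have c: "continuous_on (sphere 0 1) \<phi>" and bY: "bounded_operator_on M Y"
    and F: "finite_rank_on M (\<lambda>f. mult_L2T \<phi> f - Y f)"
    using Y unfolding models_def by blast+
  have nz: "z - b \<noteq> 0" if "z \<in> sphere 0 1" for z using b that by auto
  have c1: "bounded_symbol (\<lambda>z. z - b)"
    by (intro bounded_symbol_continuous continuous_intros)
  have c2: "bounded_symbol (\<lambda>z. 1 / (z - b))"
    using nz by (intro bounded_symbol_continuous continuous_intros) auto
  let ?V = "mult_L2T (\<lambda>z. 1 / (z - b))"
  have bRY: "bounded_operator_on M (\<lambda>f. R (Y f))"
    by (rule M.bounded_operator_on_compose[OF R(1) bY])
  have neg: "finite_rank_on M (\<lambda>f. (-1) *\<^sub>C (U (R (Y f)) - W (R (Y f))))"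
    using finite_rank_on_compose_left[OF
        finite_rank_on_compose_right[OF finite_rank_shift_minus_W bRY], of "\<lambda>f. (-1) *\<^sub>C f"]
    by (simp add: L2T.scale_right_distrib)
  have "finite_rank_on M (\<lambda>f. ?V (mult_L2T \<phi> f - Y f) + ?V ((-1) *\<^sub>C (U (R (Y f)) - W (R (Y f)))))"
    by (rule finite_rank_on_add[OF
          finite_rank_on_compose_left[OF F mult_L2T_add[OF c2] mult_L2T_scaleC[OF c2]]
          finite_rank_on_compose_left[OF neg mult_L2T_add[OF c2] mult_L2T_scaleC[OF c2]]])
  moreover have "mult_L2T (\<lambda>z. \<phi> z / (z - b)) f - R (Y f)
      = ?V (mult_L2T \<phi> f - Y f) + ?V ((-1) *\<^sub>C (U (R (Y f)) - W (R (Y f))))" if f: "f \<in> M" for f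
  proof -
    have "mult_L2T (\<lambda>z. \<phi> z / (z - b)) f = ?V (mult_L2T \<phi> f)"
      using mult_L2T_mult[OF c2 bounded_symbol_continuous[OF c], of f] by simp
    moreover have "?V (mult_L2T (\<lambda>z. z - b) g) = g" for g
    proof -
      have "?V (mult_L2T (\<lambda>z. z - b) g) = mult_L2T (\<lambda>z. 1 / (z - b) * (z - b)) g"
        by (rule mult_L2T_mult[OF c2 c1])
      also have "\<dots> = mult_L2T (\<lambda>_. 1) g"
        using nz by (intro mult_L2T_cong bounded_symbol_continuous) auto
      finally show ?thesis by (simp add: mult_L2T_one)
    qed
    then have "R (Y f) = ?V (U (R (Y f)) - b *\<^sub>C R (Y f))"
      using mult_L2T_minus_const[OF bounded_symbol_id] by metis
    moreover have "U (R (Y f)) - b *\<^sub>C R (Y f) = Y f + (U (R (Y f)) - W (R (Y f)))"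
      using R(2)[OF bounded_operator_onD(1)[OF bY f]] by (simp add: algebra_simps)
    ultimately have "mult_L2T (\<lambda>z. \<phi> z / (z - b)) f - R (Y f)
        = ?V (mult_L2T \<phi> f) - ?V (Y f + (U (R (Y f)) - W (R (Y f))))"
      by simp
    also have "\<dots> = ?V (mult_L2T \<phi> f - Y f) + ?V (- (U (R (Y f)) - W (R (Y f))))"
      unfolding mult_L2T_diff[OF c2, symmetric] mult_L2T_add[OF c2, symmetric]
      by (simp add: algebra_simps)
    finally show ?thesis by (simp only: scaleC_minus_one)
  qed
  ultimately have "finite_rank_on M (\<lambda>f. mult_L2T (\<lambda>z. \<phi> z / (z - b)) f - R (Y f))"
    by (rule finite_rank_on_cong[rotated])
  then show ?thesis
    unfolding models_def using bRY c nz by (auto intro!: continuous_intros)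
qed

lemma models_poly:
  assumes "models Y \<phi>"
  shows "\<exists>Y'. models Y' (\<lambda>z. poly p z * \<phi> z) \<and>
    ((\<forall>z\<in>sphere 0 1. poly p z \<noteq> 0) \<longrightarrow> invertible_on M Y \<longrightarrow> invertible_on M Y')"
proof (induction "degree p" arbitrary: p rule: less_induct)
  case less
  have bY: "bounded_operator_on M Y" using assms by (simp add: models_def)
  show ?case
  proof (cases "degree p = 0")
    case True
    then obtain c where c: "p = [:c:]" by (rule degree_eq_zeroE)
    have bs: "bounded_symbol \<phi>"
      using assms by (auto simp: models_def intro: bounded_symbol_continuous)
    have m: "models (\<lambda>f. c *\<^sub>C Y f) (\<lambda>z. c * \<phi> z)"
    proof -
      have "mult_L2T (\<lambda>z. c * \<phi> z) f = c *\<^sub>C mult_L2T \<phi> f" for f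
        using rep_mult_L2T[OF bounded_symbol_mult[OF bounded_symbol_continuous bs], of "\<lambda>_. c" f]
          rep_mult_L2T[OF bs, of f] rep_L2T_scaleC[of c "mult_L2T \<phi> f"]
        by (intro L2T_eqI) (auto simp: mult.assoc)
      then have "mult_L2T (\<lambda>z. c * \<phi> z) f - c *\<^sub>C Y f = c *\<^sub>C (mult_L2T \<phi> f - Y f)" for f
        by (simp add: L2T.scale_right_diff_distrib)
      moreover have "finite_rank_on M (\<lambda>f. c *\<^sub>C (mult_L2T \<phi> f - Y f))"
        using assms unfolding models_def
        by (intro finite_rank_on_compose_left[of M _ "\<lambda>f. c *\<^sub>C f"])
           (auto simp: L2T.scale_right_distrib mult.commute)
      ultimately show ?thesis
        using assms M.bounded_operator_on_scale[OF bY, of c] unfolding models_def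
        by (auto intro!: continuous_intros)
    qed
    have i: "invertible_on M (\<lambda>f. c *\<^sub>C Y f)" if "c \<noteq> 0" "invertible_on M Y"
    proof -
      have "invertible_on M (\<lambda>f. c *\<^sub>C f)"
        unfolding invertible_on_def using that(1)
        by (intro exI[of _ "\<lambda>f. (1 / c) *\<^sub>C f"] conjI
            M.bounded_operator_on_scale[OF M.bounded_operator_on_id]) auto
      from M.invertible_on_compose[OF this that(2) bY] show ?thesis .
    qed
    show ?thesis
    proof (intro exI[of _ "\<lambda>f. c *\<^sub>C Y f"] conjI impI)
      show "models (\<lambda>f. c *\<^sub>C Y f) (\<lambda>z. poly p z * \<phi> z)" using m by (simp add: c)
      assume nz: "\<forall>z\<in>sphere 0 1. poly p z \<noteq> 0" and inv: "invertible_on M Y"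
      have "poly p 1 \<noteq> 0" by (rule bspec[OF nz]) simp
      then show "invertible_on M (\<lambda>f. c *\<^sub>C Y f)"
        using c inv by (intro i) simp_all
    qed
  next
    case False
    then obtain a where a: "poly p a = 0"
      using Fundamental_Theorem_Algebra.fundamental_theorem_of_algebra[of p] by (auto simp: constant_degree)
    then obtain r where r: "p = [:-a, 1:] * r" by (auto simp: poly_eq_0_iff_dvd)
    then have "r \<noteq> 0" using False by auto
    then have "degree p = Suc (degree r)" unfolding r by (subst degree_mult_eq) auto
    then obtain Y' where Y': "models Y' (\<lambda>z. poly r z * \<phi> z)"
      "(\<forall>z\<in>sphere 0 1. poly r z \<noteq> 0) \<Longrightarrow> invertible_on M Y \<Longrightarrow> invertible_on M Y'"
      using less[of r] by auto
    have "models (\<lambda>f. W (Y' f) - a *\<^sub>C Y' f) (\<lambda>z. (z - a) * (poly r z * \<phi> z))"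
      by (rule models_mult_linear[OF Y'(1)])
    moreover have "poly p z * \<phi> z = (z - a) * (poly r z * \<phi> z)" for z
      by (simp add: r left_diff_distrib)
    ultimately have "models (\<lambda>f. W (Y' f) - a *\<^sub>C Y' f) (\<lambda>z. poly p z * \<phi> z)"
      by (simp only:)
    moreover have "invertible_on M (\<lambda>f. W (Y' f) - a *\<^sub>C Y' f)"
      if nz: "\<forall>z\<in>sphere 0 1. poly p z \<noteq> 0" and inv: "invertible_on M Y"
    proof -
      have "norm a \<noteq> 1" using nz a by auto
      moreover have "invertible_on M Y'" using nz inv by (intro Y'(2)) (auto simp: r)
      ultimately show ?thesis
        using M.invertible_on_compose[OF invertible_W_minus[of a], of Y'] Y'(1)
        by (simp add: models_def)
    qed
    ultimately show ?thesis by (intro exI[of _ "\<lambda>f. W (Y' f) - a *\<^sub>C Y' f"]) simp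
  qed
qed

lemma models_divide_poly:
  assumes "models Y \<phi>" and "\<forall>z\<in>sphere 0 1. poly q z \<noteq> 0"
  shows "\<exists>Y'. models Y' (\<lambda>z. \<phi> z / poly q z) \<and> (invertible_on M Y \<longrightarrow> invertible_on M Y')"
  using assms(2)
proof (induction "degree q" arbitrary: q rule: less_induct)
  case less
  show ?case
  proof (cases "degree q = 0")
    case True
    then obtain c where c: "q = [:c:]" by (rule degree_eq_zeroE)
    have "(1::complex) \<in> sphere 0 1" by simp
    from bspec[OF less(2) this] have c0: "c \<noteq> 0" using c by simp
    then show ?thesis
      using models_poly[OF assms(1), of "[:1 / c:]"] c by auto
  next
    case False
    then obtain a where a: "poly q a = 0"
      using Fundamental_Theorem_Algebra.fundamental_theorem_of_algebra[of q] by (auto simp: constant_degree)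
    then obtain r where r: "q = [:-a, 1:] * r" by (auto simp: poly_eq_0_iff_dvd)
    then have "r \<noteq> 0" using False by auto
    then have "degree q = Suc (degree r)" unfolding r by (subst degree_mult_eq) auto
    moreover have "\<forall>z\<in>sphere 0 1. poly r z \<noteq> 0" using less(2) by (auto simp: r)
    ultimately obtain Y' where Y': "models Y' (\<lambda>z. \<phi> z / poly r z)"
      "invertible_on M Y \<Longrightarrow> invertible_on M Y'"
      using less(1)[of r] by auto
    have a1: "norm a \<noteq> 1" using less(2) a by auto
    obtain R where R: "bounded_operator_on M R"
      "\<forall>f\<in>M. R (W f - a *\<^sub>C f) = f \<and> W (R f) - a *\<^sub>C R f = f"
      using invertible_W_minus[OF a1] unfolding invertible_on_def by (elim exE conjE)
    have "models (\<lambda>f. R (Y' f)) (\<lambda>z. \<phi> z / poly r z / (z - a))"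
      using R by (intro models_divide_linear[OF Y'(1) a1]) auto
    moreover have "poly q z = poly r z * (z - a)" for z by (simp add: r algebra_simps)
    then have "\<phi> z / poly q z = \<phi> z / poly r z / (z - a)" for z by simp
    ultimately have mR: "models (\<lambda>f. R (Y' f)) (\<lambda>z. \<phi> z / poly q z)"
      by (simp only:)
    have iR: "invertible_on M R"
      unfolding invertible_on_def using R(2) bounded_operator_W_minus[of a]
      by (intro exI[of _ "\<lambda>f. W f - a *\<^sub>C f"]) simp
    have bY': "bounded_operator_on M Y'" using Y'(1) by (simp add: models_def)
    show ?thesis
      using mR M.invertible_on_compose[OF iR Y'(2) bY'] by (intro exI[of _ "\<lambda>f. R (Y' f)"]) simp
  qed
qed

lemma models_compression:
  assumes Y: "models Y \<phi>"
  shows "bounded_operator_on M (\<lambda>f. orth_proj M (mult_L2T \<phi> f))"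
    and "finite_rank_on M (\<lambda>f. orth_proj M (mult_L2T \<phi> f) - Y f)"
proof -
  have c: "bounded_symbol \<phi>" and bY: "bounded_operator_on M Y"
    and F: "finite_rank_on M (\<lambda>f. mult_L2T \<phi> f - Y f)"
    using Y unfolding models_def by (auto intro: bounded_symbol_continuous)
  obtain C where C: "\<And>f. norm (mult_L2T \<phi> f) \<le> C * norm f"
    using mult_L2T_bounded[OF c] by blast
  show "bounded_operator_on M (\<lambda>f. orth_proj M (mult_L2T \<phi> f))"
  proof (rule M.bounded_operator_onI[where C=C])
    show "norm (orth_proj M (mult_L2T \<phi> f)) \<le> C * norm f" for f
      using M.norm_orth_proj_le C order_trans by blast
  qed (simp_all add: M.orth_proj_mem mult_L2T_add[OF c] mult_L2T_scaleC[OF c] M.orth_proj_add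
      M.orth_proj_scaleC)
  have "orth_proj M (mult_L2T \<phi> f) - Y f = orth_proj M (mult_L2T \<phi> f - Y f)" if "f \<in> M" for f
  proof -
    have "orth_proj M ((mult_L2T \<phi> f - Y f) + Y f)
        = orth_proj M (mult_L2T \<phi> f - Y f) + orth_proj M (Y f)"
      by (rule M.orth_proj_add)
    then show ?thesis
      using M.orth_proj_id[OF bounded_operator_onD(1)[OF bY that]] by simp
  qed
  then show "finite_rank_on M (\<lambda>f. orth_proj M (mult_L2T \<phi> f) - Y f)"
    by (rule finite_rank_on_cong[OF _
          finite_rank_on_compose_left[OF F M.orth_proj_add M.orth_proj_scaleC]])
qed

text \<open>
  Up to a nonzero constant, the model of \<open>p/q\<close> is a product of operators \<open>W - a\<close> with \<open>\<bar>a\<bar> \<noteq> 1\<close> and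
  of inverses of such operators, so the
  compression is an invertible operator plus one of finite rank.
\<close>

lemma compression_invertible:
  assumes p: "\<forall>z\<in>sphere 0 1. poly p z \<noteq> 0" and q: "\<forall>z\<in>sphere 0 1. poly q z \<noteq> 0"
    and inj: "\<And>f. f \<in> M \<Longrightarrow> orth_proj M (mult_L2T (\<lambda>z. poly p z / poly q z) f) = 0 \<Longrightarrow> f = 0"
  shows "invertible_on M (\<lambda>f. orth_proj M (mult_L2T (\<lambda>z. poly p z / poly q z) f))"
proof -
  have "models (\<lambda>f. f) (\<lambda>_. 1)" using models_const[of 1] by simp
  moreover have "invertible_on M (\<lambda>f. f)"
    unfolding invertible_on_def using M.bounded_operator_on_id by (intro exI[of _ "\<lambda>f. f"]) simp
  ultimately have id: "models (\<lambda>f. f) (\<lambda>_. 1)" "invertible_on M (\<lambda>f. f)" by simp_all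
  from models_poly[OF id(1), of p] obtain Y where Y: "models Y (\<lambda>z. poly p z * 1)"
    and "(\<forall>z\<in>sphere 0 1. poly p z \<noteq> 0) \<longrightarrow> invertible_on M (\<lambda>f. f) \<longrightarrow> invertible_on M Y"
    by (elim exE conjE)
  then have "invertible_on M Y" using p id(2) by simp
  moreover from models_divide_poly[OF Y q] obtain Y' where
    Y': "models Y' (\<lambda>z. poly p z * 1 / poly q z)" and "invertible_on M Y \<longrightarrow> invertible_on M Y'"
    by (elim exE conjE)
  ultimately have inv: "invertible_on M Y'" by simp
  have m: "models Y' (\<lambda>z. poly p z / poly q z)" using Y' by simp
  show ?thesis
    by (rule M.invertible_on_finite_rank_perturbation[OF _ inv models_compression[OF m] inj])
       (use m in \<open>auto simp: models_def\<close>)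
qed

text \<open>
  The factor \<open>z - a\<close> of \<open>p\<close> puts the range of the model into that of \<open>W - a\<close>. If the compression had a
  range of finite codimension, then so would \<open>W - a\<close>.
\<close>

lemma compression_not_fredholm:
  assumes q: "\<forall>z\<in>sphere 0 1. poly q z \<noteq> 0" and a: "norm a = 1" "poly p a = 0"
  shows "\<not> fredholm_on M (\<lambda>f. orth_proj M (mult_L2T (\<lambda>z. poly p z / poly q z) f))"
    (is "\<not> fredholm_on M ?T")
proof
  assume "fredholm_on M ?T"
  then obtain B where B: "finite B" "\<And>f. f \<in> M \<Longrightarrow> \<exists>g\<in>M. f - ?T g \<in> L2T.span B"
    unfolding fredholm_on_def by blast
  obtain r where r: "p = [:-a, 1:] * r" using a(2) by (auto simp: poly_eq_0_iff_dvd)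
  have "models (\<lambda>f. f) (\<lambda>_. 1)" using models_const[of 1] by simp
  from models_poly[OF this, of r] obtain Y where Y: "models Y (\<lambda>z. poly r z * 1)"
    by (elim exE conjE)
  from models_divide_poly[OF Y q] obtain Y' where Y': "models Y' (\<lambda>z. poly r z * 1 / poly q z)"
    by (elim exE conjE)
  have "models (\<lambda>f. W (Y' f) - a *\<^sub>C Y' f) (\<lambda>z. (z - a) * (poly r z * 1 / poly q z))"
    by (rule models_mult_linear[OF Y'])
  moreover have "(z - a) * (poly r z * 1 / poly q z) = poly p z / poly q z" for z
    by (simp add: r left_diff_distrib)
  ultimately have "models (\<lambda>f. W (Y' f) - a *\<^sub>C Y' f) (\<lambda>z. poly p z / poly q z)"
    by (simp only:)
  from finite_rank_on_range[OF models_compression(2)[OF this]] obtain B' where "finite B'"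
    and "\<forall>f\<in>M. ?T f - (W (Y' f) - a *\<^sub>C Y' f) \<in> L2T.span B'"
    by (elim exE conjE)
  note B' = this(1) bspec[OF this(2)]
  show False
  proof (rule range_W_minus_infinite_codim[OF a(1), of "B \<union> B'"])
    show "finite (B \<union> B')" using B B' by simp
    fix f assume "f \<in> M"
    then obtain g where g: "g \<in> M" "f - ?T g \<in> L2T.span B" using B(2) by blast
    have "(f - ?T g) + (?T g - (W (Y' g) - a *\<^sub>C Y' g)) \<in> L2T.span (B \<union> B')"
      using g(2) B'(2)[OF g(1)] L2T.span_mono[of B "B \<union> B'"] L2T.span_mono[of B' "B \<union> B'"]
      by (intro L2T.span_add) auto
    moreover have "Y' g \<in> M" using Y' g(1) unfolding models_def
      by (auto dest: bounded_operator_onD(1))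
    moreover have "(f - ?T g) + (?T g - (W (Y' g) - a *\<^sub>C Y' g)) = f - (W (Y' g) - a *\<^sub>C Y' g)"
      by (rule diff_add_diff)
    ultimately show "\<exists>g\<in>M. f - (W g - a *\<^sub>C g) \<in> L2T.span (B \<union> B')"
      by (intro bexI[of _ "Y' g"]) simp_all
  qed
qed

end

section \<open>The Hardy space as a closed span\<close>

definition zpow :: "nat \<Rightarrow> L2T" where "zpow n = abs_L2T (\<lambda>z. z ^ n)"

lemma square_integrable_continuous:
  assumes "continuous_on (sphere 0 1) f"
  shows "square_integrable f"
proof -
  have "square_integrable (\<lambda>z. f z * 1)"
    by (intro square_integrable_bounded_mult bounded_symbol_continuous assms)
       (simp add: square_integrable_def)
  then show ?thesis by simp
qed

lemma square_integrable_power: "square_integrable (\<lambda>z. z ^ n)"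
  by (intro square_integrable_continuous continuous_intros)

interpretation zpow: orthonormal_seq zpow
proof
  fix m n
  have "cinner (zpow m) (zpow n) = integral\<^sup>L circle (\<lambda>z. z ^ m * cnj (z ^ n))"
    unfolding zpow_def using cinner.abs_eq[of "\<lambda>z. z ^ m" "\<lambda>z. z ^ n"] square_integrable_power
    by (simp del: complex_cnj_power)
  then show "cinner (zpow m) (zpow n) = (if m = n then 1 else 0)"
    by (simp only: integral_circle_power_cnj)
qed

lemma shift_zpow: "U (zpow n) = zpow (Suc n)"
  unfolding zpow_def by (simp add: mult_abs_L2T[OF bounded_symbol_id square_integrable_power])

text \<open>
  The closed span of the powers of \<open>z\<close>, which turns out to be the Hardy space. In this form it gives at
  once the expansion that the later proofs use.
\<close>

definition analytic_L2 :: "L2T set" where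
  "analytic_L2 = {f. zpow.fourier_sum f \<longlonglongrightarrow> f}"

lemma fourier_sum_add: "zpow.fourier_sum (f + g) m = zpow.fourier_sum f m + zpow.fourier_sum g m"
  by (simp add: zpow.fourier_sum_def cinner_add_left L2T.scale_left_distrib sum.distrib)

lemma fourier_sum_scaleC: "zpow.fourier_sum (c *\<^sub>C f) m = c *\<^sub>C zpow.fourier_sum f m"
  by (simp add: zpow.fourier_sum_def cinner_scaleC_left L2T.scale_sum_right)

lemma tendsto_scaleC:
  assumes "X \<longlonglongrightarrow> f"
  shows "(\<lambda>n. c *\<^sub>C X n) \<longlonglongrightarrow> c *\<^sub>C f"
proof (rule LIM_zero_cancel)
  have "(\<lambda>n. norm c * norm (X n - f)) \<longlonglongrightarrow> 0"
    using tendsto_mult_left[OF tendsto_norm_zero[OF LIM_zero[OF assms]], of "norm c"] by simp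
  then show "(\<lambda>n. c *\<^sub>C X n - c *\<^sub>C f) \<longlonglongrightarrow> 0"
    by (rule Lim_null_comparison[rotated]) (simp add: L2T.scale_right_diff_distrib[symmetric])
qed

lemma subspace_analytic_L2: "L2T.subspace analytic_L2"
  unfolding L2T.subspace_def
proof (intro conjI ballI allI)
  have "zpow.fourier_sum 0 = (\<lambda>_. 0)" by (simp add: zpow.fourier_sum_def fun_eq_iff)
  then show "0 \<in> analytic_L2" by (simp add: analytic_L2_def)
  fix f g assume fg: "f \<in> analytic_L2" "g \<in> analytic_L2"
  then have "(\<lambda>m. zpow.fourier_sum f m + zpow.fourier_sum g m) \<longlonglongrightarrow> f + g"
    unfolding analytic_L2_def by (intro tendsto_add) auto
  then show "f + g \<in> analytic_L2" by (simp add: analytic_L2_def fourier_sum_add[abs_def])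
next
  fix c f assume "f \<in> analytic_L2"
  then have "(\<lambda>m. c *\<^sub>C zpow.fourier_sum f m) \<longlonglongrightarrow> c *\<^sub>C f"
    unfolding analytic_L2_def by (intro tendsto_scaleC) auto
  then show "c *\<^sub>C f \<in> analytic_L2"
    by (simp add: analytic_L2_def fourier_sum_scaleC[abs_def])
qed

text \<open>
  Fourier sums are best approximations, so polynomials with arbitrary coefficients suffice.
\<close>

lemma analytic_L2I:
  assumes approx: "\<And>e. e > 0 \<Longrightarrow> \<exists>m c. norm (f - (\<Sum>n<m. c n *\<^sub>C zpow n)) < e"
  shows "f \<in> analytic_L2"
proof -
  have "zpow.fourier_sum f \<longlonglongrightarrow> f"
  proof (rule metric_LIMSEQ_I)
    fix e :: real assume "e > 0"
    then obtain m c where mc: "norm (f - (\<Sum>n<m. c n *\<^sub>C zpow n)) < e" using approx by blast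
    have "dist (zpow.fourier_sum f k) f < e" if "k \<ge> m" for k
    proof -
      have "(\<Sum>n<k. (if n < m then c n else 0) *\<^sub>C zpow n) = (\<Sum>n<m. c n *\<^sub>C zpow n)"
        using that by (intro sum.mono_neutral_cong_right) auto
      then have "norm (f - zpow.fourier_sum f k) \<le> norm (f - (\<Sum>n<m. c n *\<^sub>C zpow n))"
        using zpow.best_approximation[of f k "\<lambda>n. if n < m then c n else 0"] by simp
      then show ?thesis using mc by (simp add: dist_norm norm_minus_commute)
    qed
    then show "\<exists>m. \<forall>k\<ge>m. dist (zpow.fourier_sum f k) f < e" by blast
  qed
  then show ?thesis by (simp add: analytic_L2_def)
qed

lemma analytic_L2_approx:
  assumes "f \<in> analytic_L2" "e > 0"
  shows "\<exists>m c. norm (f - (\<Sum>n<m. c n *\<^sub>C zpow n)) < e"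
proof -
  have "zpow.fourier_sum f \<longlonglongrightarrow> f" using assms(1) by (simp add: analytic_L2_def)
  from metric_LIMSEQ_D[OF this assms(2)] obtain m where "dist (zpow.fourier_sum f m) f < e" by blast
  then have "norm (f - (\<Sum>n<m. cinner f (zpow n) *\<^sub>C zpow n)) < e"
    by (simp add: dist_norm norm_minus_commute zpow.fourier_sum_def)
  then show ?thesis by (intro exI)
qed

lemma closed_analytic_L2: "closed analytic_L2"
  unfolding closed_sequential_limits
proof safe
  fix X f assume X: "\<forall>n. X n \<in> analytic_L2" "X \<longlonglongrightarrow> f"
  show "f \<in> analytic_L2"
  proof (rule analytic_L2I)
    fix e :: real assume "e > 0"
    then obtain k where k: "norm (X k - f) < e / 2"
      using metric_LIMSEQ_D[OF X(2), of "e / 2"] by (auto simp: dist_norm)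
    obtain m c where mc: "norm (X k - (\<Sum>n<m. c n *\<^sub>C zpow n)) < e / 2"
      using analytic_L2_approx[of "X k" "e / 2"] X(1) \<open>e > 0\<close> by auto
    have "norm (f - (\<Sum>n<m. c n *\<^sub>C zpow n)) \<le> norm (f - X k) + norm (X k - (\<Sum>n<m. c n *\<^sub>C zpow n))"
      using norm_triangle_ineq[of "f - X k" "X k - (\<Sum>n<m. c n *\<^sub>C zpow n)"] by simp
    then have "norm (f - (\<Sum>n<m. c n *\<^sub>C zpow n)) < e" using k mc by (simp add: norm_minus_commute)
    then show "\<exists>m c. norm (f - (\<Sum>n<m. c n *\<^sub>C zpow n)) < e" by (intro exI)
  qed
qed

interpretation analytic_L2: closed_subspace analytic_L2
  by unfold_locales (rule closed_analytic_L2, rule subspace_analytic_L2)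

lemma zpow_mem: "zpow n \<in> analytic_L2"
proof (rule analytic_L2I)
  fix e :: real assume "e > 0"
  have "(\<Sum>k<Suc n. (if k = n then 1 else 0) *\<^sub>C zpow k) = zpow n"
    by (subst sum.remove[of _ n]) (auto intro!: sum.neutral)
  then have "norm (zpow n - (\<Sum>k<Suc n. (if k = n then 1 else 0) *\<^sub>C zpow k)) < e"
    using \<open>e > 0\<close> by simp
  then show "\<exists>m c. norm (zpow n - (\<Sum>n<m. c n *\<^sub>C zpow n)) < e" by (intro exI)
qed

lemma shift_sum_zpow: "U (\<Sum>n<m. c n *\<^sub>C zpow n) = (\<Sum>n<m. c n *\<^sub>C zpow (Suc n))"
  by (induction m)
     (simp_all add: shift_linear shift_zpow mult_L2T_diff[OF bounded_symbol_id, of 0 0, simplified])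

lemma shift_fourier_sum_orth:
  assumes "f \<in> analytic_L2"
  shows "(\<lambda>m. \<Sum>n<m. cinner f (zpow n) *\<^sub>C zpow (Suc n)) \<longlonglongrightarrow> U f"
proof -
  have "(\<lambda>m. U (zpow.fourier_sum f m)) \<longlonglongrightarrow> U f"
    using assms by (intro tendsto_mult_L2T[OF bounded_symbol_id]) (simp add: analytic_L2_def)
  then show ?thesis by (simp add: zpow.fourier_sum_def shift_sum_zpow)
qed

interpretation analytic_L2: shift_space analytic_L2 "zpow 0"
proof
  fix f assume f: "f \<in> analytic_L2"
  have part: "(\<Sum>n<m. cinner f (zpow n) *\<^sub>C zpow (Suc n)) \<in> analytic_L2" for m
    by (intro L2T.subspace_sum[OF subspace_analytic_L2] analytic_L2.mem_scale zpow_mem)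
  show "U f \<in> analytic_L2"
    by (rule closed_sequentially[OF closed_analytic_L2 part shift_fourier_sum_orth[OF f]])
  have "(\<lambda>m. cinner (\<Sum>n<m. cinner f (zpow n) *\<^sub>C zpow (Suc n)) (zpow 0)) \<longlonglongrightarrow> cinner (U f) (zpow 0)"
    by (rule tendsto_cinner[OF shift_fourier_sum_orth[OF f]])
  moreover have "cinner (\<Sum>n<m. cinner f (zpow n) *\<^sub>C zpow (Suc n)) (zpow 0) = 0" for m
    by (simp add: cinner_sum_left cinner_scaleC_left zpow.orthonormal)
  ultimately show "cinner (U f) (zpow 0) = 0" by (simp add: LIMSEQ_const_iff)
next
  show "zpow 0 \<in> analytic_L2" by (rule zpow_mem)
  show "cinner (zpow 0) (zpow 0) = 1" by (simp add: zpow.orthonormal)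
next
  fix f assume f: "f \<in> analytic_L2" "cinner f (zpow 0) = 0"
  have "U' (zpow.fourier_sum f (Suc m)) = (\<Sum>n<m. cinner f (zpow (Suc n)) *\<^sub>C zpow n)" for m
  proof -
    have "zpow.fourier_sum f (Suc m) = U (\<Sum>n<m. cinner f (zpow (Suc n)) *\<^sub>C zpow n)"
      unfolding zpow.fourier_sum_def sum.lessThan_Suc_shift shift_sum_zpow using f(2) by simp
    then show ?thesis by simp
  qed
  moreover have "(\<Sum>n<m. cinner f (zpow (Suc n)) *\<^sub>C zpow n) \<in> analytic_L2" for m
    by (intro L2T.subspace_sum[OF subspace_analytic_L2] analytic_L2.mem_scale zpow_mem)
  ultimately have mem: "U' (zpow.fourier_sum f (Suc m)) \<in> analytic_L2" for m by simp
  have "(\<lambda>m. zpow.fourier_sum f (Suc m)) \<longlonglongrightarrow> f"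
    using f(1) LIMSEQ_Suc by (auto simp: analytic_L2_def)
  then have "(\<lambda>m. U' (zpow.fourier_sum f (Suc m))) \<longlonglongrightarrow> U' f"
    by (rule tendsto_mult_L2T[OF bounded_symbol_cnj_id])
  then show "U' f \<in> analytic_L2" by (rule closed_sequentially[OF closed_analytic_L2 mem])
qed

subsection \<open>Boundary functions\<close>

definition dilate :: "(complex \<Rightarrow> complex) \<Rightarrow> real \<Rightarrow> complex \<Rightarrow> complex" where
  "dilate F r z = F (of_real r * z)"

lemma square_integrable_dilate:
  assumes "F holomorphic_on ball 0 1" "0 \<le> r" "r < 1"
  shows "square_integrable (dilate F r)"
proof (rule square_integrable_continuous)
  have "continuous_on (ball 0 1) F"
    using assms(1) by (rule holomorphic_on_imp_continuous_on)
  then show "continuous_on (sphere 0 1) (dilate F r)"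
    unfolding dilate_def
    by (rule continuous_on_compose2) (use assms in \<open>auto intro!: continuous_intros simp: norm_mult\<close>)
qed

lemma norm_abs_L2T_le:
  assumes "square_integrable f" "0 \<le> C" "\<And>z. z \<in> sphere 0 1 \<Longrightarrow> norm (f z) \<le> C"
  shows "norm (abs_L2T f) \<le> C"
proof -
  have "(norm (abs_L2T f))\<^sup>2 \<le> integral\<^sup>L circle (\<lambda>z. C\<^sup>2)"
    unfolding norm_squared_abs[OF assms(1)]
    using assms by (intro integral_mono) (auto simp: square_integrable_def space_circle intro!: power_mono)
  also have "\<dots> = C\<^sup>2" by (simp add: space_circle measure_circle_space)
  finally show ?thesis using assms(2) by (rule power2_le_imp_le)
qed

lemma sum_zpow_eq: "(\<Sum>n<m. c n *\<^sub>C zpow n) = abs_L2T (\<lambda>z. \<Sum>n<m. c n * z ^ n)"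
proof (induction m)
  case 0
  then show ?case by (simp add: zero_L2T_def)
next
  case (Suc m)
  have s: "square_integrable (\<lambda>z. \<Sum>n<m. c n * z ^ n)"
    by (intro square_integrable_continuous continuous_intros)
  show ?case
    using Suc plus_abs_L2T[OF s square_integrable_scale[OF square_integrable_power, of "c m" m]]
      scaleC_abs_L2T[OF square_integrable_power, of "c m" m]
    by (simp add: zpow_def)
qed

lemma minus_abs_L2T:
  assumes "square_integrable f" "square_integrable g"
  shows "abs_L2T f - abs_L2T g = abs_L2T (\<lambda>z. f z - g z)"
proof -
  have "abs_L2T f + (-1) *\<^sub>C abs_L2T g = abs_L2T (\<lambda>z. f z + (-1) * g z)"
    unfolding scaleC_abs_L2T[OF assms(2)]
    by (rule plus_abs_L2T[OF assms(1) square_integrable_scale[OF assms(2)]])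
  then show ?thesis by (simp add: scaleC_minus_one)
qed

text \<open>
  On the circle of radius \<open>r < 1\<close> the Taylor series converges absolutely, hence uniformly.
\<close>

lemma dilate_series:
  assumes F: "F holomorphic_on ball 0 1" and r: "0 \<le> r" "r < 1"
    and a: "\<And>w. norm w < 1 \<Longrightarrow> (\<lambda>n. a n * w ^ n) sums F w"
  shows "(\<lambda>m. \<Sum>n<m. (a n * of_real r ^ n) *\<^sub>C zpow n) \<longlonglongrightarrow> abs_L2T (dilate F r)"
proof (rule metric_LIMSEQ_I)
  fix e :: real assume e: "e > 0"
  obtain \<rho> :: real where \<rho>: "r < \<rho>" "\<rho> < 1" using r dense by blast
  have "summable (\<lambda>n. a n * of_real \<rho> ^ n)"
    using a[of "of_real \<rho>"] \<rho> r by (auto simp: sums_iff)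
  then have summ: "summable (\<lambda>n. norm (a n * of_real r ^ n))"
    by (rule powser_insidea) (use \<rho> r in auto)
  from summable_partial_sum_bound[OF summ, of "e / 2"] e
  obtain K where K: "\<And>m n. m \<ge> K \<Longrightarrow> norm (\<Sum>k=m..n. norm (a k * of_real r ^ k)) < e / 2" by auto
  have "dist (\<Sum>n<m. (a n * of_real r ^ n) *\<^sub>C zpow n) (abs_L2T (dilate F r)) < e" if m: "m \<ge> K" for m
  proof -
    let ?p = "\<lambda>z. \<Sum>n<m. (a n * of_real r ^ n) * z ^ n"
    have sp: "square_integrable ?p" by (intro square_integrable_continuous continuous_intros)
    have sF: "square_integrable (dilate F r)" by (rule square_integrable_dilate[OF F r])
    have "norm (dilate F r z - ?p z) \<le> e / 2" if z: "z \<in> sphere 0 1" for z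
    proof -
      have sums: "(\<lambda>n. (a n * of_real r ^ n) * z ^ n) sums dilate F r z"
        using a[of "of_real r * z"] z r
        by (simp add: norm_mult dilate_def power_mult_distrib mult.assoc)
      have "(\<lambda>n. ?p z - (\<Sum>k<n. (a k * of_real r ^ k) * z ^ k)) \<longlonglongrightarrow> ?p z - dilate F r z"
        using sums unfolding sums_def by (intro tendsto_diff tendsto_const)
      then have "(\<lambda>n. norm (?p z - (\<Sum>k<n. (a k * of_real r ^ k) * z ^ k))) \<longlonglongrightarrow> norm (?p z - dilate F r z)"
        by (rule tendsto_norm)
      moreover have "norm (?p z - (\<Sum>k<n. (a k * of_real r ^ k) * z ^ k)) \<le> e / 2" if n: "n \<ge> Suc m" for n
      proof -
        have "(\<Sum>k<n. (a k * of_real r ^ k) * z ^ k) - ?p z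
            = (\<Sum>k=m..n-1. (a k * of_real r ^ k) * z ^ k)"
        proof -
          have "{..<n} = {..<m} \<union> {m..n-1}" using n by auto
          moreover have "{..<m} \<inter> {m..n-1} = {}" by auto
          ultimately show ?thesis by (simp add: sum.union_disjoint)
        qed
        then have "norm (?p z - (\<Sum>k<n. (a k * of_real r ^ k) * z ^ k))
            = norm (\<Sum>k=m..n-1. (a k * of_real r ^ k) * z ^ k)"
          by (metis norm_minus_commute)
        also have "\<dots> \<le> (\<Sum>k=m..n-1. norm (a k * of_real r ^ k))"
          using z by (intro sum_norm_le) (simp add: norm_mult norm_power)
        also have "\<dots> \<le> e / 2" using K[OF m, of "n - 1"] by (simp add: sum_nonneg)
        finally show ?thesis .
      qed
      ultimately have "norm (?p z - dilate F r z) \<le> e / 2"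
        by (intro LIMSEQ_le_const2[of _ _ "e / 2"]) auto
      then show ?thesis by (simp add: norm_minus_commute)
    qed
    then have "norm (abs_L2T (\<lambda>z. dilate F r z - ?p z)) \<le> e / 2"
      using e square_integrable_add[OF sF square_integrable_scale[OF sp, of "-1"]]
      by (intro norm_abs_L2T_le) auto
    then have "norm (abs_L2T (dilate F r) - (\<Sum>n<m. (a n * of_real r ^ n) *\<^sub>C zpow n)) \<le> e / 2"
      by (simp add: sum_zpow_eq minus_abs_L2T[OF sF sp])
    then show ?thesis using e by (simp add: dist_norm norm_minus_commute)
  qed
  then show "\<exists>K. \<forall>m\<ge>K. dist (\<Sum>n<m. (a n * of_real r ^ n) *\<^sub>C zpow n) (abs_L2T (dilate F r)) < e"
    by blast
qed

lemma dilate_mem_analytic_L2: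
  assumes hol: "F holomorphic_on ball 0 1" and r: "0 \<le> r" "r < 1"
  shows "abs_L2T (dilate F r) \<in> analytic_L2"
proof (rule closed_sequentially[OF closed_analytic_L2 _ dilate_series[OF hol r]])
  show "(\<lambda>n. ((deriv ^^ n) F 0 / fact n) * w ^ n) sums F w" if "norm w < 1" for w
    using holomorphic_power_series[OF hol, of w] that by simp
  show "(\<Sum>k<m. ((deriv ^^ k) F 0 / fact k * of_real r ^ k) *\<^sub>C zpow k) \<in> analytic_L2" for m
    by (intro L2T.subspace_sum[OF subspace_analytic_L2] analytic_L2.mem_scale zpow_mem)
qed

lemma hardy_space_subset: "hardy_space \<subseteq> analytic_L2"
proof
  fix f assume "f \<in> hardy_space"
  then obtain F where F: "F \<in> hardy_disk"
    and lim: "((\<lambda>r. \<integral>z. (norm (F (of_real r * z) - rep_L2T f z))\<^sup>2 \<partial>circle) \<longlongrightarrow> 0) (at_left 1)"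
    unfolding hardy_space_def by blast
  have hol: "F holomorphic_on ball 0 1" using F by (simp add: hardy_disk_def)
  define r where "r n = 1 - 1 / real (Suc (Suc n))" for n
  have r: "0 \<le> r n" "r n < 1" for n by (simp_all add: r_def field_simps)
  have "filterlim r (at_left 1) sequentially"
    unfolding r_def by real_asymp
  then have "(\<lambda>n. \<integral>z. (norm (F (of_real (r n) * z) - rep_L2T f z))\<^sup>2 \<partial>circle) \<longlonglongrightarrow> 0"
    by (rule filterlim_compose[OF lim])
  then have "(\<lambda>n. (norm (abs_L2T (dilate F (r n)) - f))\<^sup>2) \<longlonglongrightarrow> 0"
    by (simp add: norm_squared_abs_diff[OF square_integrable_dilate[OF hol r]] dilate_def)
  then have "(\<lambda>n. sqrt ((norm (abs_L2T (dilate F (r n)) - f))\<^sup>2)) \<longlonglongrightarrow> sqrt 0"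
    by (rule tendsto_real_sqrt)
  then have "(\<lambda>n. abs_L2T (dilate F (r n)) - f) \<longlonglongrightarrow> 0"
    by (simp add: tendsto_norm_zero_iff)
  then have conv: "(\<lambda>n. abs_L2T (dilate F (r n))) \<longlonglongrightarrow> f" by (rule LIM_zero_cancel)
  have mem: "abs_L2T (dilate F (r n)) \<in> analytic_L2" for n
    by (rule dilate_mem_analytic_L2[OF hol r])
  show "f \<in> analytic_L2" by (rule closed_sequentially[OF closed_analytic_L2 mem conv])
qed

lemma norm_diff_diff_le:
  fixes x y z :: "'a::real_normed_vector"
  shows "norm (x - y - z) \<le> norm x + norm y + norm z"
  using norm_triangle_ineq4[of "x - y" z] norm_triangle_ineq4[of x y] by linarith

text \<open>
  Dilation by \<open>r\<close> multiplies the \<open>n\<close>-th coefficient by \<open>r ^ n \<le> 1\<close>. It therefore does not increase the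
  norm of the tails, uniformly in \<open>r\<close>, while each partial sum converges as \<open>r\<close> tends to 1.
\<close>

lemma analytic_L2_dilates:
  assumes f: "f \<in> analytic_L2"
  defines "a \<equiv> \<lambda>n. cinner f (zpow n)"
  defines "F \<equiv> \<lambda>w. \<Sum>n. a n * w ^ n"
  shows "F holomorphic_on ball 0 1"
    and "0 \<le> r \<Longrightarrow> r < 1 \<Longrightarrow> norm (abs_L2T (dilate F r)) \<le> norm f"
    and "((\<lambda>r. abs_L2T (dilate F r)) \<longlongrightarrow> f) (at_left 1)"
proof -
  have abound: "norm (a n) \<le> norm f" for n
    using Cauchy_Schwarz_cinner[of f "zpow n"] by (simp add: a_def zpow.norm_E)
  have sums: "(\<lambda>n. a n * w ^ n) sums F w" if "norm w < 1" for w
  proof -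
    have "summable (\<lambda>n. norm f * norm w ^ n)" using that by (intro summable_mult summable_geometric) simp
    then have "summable (\<lambda>n. a n * w ^ n)"
      by (rule summable_comparison_test'[where N=0])
         (simp add: norm_mult norm_power mult_right_mono abound)
    then show ?thesis unfolding F_def by (rule summable_sums)
  qed
  show hol: "F holomorphic_on ball 0 1"
    by (rule power_series_holomorphic[where a=a]) (simp add: sums)
  have tail: "norm (\<Sum>n=m..<k. (a n * of_real r ^ n) *\<^sub>C zpow n) \<le> norm (f - zpow.fourier_sum f m)"
    if r: "0 \<le> r" "r < 1" for m k and r :: real
  proof (cases "m \<le> k")
    case True
    have "(norm (\<Sum>n=m..<k. (a n * of_real r ^ n) *\<^sub>C zpow n))\<^sup>2
        = (\<Sum>n=m..<k. (norm (a n * of_real r ^ n))\<^sup>2)"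
      by (rule zpow.norm_sum_E) simp
    also have "\<dots> \<le> (\<Sum>n=m..<k. (norm (cinner (f - zpow.fourier_sum f m) (zpow n)))\<^sup>2)"
    proof (intro sum_mono power_mono)
      fix n assume n: "n \<in> {m..<k}"
      have "cinner (zpow.fourier_sum f m) (zpow n) = 0"
        using n by (simp add: zpow.fourier_sum_def zpow.cinner_sum_E)
      then have "cinner (f - zpow.fourier_sum f m) (zpow n) = a n" by (simp add: cinner_diff_left a_def)
      moreover have "norm (a n * of_real r ^ n) \<le> norm (a n) * 1"
        unfolding norm_mult using r by (intro mult_left_mono) (simp_all add: norm_power power_le_one)
      ultimately show "norm (a n * of_real r ^ n) \<le> norm (cinner (f - zpow.fourier_sum f m) (zpow n))"
        by simp
    qed simp
    also have "\<dots> \<le> (\<Sum>n<k. (norm (cinner (f - zpow.fourier_sum f m) (zpow n)))\<^sup>2)"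
      by (rule sum_mono2) auto
    also have "\<dots> \<le> (norm (f - zpow.fourier_sum f m))\<^sup>2" by (rule zpow.Bessel)
    finally show ?thesis by (rule power2_le_imp_le) simp
  qed simp
  have tail_limit: "norm (abs_L2T (dilate F r) - (\<Sum>n<m. (a n * of_real r ^ n) *\<^sub>C zpow n))
      \<le> norm (f - zpow.fourier_sum f m)" if r: "0 \<le> r" "r < 1" for m and r :: real
  proof (rule LIMSEQ_le_const2)
    show "(\<lambda>k. norm ((\<Sum>n<k. (a n * of_real r ^ n) *\<^sub>C zpow n) - (\<Sum>n<m. (a n * of_real r ^ n) *\<^sub>C zpow n)))
        \<longlonglongrightarrow> norm (abs_L2T (dilate F r) - (\<Sum>n<m. (a n * of_real r ^ n) *\<^sub>C zpow n))"
      by (intro tendsto_norm tendsto_diff tendsto_const dilate_series[OF hol r sums])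
    have "norm ((\<Sum>n<k. (a n * of_real r ^ n) *\<^sub>C zpow n) - (\<Sum>n<m. (a n * of_real r ^ n) *\<^sub>C zpow n))
        \<le> norm (f - zpow.fourier_sum f m)" if "k \<ge> m" for k
    proof -
      have "{..<k} = {..<m} \<union> {m..<k}" "{..<m} \<inter> {m..<k} = {}" using that by auto
      then have "(\<Sum>n<k. (a n * of_real r ^ n) *\<^sub>C zpow n) - (\<Sum>n<m. (a n * of_real r ^ n) *\<^sub>C zpow n)
          = (\<Sum>n=m..<k. (a n * of_real r ^ n) *\<^sub>C zpow n)"
        by (simp add: sum.union_disjoint)
      then show ?thesis using tail[OF r, of m k] by simp
    qed
    then show "\<exists>K. \<forall>k\<ge>K. norm ((\<Sum>n<k. (a n * of_real r ^ n) *\<^sub>C zpow n) - (\<Sum>n<m. (a n * of_real r ^ n) *\<^sub>C zpow n))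
        \<le> norm (f - zpow.fourier_sum f m)" by blast
  qed
  show "norm (abs_L2T (dilate F r)) \<le> norm f" if "0 \<le> r" "r < 1" for r
    using tail_limit[OF that, of 0] by (simp add: zpow.fourier_sum_def)
  show "((\<lambda>r. abs_L2T (dilate F r)) \<longlongrightarrow> f) (at_left 1)"
  proof (rule tendstoI)
    fix e :: real assume e: "e > 0"
    have "zpow.fourier_sum f \<longlonglongrightarrow> f" using f by (simp add: analytic_L2_def)
    from metric_LIMSEQ_D[OF this, of "e / 4"] e
    obtain m where m: "norm (f - zpow.fourier_sum f m) < e / 4"
      by (auto simp: dist_norm norm_minus_commute)
    have "((\<lambda>r::real. \<Sum>n<m. norm (a n) * \<bar>1 - r ^ n\<bar>) \<longlongrightarrow> (\<Sum>n<m. norm (a n) * \<bar>1 - 1 ^ n\<bar>)) (at_left 1)"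
      by (intro tendsto_intros)
    then have "((\<lambda>r::real. \<Sum>n<m. norm (a n) * \<bar>1 - r ^ n\<bar>) \<longlongrightarrow> 0) (at_left 1)" by simp
    then have "eventually (\<lambda>r::real. (\<Sum>n<m. norm (a n) * \<bar>1 - r ^ n\<bar>) < e / 4) (at_left 1)"
      by (rule order_tendstoD) (use e in simp)
    moreover have "eventually (\<lambda>r::real. r \<in> {0<..<1}) (at_left 1)"
      by (rule eventually_at_left_real) simp
    ultimately show "eventually (\<lambda>r. dist (abs_L2T (dilate F r)) f < e) (at_left 1)"
    proof eventually_elim
      case (elim r)
      then have r: "0 \<le> r" "r < 1" by auto
      let ?S = "\<Sum>n<m. (a n * of_real r ^ n) *\<^sub>C zpow n"
      have "zpow.fourier_sum f m - ?S = (\<Sum>n<m. (a n * (1 - of_real r ^ n)) *\<^sub>C zpow n)"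
        by (simp add: zpow.fourier_sum_def a_def right_diff_distrib L2T.scale_left_diff_distrib sum_subtractf)
      also have "norm \<dots> \<le> (\<Sum>n<m. norm (a n) * \<bar>1 - r ^ n\<bar>)"
      proof (rule sum_norm_le)
        fix n
        have "norm (1 - complex_of_real r ^ n) = \<bar>1 - r ^ n\<bar>"
          by (metis norm_of_real of_real_1 of_real_diff of_real_power)
        then show "norm ((a n * (1 - of_real r ^ n)) *\<^sub>C zpow n) \<le> norm (a n) * \<bar>1 - r ^ n\<bar>"
          by (simp add: zpow.norm_E norm_mult)
      qed
      finally have "norm (zpow.fourier_sum f m - ?S) < e / 4" using elim by linarith
      moreover have "norm (abs_L2T (dilate F r) - ?S) < e / 4"
        using tail_limit[OF r, of m] m by linarith
      moreover have "abs_L2T (dilate F r) - f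
          = (abs_L2T (dilate F r) - ?S) - (zpow.fourier_sum f m - ?S) - (f - zpow.fourier_sum f m)"
        by simp
      then have "norm (abs_L2T (dilate F r) - f) \<le> norm (abs_L2T (dilate F r) - ?S)
          + norm (zpow.fourier_sum f m - ?S) + norm (f - zpow.fourier_sum f m)"
        by (simp only: norm_diff_diff_le)
      ultimately show ?case using m e by (simp add: dist_norm)
    qed
  qed
qed

text \<open>
  A boundary function is the limit of dilates, which are themselves limits of polynomials. Conversely
  the Fourier coefficients of a member of the closed span are the Taylor coefficients of a suitable
  function on the disk.
\<close>

lemma hardy_space_eq: "hardy_space = analytic_L2"
proof
  show "analytic_L2 \<subseteq> hardy_space"
  proof
    fix f assume f: "f \<in> analytic_L2"
    define F where "F w = (\<Sum>n. cinner f (zpow n) * w ^ n)" for w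
    note facts = analytic_L2_dilates[OF f, folded F_def[abs_def]]
    have sq: "square_integrable (dilate F r)" if "0 \<le> r" "r < 1" for r
      using square_integrable_dilate[OF facts(1)] that .
    have "(\<integral>z. (norm (F (of_real r * z)))\<^sup>2 \<partial>circle) \<le> (norm f)\<^sup>2" if "0 \<le> r" "r < 1" for r
    proof -
      have "(norm (abs_L2T (dilate F r)))\<^sup>2 \<le> (norm f)\<^sup>2"
        using facts(2)[OF that] by (intro power_mono) auto
      then show ?thesis by (simp add: norm_squared_abs[OF sq[OF that]] dilate_def)
    qed
    then have disk: "F \<in> hardy_disk"
      unfolding hardy_disk_def using facts(1) by (auto intro!: bdd_aboveI[of _ "(norm f)\<^sup>2"])
    have "((\<lambda>r. (norm (abs_L2T (dilate F r) - f))\<^sup>2) \<longlongrightarrow> 0\<^sup>2) (at_left 1)"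
      by (intro tendsto_power tendsto_norm_zero LIM_zero facts(3))
    moreover have "eventually (\<lambda>r::real. r \<in> {0<..<1}) (at_left 1)"
      by (rule eventually_at_left_real) simp
    then have "eventually (\<lambda>r. (norm (abs_L2T (dilate F r) - f))\<^sup>2
        = (\<integral>z. (norm (F (of_real r * z) - rep_L2T f z))\<^sup>2 \<partial>circle)) (at_left 1)"
    proof eventually_elim
      case (elim r)
      then show ?case using norm_squared_abs_diff[OF sq[of r], of f] by (simp add: dilate_def)
    qed
    ultimately have "((\<lambda>r. \<integral>z. (norm (F (of_real r * z) - rep_L2T f z))\<^sup>2 \<partial>circle) \<longlongrightarrow> 0) (at_left 1)"
      using Lim_transform_eventually by fastforce
    then show "f \<in> hardy_space" unfolding hardy_space_def using disk by blast
  qed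
qed (rule hardy_space_subset)

section \<open>Multiplication by an inner function\<close>

text \<open>
  Multiplication by \<open>\<Theta>\<close> is unitary and commutes with \<open>U\<close>.
\<close>

lemma shift_space_mult_unimodular:
  assumes S: "shift_space S d" and \<Theta>: "bounded_symbol \<Theta>"
    and unimodular: "\<And>z. z \<in> sphere 0 1 \<Longrightarrow> norm (\<Theta> z) = 1"
  shows "shift_space (mult_L2T \<Theta> ` S) (mult_L2T \<Theta> d)"
proof -
  interpret S: shift_space S d by (rule S)
  let ?V = "mult_L2T \<Theta>" and ?V' = "mult_L2T (\<lambda>z. cnj (\<Theta> z))"
  note c = bounded_symbol_cnj[OF \<Theta>]
  have one: "\<Theta> z * cnj (\<Theta> z) = 1" if "z \<in> sphere 0 1" for z
    using unimodular[OF that] complex_norm_square[of "\<Theta> z"] by simp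
  have inv: "?V' (?V f) = f" "?V (?V' f) = f" for f
  proof -
    have "mult_L2T (\<lambda>z. \<Theta> z * cnj (\<Theta> z)) f = mult_L2T (\<lambda>_. 1) f"
      by (intro mult_L2T_cong bounded_symbol_continuous one) simp_all
    then show "?V' (?V f) = f" "?V (?V' f) = f"
      by (simp_all add: mult_L2T_mult \<Theta> c mult_L2T_one mult.commute)
  qed
  have inner: "cinner (?V f) (?V g) = cinner f g" for f g
    using cinner_mult_L2T_left[OF \<Theta>, of f "?V g"] inv by simp
  have commute: "U (?V f) = ?V (U f)" "U' (?V f) = ?V (U' f)" for f
    by (simp_all add: mult_L2T_mult \<Theta> bounded_symbol_id bounded_symbol_cnj_id mult.commute)
  have image: "f \<in> ?V ` S \<longleftrightarrow> ?V' f \<in> S" for f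
    using inv by (metis imageE imageI)
  show ?thesis
  proof
    show "closed (?V ` S)"
      unfolding closed_sequential_limits
    proof safe
      fix X f assume X: "\<forall>n. X n \<in> ?V ` S" "X \<longlonglongrightarrow> f"
      have "?V' f \<in> S"
      proof (rule closed_sequentially[OF S.closed _ tendsto_mult_L2T[OF c X(2)]])
        show "?V' (X n) \<in> S" for n using X(1) image by blast
      qed
      then show "f \<in> ?V ` S" by (simp only: image)
    qed
    show "L2T.subspace (?V ` S)"
    proof (rule L2T.subspaceI)
      show "0 \<in> ?V ` S"
        unfolding image using mult_L2T_scaleC[OF c, of 0 0] S.mem_zero by simp
      show "x + y \<in> ?V ` S" if "x \<in> ?V ` S" "y \<in> ?V ` S" for x y
        using that unfolding image by (simp add: mult_L2T_add[OF c] S.mem_add)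
      show "b *\<^sub>C x \<in> ?V ` S" if "x \<in> ?V ` S" for b x
        using that unfolding image by (simp add: mult_L2T_scaleC[OF c] S.mem_scale)
    qed
    show "?V d \<in> ?V ` S" using S.d_mem by (rule imageI)
    show "cinner (?V d) (?V d) = 1" by (simp add: inner S.cinner_d_d)
    fix f assume "f \<in> ?V ` S"
    then obtain g where g: "g \<in> S" "f = ?V g" by (rule imageE)
    show "U f \<in> ?V ` S" unfolding g(2) commute by (rule imageI[OF S.shift_mem[OF g(1)]])
    show "cinner (U f) (?V d) = 0"
      unfolding g(2) commute inner by (rule S.cinner_shift_d[OF g(1)])
    assume "cinner f (?V d) = 0"
    then have "cinner g d = 0" by (simp only: g(2) inner)
    from S.backshift_mem[OF g(1) this] show "U' f \<in> ?V ` S"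
      unfolding g(2) commute by (rule imageI)
  qed
qed

text \<open>
  Since multiplication operators commute with \<open>U\<close>, the image of 1 determines the images of all powers of
  \<open>z\<close>, and by continuity that of their closed span.
\<close>

lemma mult_L2T_image_subset_analytic_L2:
  assumes \<Theta>: "bounded_symbol \<Theta>" and base: "mult_L2T \<Theta> (zpow 0) \<in> analytic_L2"
  shows "mult_L2T \<Theta> ` analytic_L2 \<subseteq> analytic_L2"
proof safe
  fix f assume f: "f \<in> analytic_L2"
  have Z: "mult_L2T \<Theta> (zpow n) \<in> analytic_L2" for n
  proof (induction n)
    case (Suc n)
    have "mult_L2T \<Theta> (U (zpow n)) = U (mult_L2T \<Theta> (zpow n))"
      by (simp add: mult_L2T_mult \<Theta> bounded_symbol_id mult.commute)
    then show ?case using analytic_L2.shift_mem[OF Suc] by (simp add: shift_zpow)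
  qed (rule base)
  have "mult_L2T \<Theta> (\<Sum>n<m. c n *\<^sub>C zpow n) = (\<Sum>n<m. c n *\<^sub>C mult_L2T \<Theta> (zpow n))" for m c
    by (induction m) (simp_all add: mult_L2T_add[OF \<Theta>] mult_L2T_scaleC[OF \<Theta>]
        mult_L2T_diff[OF \<Theta>, of 0 0, simplified])
  moreover have "(\<Sum>n<m. c n *\<^sub>C mult_L2T \<Theta> (zpow n)) \<in> analytic_L2" for m c
    by (intro L2T.subspace_sum[OF subspace_analytic_L2] analytic_L2.mem_scale Z)
  ultimately have mem: "mult_L2T \<Theta> (zpow.fourier_sum f m) \<in> analytic_L2" for m
    by (simp add: zpow.fourier_sum_def)
  have "zpow.fourier_sum f \<longlonglongrightarrow> f" using f by (simp add: analytic_L2_def)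
  then show "mult_L2T \<Theta> f \<in> analytic_L2"
    by (rule closed_sequentially[OF closed_analytic_L2 mem tendsto_mult_L2T[OF \<Theta>]])
qed

text \<open>
  Boundedness of \<open>\<theta>\<close> allows dominated convergence, by which the dilates converge in \<open>L\<^sup>2\<close> to the boundary
  values; hence these are a member of the Hardy space.
\<close>

lemma inner_function_boundary:
  assumes \<theta>: "inner_function \<theta>"
  obtains \<Theta> where "bounded_symbol \<Theta>" "\<And>z. z \<in> sphere 0 1 \<Longrightarrow> norm (\<Theta> z) = 1"
    "AE z in circle. radial_limit \<theta> z = \<Theta> z" "mult_L2T \<Theta> (zpow 0) \<in> analytic_L2"
proof -
  have hol: "\<theta> holomorphic_on ball 0 1" and bdd: "bounded (\<theta> ` ball 0 1)"
    and ae: "AE z in circle. \<exists>w. norm w = 1 \<and> ((\<lambda>r::real. \<theta> (of_real r * z)) \<longlongrightarrow> w) (at_left 1)"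
    using \<theta> by (simp_all add: inner_function_def)
  obtain C where "\<forall>x\<in>\<theta> ` ball 0 1. norm x \<le> C" using bdd unfolding bounded_iff by blast
  then have C: "norm (\<theta> w) \<le> C" if "norm w < 1" for w using that by simp
  define r where "r n = 1 - 1 / real (Suc (Suc n))" for n
  have r: "0 \<le> r n" "r n < 1" for n by (simp_all add: r_def field_simps)
  have r1: "filterlim r (at_left 1) sequentially"
    unfolding r_def by real_asymp
  have sq: "square_integrable (dilate \<theta> (r n))" for n
    by (rule square_integrable_dilate[OF hol r])
  then have meas [measurable]: "dilate \<theta> (r n) \<in> borel_measurable circle" for n
    by (simp add: square_integrable_def)
  \<comment> \<open>The radial limit may fail to be measurable where it does not exist, so it is corrected there.\<close>
  define L where "L z = lim (\<lambda>n. dilate \<theta> (r n) z)" for z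
  have L [measurable]: "L \<in> borel_measurable circle"
    unfolding L_def by (intro borel_measurable_lim_metric) measurable
  define \<Theta> where "\<Theta> z = (if norm (L z) = 1 then L z else 1)" for z
  have [measurable]: "\<Theta> \<in> borel_measurable circle" unfolding \<Theta>_def by measurable
  have uni: "norm (\<Theta> z) = 1" for z by (simp add: \<Theta>_def)
  have bs: "bounded_symbol \<Theta>" by (rule bounded_symbolI[where C=1]) (simp_all add: uni)
  have lim: "AE z in circle. radial_limit \<theta> z = \<Theta> z \<and> (\<lambda>n. dilate \<theta> (r n) z) \<longlonglongrightarrow> \<Theta> z"
    using ae
  proof eventually_elim
    case (elim z)
    then obtain w where w: "norm w = 1" "((\<lambda>r::real. \<theta> (of_real r * z)) \<longlongrightarrow> w) (at_left 1)" by blast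
    have "radial_limit \<theta> z = w"
      unfolding radial_limit_def by (rule tendsto_Lim[OF _ w(2)]) simp
    moreover have seq: "(\<lambda>n. dilate \<theta> (r n) z) \<longlonglongrightarrow> w"
      unfolding dilate_def by (rule filterlim_compose[OF w(2) r1])
    moreover have "L z = w" unfolding L_def by (rule limI[OF seq])
    ultimately show ?case using w(1) by (simp add: \<Theta>_def)
  qed
  have sq\<Theta>: "square_integrable \<Theta>"
    using square_integrable_bounded_mult[OF bs, of "\<lambda>_. 1"] by (simp add: square_integrable_def)
  have "(\<lambda>n. \<integral>z. (norm (dilate \<theta> (r n) z - \<Theta> z))\<^sup>2 \<partial>circle) \<longlonglongrightarrow> (\<integral>z. 0 \<partial>circle)"
  proof (rule integral_dominated_convergence[where w = "\<lambda>_. (C + 1)\<^sup>2"])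
    show "AE z in circle. (\<lambda>n. (norm (dilate \<theta> (r n) z - \<Theta> z))\<^sup>2) \<longlonglongrightarrow> 0"
      using lim
    proof eventually_elim
      case (elim z)
      then have "(\<lambda>n. (norm (dilate \<theta> (r n) z - \<Theta> z))\<^sup>2) \<longlonglongrightarrow> 0\<^sup>2"
        by (intro tendsto_power tendsto_norm_zero LIM_zero) auto
      then show ?case by simp
    qed
    show "AE z in circle. norm ((norm (dilate \<theta> (r n) z - \<Theta> z))\<^sup>2) \<le> (C + 1)\<^sup>2" for n
    proof (rule AE_I2)
      fix z assume "z \<in> space circle"
      then have "norm (dilate \<theta> (r n) z) \<le> C"
        unfolding dilate_def using r[of n] by (intro C) (simp add: space_circle norm_mult)
      then have "norm (dilate \<theta> (r n) z - \<Theta> z) \<le> C + 1"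
        using norm_triangle_ineq4[of "dilate \<theta> (r n) z" "\<Theta> z"] uni[of z] by linarith
      then show "norm ((norm (dilate \<theta> (r n) z - \<Theta> z))\<^sup>2) \<le> (C + 1)\<^sup>2"
        by (simp add: power_mono)
    qed
  qed (simp_all, measurable)
  moreover have "(norm (abs_L2T (dilate \<theta> (r n)) - abs_L2T \<Theta>))\<^sup>2
      = (\<integral>z. (norm (dilate \<theta> (r n) z - \<Theta> z))\<^sup>2 \<partial>circle)" for n
    unfolding minus_abs_L2T[OF sq sq\<Theta>]
    using norm_squared_abs[OF square_integrable_add[OF sq square_integrable_scale[OF sq\<Theta>, of "-1"]]]
    by simp
  ultimately have "(\<lambda>n. (norm (abs_L2T (dilate \<theta> (r n)) - abs_L2T \<Theta>))\<^sup>2) \<longlonglongrightarrow> 0"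
    by simp
  then have "(\<lambda>n. sqrt ((norm (abs_L2T (dilate \<theta> (r n)) - abs_L2T \<Theta>))\<^sup>2)) \<longlonglongrightarrow> sqrt 0"
    by (rule tendsto_real_sqrt)
  then have "(\<lambda>n. abs_L2T (dilate \<theta> (r n)) - abs_L2T \<Theta>) \<longlonglongrightarrow> 0"
    by (simp add: tendsto_norm_zero_iff)
  then have conv: "(\<lambda>n. abs_L2T (dilate \<theta> (r n))) \<longlonglongrightarrow> abs_L2T \<Theta>" by (rule LIM_zero_cancel)
  have mem: "abs_L2T (dilate \<theta> (r n)) \<in> analytic_L2" for n
    by (rule dilate_mem_analytic_L2[OF hol r])
  have "abs_L2T \<Theta> \<in> analytic_L2"
    by (rule closed_sequentially[OF closed_analytic_L2 mem conv])
  moreover have "mult_L2T \<Theta> (zpow 0) = abs_L2T \<Theta>"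
    unfolding zpow_def by (simp add: mult_abs_L2T[OF bs] square_integrable_def)
  ultimately show ?thesis using that[OF bs uni] lim by auto
qed

section \<open>Rational functions without poles on the circle\<close>

text \<open>
  The circle has no isolated points.
\<close>

lemma continuous_agree_off_finite:
  fixes f g :: "complex \<Rightarrow> complex"
  assumes f: "continuous_on (sphere 0 1) f" and g: "continuous_on (sphere 0 1) g"
    and fin: "finite A" and eq: "\<And>z. z \<in> sphere 0 1 \<Longrightarrow> z \<notin> A \<Longrightarrow> f z = g z"
    and b: "b \<in> sphere 0 1"
  shows "f b = g b"
proof (rule ccontr)
  assume "f b \<noteq> g b"
  then have pos: "norm (f b - g b) > 0" by simp
  have "continuous_on (sphere 0 1) (\<lambda>z. f z - g z)" by (intro continuous_intros f g)
  then obtain e where e: "e > 0"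
    "\<And>z. z \<in> sphere 0 1 \<Longrightarrow> dist z b < e \<Longrightarrow> dist (f z - g z) (f b - g b) < norm (f b - g b)"
    using b pos unfolding continuous_on_iff by blast
  have "b islimpt sphere 0 1"
  proof (rule connected_imp_perfect[OF _ b])
    show "connected (sphere (0::complex) 1)" by (rule connected_sphere) simp
    have "(1::complex) \<in> sphere 0 1" "(-1::complex) \<in> sphere 0 1" by simp_all
    then show "sphere 0 1 \<noteq> {a}" for a :: complex by (metis one_neq_neg_one singletonD)
  qed
  then have "infinite (sphere 0 1 \<inter> ball b e)" using e(1) by (simp add: islimpt_eq_infinite_ball)
  then obtain z where z: "z \<in> sphere 0 1" "z \<in> ball b e" "z \<notin> A"
    using fin by (metis Int_iff finite_subset subsetI)
  then have "dist (f z - g z) (f b - g b) < norm (f b - g b)"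
    by (intro e(2)) (simp_all add: dist_commute)
  then show False using eq[OF z(1,3)] by (simp add: dist_norm norm_minus_commute)
qed

text \<open>
  By continuity \<open>R q = p\<close> holds on all of the circle, so a zero of \<open>q\<close> there is also a zero of \<open>p\<close> and
  the common factor can be cancelled.
\<close>

lemma rational_function_reduced:
  assumes R: "rational_function R" and cont: "continuous_on (sphere 0 1) R"
  shows "\<exists>p q. \<forall>z\<in>sphere 0 1. poly q z \<noteq> 0 \<and> R z = poly p z / poly q z"
proof -
  have reduce: "q \<noteq> 0 \<Longrightarrow> \<forall>z\<in>sphere 0 1. R z * poly q z = poly p z \<Longrightarrow>
      \<exists>p q. \<forall>z\<in>sphere 0 1. poly q z \<noteq> 0 \<and> R z = poly p z / poly q z" for p q
  proof (induction "degree q" arbitrary: p q rule: less_induct)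
    case less
    show ?case
    proof (cases "\<exists>b\<in>sphere 0 1. poly q b = 0")
      case False
      then have "\<forall>z\<in>sphere 0 1. poly q z \<noteq> 0 \<and> R z = poly p z / poly q z"
        using less.prems(2) by (metis nonzero_mult_div_cancel_right)
      then show ?thesis by (intro exI)
    next
      case True
      then obtain b where b: "b \<in> sphere 0 1" "poly q b = 0" by blast
      then have "poly p b = 0" using less.prems(2) by force
      then obtain p1 where p1: "p = [:-b, 1:] * p1" by (auto simp: poly_eq_0_iff_dvd)
      obtain q1 where q1: "q = [:-b, 1:] * q1" using b(2) by (auto simp: poly_eq_0_iff_dvd)
      have q1_nz: "q1 \<noteq> 0" using less.prems(1) q1 by auto
      have deg: "degree q1 < degree q"
        unfolding q1 using q1_nz by (subst degree_mult_eq) auto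
      have "R z * poly q1 z = poly p1 z" if z: "z \<in> sphere 0 1" for z
      proof (rule continuous_agree_off_finite[of "\<lambda>z. R z * poly q1 z" "poly p1" "{b}"])
        show "continuous_on (sphere 0 1) (\<lambda>z. R z * poly q1 z)"
          "continuous_on (sphere 0 1) (poly p1)" by (intro continuous_intros cont)+
        fix w assume w: "w \<in> sphere 0 1" "w \<notin> {b}"
        have "R w * poly q w = poly p w" using less.prems(2) w(1) by blast
        then have "(w - b) * (R w * poly q1 w) = (w - b) * poly p1 w"
          by (simp add: p1 q1 algebra_simps)
        then show "R w * poly q1 w = poly p1 w" using w(2) by simp
      qed (use z in simp_all)
      then show ?thesis by (intro less.hyps[OF deg q1_nz]) blast
    qed
  qed
  obtain p q where q: "q \<noteq> 0" and eq: "\<And>z. poly q z \<noteq> 0 \<Longrightarrow> R z = poly p z / poly q z"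
    using R unfolding rational_function_def by blast
  have "R z * poly q z = poly p z" if "z \<in> sphere 0 1" for z
  proof (rule continuous_agree_off_finite[of "\<lambda>z. R z * poly q z" "poly p" "{z. poly q z = 0}"])
    show "continuous_on (sphere 0 1) (\<lambda>z. R z * poly q z)"
      "continuous_on (sphere 0 1) (poly p)" by (intro continuous_intros cont)+
    show "finite {z. poly q z = 0}" using q by (rule poly_roots_finite)
  qed (use that eq in auto)
  then show ?thesis using reduce[OF q] by blast
qed

section \<open>The spectrum\<close>

lemma invertible_on_cong:
  assumes "\<And>f. f \<in> S \<Longrightarrow> T f = T' f"
  shows "invertible_on S T \<longleftrightarrow> invertible_on S T'"
proof -
  have "(\<forall>f\<in>S. R (T f) = f \<and> T (R f) = f) \<longleftrightarrow> (\<forall>f\<in>S. R (T' f) = f \<and> T' (R f) = f)"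
    if "bounded_operator_on S R" for R
    using assms bounded_operator_onD(1)[OF that] by auto
  then show ?thesis unfolding invertible_on_def by blast
qed

lemma fredholm_on_cong:
  assumes "\<And>f. f \<in> S \<Longrightarrow> T f = T' f"
  shows "fredholm_on S T \<longleftrightarrow> fredholm_on S T'"
proof -
  have "T ` S = T' ` S" using assms by (rule image_cong[OF refl])
  moreover have "{f \<in> S. T f = 0} = {f \<in> S. T' f = 0}" using assms by auto
  moreover have "(\<forall>f\<in>S. \<exists>g\<in>S. f - T g \<in> L2T.span B) \<longleftrightarrow> (\<forall>f\<in>S. \<exists>g\<in>S. f - T' g \<in> L2T.span B)" for B
    using assms by (simp cong: bex_cong)
  ultimately show ?thesis unfolding fredholm_on_def by simp
qed

lemma (in closed_subspace) invertible_on_imp_fredholm_on: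
  assumes T: "invertible_on S T" and T0: "\<And>f. f \<in> S \<Longrightarrow> T f \<in> S"
  shows "fredholm_on S T"
proof -
  obtain R where R: "bounded_operator_on S R" "\<forall>f\<in>S. R (T f) = f \<and> T (R f) = f"
    using T unfolding invertible_on_def by (elim exE conjE)
  note R' = bspec[OF R(2)]
  have RS: "R f \<in> S" if "f \<in> S" for f using bounded_operator_onD(1)[OF R(1) that] .
  have onto: "T ` S = S" using T0 R' RS by (metis image_subset_iff subsetI subset_antisym imageI)
  have ker: "f = 0" if "f \<in> S" "T f = 0" for f
    using R'[OF that(1)] bounded_operator_on_zero_eq[OF R(1)] that(2) by simp
  show ?thesis
    unfolding fredholm_on_def
  proof (intro conjI)
    show "closed (T ` S)" using closed by (simp add: onto)
    show "\<exists>B. finite B \<and> {f \<in> S. T f = 0} \<subseteq> L2T.span B"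
      using ker by (intro exI[of _ "{}"]) auto
    have "\<forall>f\<in>S. \<exists>g\<in>S. f - T g \<in> L2T.span {}"
      using R' RS by (intro ballI bexI[of _ "R _"]) (auto simp: L2T.span_zero)
    then show "\<exists>B. finite B \<and> B \<subseteq> S \<and> (\<forall>f\<in>S. \<exists>g\<in>S. f - T g \<in> L2T.span B)"
      by (intro exI[of _ "{}"]) simp
  qed
qed

theorem theorem8p11:
  fixes \<theta> R :: "complex \<Rightarrow> complex"
  assumes "inner_function \<theta>"
    and "rational_function R"
    and "continuous_on (sphere 0 1) R"
  shows "op_spectrum (orth_compl (model_space \<theta>)) (dual_toeplitz \<theta> R) =
           R ` sphere 0 1 \<union> point_spectrum (orth_compl (model_space \<theta>)) (dual_toeplitz \<theta> R)
       \<and> R ` sphere 0 1 \<union> point_spectrum (orth_compl (model_space \<theta>)) (dual_toeplitz \<theta> R) =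
           ess_spectrum (orth_compl (model_space \<theta>)) (dual_toeplitz \<theta> R)
             \<union> point_spectrum (orth_compl (model_space \<theta>)) (dual_toeplitz \<theta> R)"
proof -
  obtain \<Theta> where \<Theta>: "bounded_symbol \<Theta>" "\<And>z. z \<in> sphere 0 1 \<Longrightarrow> norm (\<Theta> z) = 1"
    and ae: "AE z in circle. radial_limit \<theta> z = \<Theta> z" and base: "mult_L2T \<Theta> (zpow 0) \<in> analytic_L2"
    using inner_function_boundary[OF assms(1)] by blast
  define N where "N = mult_L2T \<Theta> ` analytic_L2"
  have N: "shift_space N (mult_L2T \<Theta> (zpow 0))"
    unfolding N_def
    by (rule shift_space_mult_unimodular[OF analytic_L2.shift_space_axioms \<Theta>])
  interpret shift_pair analytic_L2 N "zpow 0" "mult_L2T \<Theta> (zpow 0)"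
  proof (rule shift_pair.intro[OF analytic_L2.shift_space_axioms N])
    show "shift_pair_axioms analytic_L2 N"
      by unfold_locales (simp add: N_def mult_L2T_image_subset_analytic_L2[OF \<Theta>(1) base])
  qed
  have "mult_L2T (radial_limit \<theta>) = mult_L2T \<Theta>"
    by (rule ext) (rule mult_L2T_cong_AE[OF \<Theta>(1) ae])
  then have M_eq: "orth_compl (model_space \<theta>) = M"
    by (simp only: M_def K_def) (simp add: model_space_def hardy_space_eq N_def)
  let ?D = "dual_toeplitz \<theta> R"
  have D: "?D f = orth_proj M (mult_L2T R f)" for f
    by (simp add: dual_toeplitz_def M_eq)
  obtain p q where pq: "\<forall>z\<in>sphere 0 1. poly q z \<noteq> 0 \<and> R z = poly p z / poly q z"
    using rational_function_reduced[OF assms(2,3)] by (elim exE)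
  then have q: "\<forall>z\<in>sphere 0 1. poly q z \<noteq> 0" by blast
  define P where "P c = p - smult c q" for c
  have P: "poly (P c) z / poly q z = R z - c" if "z \<in> sphere 0 1" for c z
    using bspec[OF pq that] by (simp add: P_def diff_divide_distrib)
  let ?T = "\<lambda>c f. orth_proj M (mult_L2T (\<lambda>z. poly (P c) z / poly q z) f)"
  have T: "?D f - c *\<^sub>C f = ?T c f" if f: "f \<in> M" for c f
  proof -
    have bs: "bounded_symbol R" by (rule bounded_symbol_continuous[OF assms(3)])
    have "mult_L2T (\<lambda>z. poly (P c) z / poly q z) f = mult_L2T (\<lambda>z. R z - c) f"
      by (intro mult_L2T_cong bounded_symbol_continuous continuous_intros assms(3) P)
    also have "\<dots> = mult_L2T R f - c *\<^sub>C f" by (rule mult_L2T_minus_const[OF bs])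
    finally have "mult_L2T R f = mult_L2T (\<lambda>z. poly (P c) z / poly q z) f + c *\<^sub>C f" by simp
    then have "orth_proj M (mult_L2T R f) = ?T c f + orth_proj M (c *\<^sub>C f)"
      by (simp only: M.orth_proj_add)
    then show ?thesis using M.orth_proj_id[OF M.mem_scale[OF f]] by (simp add: D)
  qed
  have op: "c \<in> op_spectrum M ?D \<longleftrightarrow> \<not> invertible_on M (?T c)" for c
    using invertible_on_cong[OF T] by (simp add: op_spectrum_def)
  have ess: "c \<in> ess_spectrum M ?D \<longleftrightarrow> \<not> fredholm_on M (?T c)" for c
    using fredholm_on_cong[OF T] by (simp add: ess_spectrum_def)
  have point: "c \<in> point_spectrum M ?D \<longleftrightarrow> (\<exists>f\<in>M. f \<noteq> 0 \<and> ?T c f = 0)" for c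
    unfolding point_spectrum_def by (simp add: T[symmetric] cong: bex_cong)
  have inv_fred: "invertible_on M (?T c) \<Longrightarrow> fredholm_on M (?T c)" for c
    by (erule M.invertible_on_imp_fredholm_on) (rule M.orth_proj_mem)
  have circle: "\<not> fredholm_on M (?T c)" if c: "c \<in> R ` sphere 0 1" for c
  proof -
    obtain a where a: "a \<in> sphere 0 1" "c = R a" using c by blast
    have "poly (P c) a = 0" using P[OF a(1), of c] bspec[OF q a(1)] a(2) by simp
    then show ?thesis using a(1) by (intro compression_not_fredholm[OF q]) auto
  qed
  have outside: "invertible_on M (?T c)" if c: "c \<notin> R ` sphere 0 1" "c \<notin> point_spectrum M ?D" for c
  proof (rule compression_invertible[OF _ q])
    show "\<forall>z\<in>sphere 0 1. poly (P c) z \<noteq> 0"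
    proof
      fix z :: complex assume z: "z \<in> sphere 0 1"
      have "R z - c \<noteq> 0" using c(1) z by auto
      then show "poly (P c) z \<noteq> 0" using P[OF z, of c] by auto
    qed
    show "f = 0" if "f \<in> M" "?T c f = 0" for f using c(2) that point by blast
  qed
  have eigen: "\<not> invertible_on M (?T c)" if c: "c \<in> point_spectrum M ?D" for c
  proof
    assume "invertible_on M (?T c)"
    then obtain S where S: "bounded_operator_on M S" "\<forall>f\<in>M. S (?T c f) = f \<and> ?T c (S f) = f"
      unfolding invertible_on_def by (elim exE conjE)
    obtain f where f: "f \<in> M" "f \<noteq> 0" "?T c f = 0" using c point by blast
    then show False using bspec[OF S(2) f(1)] M.bounded_operator_on_zero_eq[OF S(1)] by simp
  qed
  show ?thesis
    unfolding M_eq using op ess inv_fred circle outside eigen by blast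
qed

end
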